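(* Let $1\le b\le r$ be integers with $\gcd(r,b)=1$, and let $\gamma=\Theta(r^5+b^5)$ (a suitable value depending only on $r,b$, with $\gamma\ge 2$). There exists a randomized algorithm running in time $O(d\cdot n\cdot\log_\gamma n)$ that, given a set $P\subseteq\mathbb{R}^d$ of $n$ points, each colored red or blue, with $\mathrm{balance}(P)\ge b/r$ and with aspect ratio polynomial in $n$, computes an $(r,b)$-fairlet decomposition of $P$ whose expected cost with respect to $\mathrm{cost}_{\mathrm{median}}$ (with Euclidean distances) is within a factor $O(d\cdot(r^8+b^8)\cdot\log n)$ of the cost of an optimal $(r,b)$-fairlet decomposition of $P$.
   Context: The aspect ratio of $P$ is the ratio between the maximum and minimum distance between distinct points of $P$; it is assumed to be $n^{O(1)}$. For a finite set $S$ of points colored red or blue, with red part $S_r$ and blue part $S_b$, $\mathrm{balance}(S):=\min\{|S_r|/|S_b|,\,|S_b|/|S_r|\}$; the condition $\mathrm{balance}(S)\ge b/r$ means $b|S_r|\le r|S_b|$ and $b|S_b|\le r|S_r|$. An $(r,b)$-fairlet decomposition of $P$ is a partition $\mathcal{X}=\{D_1,\dots,D_m\}$ of $P$ such that every $D_i$ satisfies $|D_i|\le r+b$ and $\mathrm{balance}(D_i)\ge b/r$. The parts $D_i$ are called fairlets. For a finite nonempty set $S$ of points and a distance function $\mathrm{dist}$, $\mathrm{cost}_{\mathrm{median}}(S):=\min_{p\in S}\sum_{q\in S}\mathrm{dist}(p,q)$; the cost of a fairlet decomposition $\mathcal{X}$ is $\sum_{D\in\mathcal{X}}\mathrm{cost}_{\mathrm{median}}(D)$.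 An optimal decomposition minimizes this cost over all $(r,b)$-fairlet decompositions of $P$. Running time counts arithmetic operations at unit cost. *)

theory Defs
  imports "HOL-Probability.Probability" "HOL-Library.Disjoint_Sets"
begin

section \<open>Fairlet decompositions\<close>

datatype color = Red | Blue

definition red_part :: "('a \<Rightarrow> color) \<Rightarrow> 'a set \<Rightarrow> 'a set" where
  "red_part col S = {p \<in> S. col p = Red}"

definition blue_part :: "('a \<Rightarrow> color) \<Rightarrow> 'a set \<Rightarrow> 'a set" where
  "blue_part col S = {p \<in> S. col p = Blue}"

text \<open>Since \<open>x / 0 = 0\<close>, a set that misses one of the colours has balance \<open>0\<close>;
  see \<open>balance_ge_iff\<close> below for the division-free form.\<close>

definition balance :: "('a \<Rightarrow> color) \<Rightarrow> 'a set \<Rightarrow> real" where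
  "balance col S =
     min (real (card (red_part col S)) / real (card (blue_part col S)))
         (real (card (blue_part col S)) / real (card (red_part col S)))"

lemma balance_ge_iff:
  assumes "finite S" "S \<noteq> {}" "1 \<le> b" "1 \<le> r"
  shows "balance col S \<ge> real b / real r \<longleftrightarrow>
     b * card (red_part col S) \<le> r * card (blue_part col S) \<and>
     b * card (blue_part col S) \<le> r * card (red_part col S)"
proof -
  let ?R = "card (red_part col S)" and ?B = "card (blue_part col S)"
  have fin: "finite (red_part col S)" "finite (blue_part col S)"
    using assms(1) by (auto simp: red_part_def blue_part_def)
  have "S = red_part col S \<union> blue_part col S"
    using color.exhaust by (auto simp: red_part_def blue_part_def)
  hence ne: "?R \<noteq> 0 \<or> ?B \<noteq> 0"
    using fin assms(2) by (metis card_0_eq sup_bot.right_neutral)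
  show ?thesis
  proof (cases "?R = 0 \<or> ?B = 0")
    case True
    then show ?thesis using ne assms(3,4)
      by (auto simp: balance_def divide_simps)
  next
    case False
    hence "real ?R > 0" "real ?B > 0" "real r > 0" using assms(4) by auto
    hence "real b / real r \<le> real ?R / real ?B \<longleftrightarrow> real (b * ?B) \<le> real (r * ?R)"
      and "real b / real r \<le> real ?B / real ?R \<longleftrightarrow> real (b * ?R) \<le> real (r * ?B)"
      by (simp_all add: divide_simps mult.commute)
    then show ?thesis
      unfolding balance_def of_nat_le_iff by auto
  qed
qed

definition fairlet_decomposition ::
  "nat \<Rightarrow> nat \<Rightarrow> ('a \<Rightarrow> color) \<Rightarrow> 'a set \<Rightarrow> 'a set set \<Rightarrow> bool" where
  "fairlet_decomposition r b col P X \<longleftrightarrow>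
     partition_on P X \<and>
     (\<forall>D\<in>X. card D \<le> r + b \<and> balance col D \<ge> real b / real r)"

definition cost_median :: "('a \<Rightarrow> 'a \<Rightarrow> real) \<Rightarrow> 'a set \<Rightarrow> real" where
  "cost_median \<delta> S = Min ((\<lambda>p. \<Sum>q\<in>S. \<delta> p q) ` S)"

definition decomposition_cost :: "('a \<Rightarrow> 'a \<Rightarrow> real) \<Rightarrow> 'a set set \<Rightarrow> real" where
  "decomposition_cost \<delta> X = (\<Sum>D\<in>X. cost_median \<delta> D)"

definition optimal_cost ::
  "nat \<Rightarrow> nat \<Rightarrow> ('a \<Rightarrow> 'a \<Rightarrow> real) \<Rightarrow> ('a \<Rightarrow> color) \<Rightarrow> 'a set \<Rightarrow> real" where
  "optimal_cost r b \<delta> col P =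
     Min (decomposition_cost \<delta> ` {X. fairlet_decomposition r b col P X})"


section \<open>Points\<close>

text \<open>The dimension is part of an algorithm's input, so a point of \<open>\<real>\<^sup>d\<close> is a list of length \<open>d\<close>.\<close>

type_synonym point = "real list"

definition euclid_dist :: "point \<Rightarrow> point \<Rightarrow> real" where
  "euclid_dist p q = L2_set (\<lambda>i. p ! i - q ! i) {..<length p}"

definition aspect_ratio :: "point set \<Rightarrow> real" where
  "aspect_ratio P =
     Max {euclid_dist p q | p q. p \<in> P \<and> q \<in> P \<and> p \<noteq> q} /
     Min {euclid_dist p q | p q. p \<in> P \<and> q \<in> P \<and> p \<noteq> q}"


section \<open>Randomized real RAM\<close>

text \<open>
  The memory consists of arrays of reals; cell \<open>i\<close> of array \<open>a\<close> is \<open>m a i\<close>, and a program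
  can only name finitely many arrays. Indices are computed values (indirect addressing)
  and are rounded down to a natural number.

  Programs are finite syntactic objects that do not depend on the input, on the number of
  points, or on the dimension. Literals are integers rather than reals, so that a program
  cannot carry infinitely much information in a constant. Besides the field operations the
  machine has a unit-cost floor, as is usual for algorithms that locate points in grids.
  Randomness is supplied by drawing a uniform integer from \<open>{0, \<dots>, k - 1}\<close>.
\<close>

type_synonym memory = "nat \<Rightarrow> nat \<Rightarrow> real"

datatype aexp =
    Lit int
  | Get nat aexp
  | Plus aexp aexp
  | Minus aexp aexp
  | Times aexp aexp
  | Divide aexp aexp
  | Floor aexp

datatype bexp =
    Less aexp aexp
  | Neg bexp
  | Conj bexp bexp

datatype com =
    Skip
  | Assign nat aexp aexp
  | Random nat aexp aexp
  | Seq com com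
  | Cond bexp com com
  | While bexp com

definition addr :: "real \<Rightarrow> nat" where
  "addr x = nat \<lfloor>x\<rfloor>"

definition store :: "nat \<Rightarrow> nat \<Rightarrow> real \<Rightarrow> memory \<Rightarrow> memory" where
  "store a i x m = m(a := (m a)(i := x))"

fun aval :: "aexp \<Rightarrow> memory \<Rightarrow> real" where
  "aval (Lit k) m = of_int k"
| "aval (Get a e) m = m a (addr (aval e m))"
| "aval (Plus e f) m = aval e m + aval f m"
| "aval (Minus e f) m = aval e m - aval f m"
| "aval (Times e f) m = aval e m * aval f m"
| "aval (Divide e f) m = aval e m / aval f m"
| "aval (Floor e) m = of_int \<lfloor>aval e m\<rfloor>"

fun bval :: "bexp \<Rightarrow> memory \<Rightarrow> bool" where
  "bval (Less e f) m \<longleftrightarrow> aval e m < aval f m"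
| "bval (Neg c) m \<longleftrightarrow> \<not> bval c m"
| "bval (Conj c d) m \<longleftrightarrow> bval c m \<and> bval d m"

text \<open>Every literal, memory access, arithmetic operation, comparison and connective costs 1.\<close>

fun acost :: "aexp \<Rightarrow> nat" where
  "acost (Lit k) = 1"
| "acost (Get a e) = 1 + acost e"
| "acost (Plus e f) = 1 + acost e + acost f"
| "acost (Minus e f) = 1 + acost e + acost f"
| "acost (Times e f) = 1 + acost e + acost f"
| "acost (Divide e f) = 1 + acost e + acost f"
| "acost (Floor e) = 1 + acost e"

fun bcost :: "bexp \<Rightarrow> nat" where
  "bcost (Less e f) = 1 + acost e + acost f"
| "bcost (Neg c) = 1 + bcost c"
| "bcost (Conj c d) = 1 + bcost c + bcost d"

definition tick :: "nat \<Rightarrow> (memory \<times> nat) pmf \<Rightarrow> (memory \<times> nat) pmf" where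
  "tick k = map_pmf (\<lambda>(m, t). (m, k + t))"

text \<open>
  \<open>exec c m \<mu>\<close>: started in memory \<open>m\<close>, the program \<open>c\<close> terminates for \<^emph>\<open>every\<close> outcome of its
  random choices, and \<open>\<mu>\<close> is the joint distribution of the final memory and the running time.
\<close>

inductive exec :: "com \<Rightarrow> memory \<Rightarrow> (memory \<times> nat) pmf \<Rightarrow> bool" where
  Skip: "exec Skip m (return_pmf (m, 0))"
| Assign: "exec (Assign a i e) m
     (return_pmf (store a (addr (aval i m)) (aval e m) m, 1 + acost i + acost e))"
| Random: "0 < addr (aval e m) \<Longrightarrow> exec (Random a i e) m
     (map_pmf (\<lambda>k. (store a (addr (aval i m)) (real k) m, 1 + acost i + acost e))
       (pmf_of_set {..<addr (aval e m)}))"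
| Seq: "exec c m \<mu> \<Longrightarrow> (\<And>m' t. (m', t) \<in> set_pmf \<mu> \<Longrightarrow> exec d m' (\<nu> m')) \<Longrightarrow>
     exec (Seq c d) m (bind_pmf \<mu> (\<lambda>(m', t). tick t (\<nu> m')))"
| Cond: "exec (if bval e m then c else d) m \<mu> \<Longrightarrow> exec (Cond e c d) m (tick (bcost e) \<mu>)"
| While: "exec (Cond e (Seq c (While e c)) Skip) m \<mu> \<Longrightarrow> exec (While e c) m \<mu>"

lemma exec_finite: "exec c m \<mu> \<Longrightarrow> finite (set_pmf \<mu>)"
proof (induction rule: exec.induct)
  case (Random e m a i)
  then have "set_pmf (pmf_of_set {..<addr (aval e m)}) = {..<addr (aval e m)}"
    by (intro set_pmf_of_set) auto
  then show ?case by simp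
qed (auto simp: tick_def)

lemma exec_deterministic: "exec c m \<mu> \<Longrightarrow> exec c m \<mu>' \<Longrightarrow> \<mu>' = \<mu>"
proof (induction arbitrary: \<mu>' rule: exec.induct)
  case (Seq c m \<mu> d \<nu>)
  from Seq.prems obtain \<kappa> \<xi> where *: "exec c m \<kappa>"
    "\<And>m' t. (m', t) \<in> set_pmf \<kappa> \<Longrightarrow> exec d m' (\<xi> m')"
    "\<mu>' = bind_pmf \<kappa> (\<lambda>(m', t). tick t (\<xi> m'))"
    by (cases rule: exec.cases) auto
  have "\<kappa> = \<mu>" using Seq.IH(1) *(1) by blast
  moreover have "\<xi> m' = \<nu> m'" if "(m', t) \<in> set_pmf \<mu>" for m' t
    using Seq.IH(2)[OF that] *(2) that \<open>\<kappa> = \<mu>\<close> by blast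
  ultimately show ?case unfolding *(3) by (intro bind_pmf_cong) auto
next
  case (Cond e m c d \<mu>)
  from Cond.prems show ?case by (cases rule: exec.cases) (auto dest: Cond.IH)
next
  case (While e c m \<mu>)
  from While.prems show ?case by (cases rule: exec.cases) (auto dest: While.IH)
qed (auto elim: exec.cases)


section \<open>Input and output conventions\<close>

text \<open>
  Array 0 holds the number of points and the dimension, array 1 the coordinates point by point,
  array 2 the colours (1 for red, 0 for blue). All other cells are 0.
\<close>

definition input_memory :: "nat \<Rightarrow> point list \<Rightarrow> (point \<Rightarrow> color) \<Rightarrow> memory" where
  "input_memory d ps col = (\<lambda>a i.
     if a = 0 \<and> i = 0 then real (length ps)
     else if a = 0 \<and> i = 1 then real d
     else if a = 1 \<and> i < length ps * d then ps ! (i div d) ! (i mod d)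
     else if a = 2 \<and> i < length ps \<and> col (ps ! i) = Red then 1
     else 0)"

text \<open>Array 3 holds the output: two points are in the same part iff their cells carry equal labels.\<close>

definition output_decomposition :: "point list \<Rightarrow> memory \<Rightarrow> point set set" where
  "output_decomposition ps m =
     (\<lambda>i. {ps ! j | j. j < length ps \<and> m 3 j = m 3 i}) ` {..<length ps}"

end

theory Submission
  imports Defs
begin

text \<open>
  The algorithm works top-down on a random hierarchical grid with ratio of order \<open>(r + b)\<^sup>3\<close> between
  the levels. All current groups of points are balanced. A level splits every group by a randomly
  shifted grid whose cell diameter is smaller than the largest group diameter by that ratio. From every
  cell one removes the fewest points that make it balanced; the removed points of a group form its
  pool, which is enlarged by a bounded factor so that it is balanced as well, and is cut into fairlets.
  The rest of each cell is a group of the next level.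

  Call a point loose if its optimal fairlet is not contained in its group. A cell minus its loose points
  is balanced, so the pools have \<open>O((r + b)\<^sup>2)\<close> times as many points as there are loose points, and the
  removal makes \<open>O((r + b)\<^sup>3)\<close> times as many points loose; since the diameter drops by a larger factor,
  the product of diameter and number of loose points is a potential that pays for the new fairlets.
  It only grows when the grid cuts an optimal fairlet, which costs \<open>O((r + b)\<^sup>4 d)\<close> times the optimum
  per level in expectation. Measuring the true group diameter, rather than the side of a grid cell,
  keeps the number of levels independent of the dimension.
\<close>

section \<open>Running programs\<close>

text \<open>The time bound must hold for every random outcome, the cost bound only in expectation.
  So all randomness of a level is a single draw, a shift common to all coordinates, and the rest of
  the level is deterministic; the diameter drops by the ratio \<open>D\<close> whatever the draw,
  which limits the number of levels to about \<open>c * log D n\<close>. The program may not depend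
  on the exponent \<open>c\<close> of the aspect ratio, and it can only draw integers. It therefore
  chooses among \<open>n ^ n\<close> equidistant shifts: rounding adds at most
  \<open>d / n ^ n\<close> to the probability that a point is cut from its centre, and
  \<open>n ^ c \<le> c ^ c * n ^ n\<close> lets the distance to the centre pay for this. Hence
  \<open>c ^ c\<close> in the constant. The cost per level is of order \<open>(r + b) ^ 6\<close>:
  the weight of the potential gives exponent 2, the points loosened by a cut 1, the ratio of the
  scales 3. Up to a constant this is below \<open>r ^ 8 + b ^ 8\<close>, and
  \<open>r ^ 5 + b ^ 5 \<le> D ^ 5\<close> changes the base of the logarithm.\<close>

definition runs :: "com \<Rightarrow> memory \<Rightarrow> nat \<Rightarrow> (memory \<Rightarrow> bool) \<Rightarrow> bool" where
  "runs c m T Q \<longleftrightarrow> (\<exists>m' t. exec c m (return_pmf (m', t)) \<and> t \<le> T \<and> Q m')"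

lemma runs_mono: "runs c m T Q \<Longrightarrow> T \<le> T' \<Longrightarrow> (\<And>m'. Q m' \<Longrightarrow> Q' m') \<Longrightarrow> runs c m T' Q'"
  unfolding runs_def by (meson le_trans)

lemma runs_Skip: "Q m \<Longrightarrow> runs Skip m T Q"
  unfolding runs_def using exec.Skip by blast

lemma runs_Assign:
  "Q (store a (addr (aval i m)) (aval e m) m) \<Longrightarrow> 1 + acost i + acost e \<le> T \<Longrightarrow>
   runs (Assign a i e) m T Q"
  unfolding runs_def using exec.Assign by blast

lemma exec_Seq_return:
  assumes "exec c m (return_pmf (m', s))" "exec d m' (return_pmf (m'', t))"
  shows "exec (Seq c d) m (return_pmf (m'', s + t))"
proof -
  have "exec (Seq c d) m (bind_pmf (return_pmf (m', s)) (\<lambda>(m', t'). tick t' (return_pmf (m'', t))))"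
    using exec.Seq[of c m "return_pmf (m', s)" d "\<lambda>_. return_pmf (m'', t)"] assms by auto
  then show ?thesis by (simp add: bind_return_pmf tick_def)
qed

lemma runs_Seq: "runs c m S (\<lambda>m'. runs d m' T Q) \<Longrightarrow> S + T \<le> R \<Longrightarrow> runs (Seq c d) m R Q"
  unfolding runs_def using exec_Seq_return by (meson add_mono le_trans)

lemma exec_Cond_return:
  "exec (if bval e m then c else d) m (return_pmf (m', t)) \<Longrightarrow>
   exec (Cond e c d) m (return_pmf (m', bcost e + t))"
  using exec.Cond[of e m c d "return_pmf (m', t)"] by (simp add: tick_def)

lemma runs_Cond:
  "runs (if bval e m then c else d) m T Q \<Longrightarrow> bcost e + T \<le> R \<Longrightarrow> runs (Cond e c d) m R Q"
  unfolding runs_def using exec_Cond_return by (meson add_left_mono le_trans)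

lemma runs_While:
  "runs (Cond e (Seq c (While e c)) Skip) m T Q \<Longrightarrow> runs (While e c) m T Q"
  unfolding runs_def using exec.While by blast

text \<open>Without loops and random choices, execution is the function \<open>sem\<close>, which
  the simplifier evaluates, so loop bodies are verified by computation. Larger deterministic parts
  are treated through \<open>runs\<close>, whose final distribution is a point mass.\<close>

fun straight :: "com \<Rightarrow> bool" where
  "straight Skip = True"
| "straight (Assign a i e) = True"
| "straight (Random a i e) = False"
| "straight (Seq c d) = (straight c \<and> straight d)"
| "straight (Cond e c d) = (straight c \<and> straight d)"
| "straight (While e c) = False"

text \<open>The last equation gives \<open>Random\<close> and \<open>While\<close> a default value;
  \<open>sem\<close> is meaningful only under \<open>straight\<close>.\<close>

fun sem :: "com \<Rightarrow> memory \<Rightarrow> memory" where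
  "sem Skip m = m"
| "sem (Assign a i e) m = store a (addr (aval i m)) (aval e m) m"
| "sem (Seq c d) m = sem d (sem c m)"
| "sem (Cond e c d) m = (if bval e m then sem c m else sem d m)"
| "sem c m = m"

text \<open>Adding both branches of a conditional, instead of taking the larger, is a cruder bound
  that evaluates to a plain numeral.\<close>

fun wcost :: "com \<Rightarrow> nat" where
  "wcost Skip = 0"
| "wcost (Assign a i e) = 1 + acost i + acost e"
| "wcost (Seq c d) = wcost c + wcost d"
| "wcost (Cond e c d) = bcost e + (wcost c + wcost d)"
| "wcost c = 0"

lemma runs_sem: "straight c \<Longrightarrow> runs c m (wcost c) (\<lambda>m'. m' = sem c m)"
proof (induction c arbitrary: m)
  case (Seq c d)
  have "runs c m (wcost c) (\<lambda>m'. runs d m' (wcost d) (\<lambda>m''. m'' = sem (Seq c d) m))"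
    by (rule runs_mono[OF Seq.IH(1)]) (use Seq in simp_all)
  then show ?case by (rule runs_Seq) simp
next
  case (Cond e c d)
  have "runs (if bval e m then c else d) m (wcost c + wcost d) (\<lambda>m'. m' = sem (Cond e c d) m)"
  proof (cases "bval e m")
    case True
    have "runs c m (wcost c + wcost d) (\<lambda>m'. m' = sem (Cond e c d) m)"
      by (rule runs_mono[OF Cond.IH(1)]) (use Cond.prems True in simp_all)
    with True show ?thesis by simp
  next
    case False
    have "runs d m (wcost c + wcost d) (\<lambda>m'. m' = sem (Cond e c d) m)"
      by (rule runs_mono[OF Cond.IH(2)]) (use Cond.prems False in simp_all)
    with False show ?thesis by simp
  qed
  then show ?case by (rule runs_Cond) simp
qed (simp_all add: runs_Skip runs_Assign)

lemma runs_straight: "straight c \<Longrightarrow> Q (sem c m) \<Longrightarrow> wcost c \<le> T \<Longrightarrow> runs c m T Q"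
  by (rule runs_mono[OF runs_sem]) auto

definition For :: "nat \<Rightarrow> aexp \<Rightarrow> com \<Rightarrow> com" where
  "For v e c = Seq (Assign v (Lit 0) (Lit 0)) (While (Less (Get v (Lit 0)) e)
     (Seq c (Assign v (Lit 0) (Plus (Get v (Lit 0)) (Lit 1)))))"

lemma addr_of_nat [simp]: "addr (real k) = k" "addr 0 = 0" "addr 1 = 1" "addr (numeral w) = numeral w"
  by (simp_all add: addr_def)

lemma store_same [simp]: "store a i x m a = (m a)(i := x)"
  by (simp add: store_def)

lemma store_other [simp]: "a' \<noteq> a \<Longrightarrow> store a i x m a' = m a'"
  by (simp add: store_def)

text \<open>The invariant is required of the memory in which the counter has already been advanced,
  so a body only has to leave the counter alone. Initialisation costs 3, an increment 6, and a test
  is bounded by \<open>4 + acost e\<close>.\<close>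

lemma runs_For:
  assumes init: "I 0 (store v 0 0 m)"
    and bound: "\<And>i m. I i m \<Longrightarrow> aval e m = real N"
    and step: "\<And>i m. i < N \<Longrightarrow> I i m \<Longrightarrow> m v 0 = real i \<Longrightarrow>
      runs c m T (\<lambda>m'. m' v 0 = real i \<and> I (Suc i) (store v 0 (real (Suc i)) m'))"
    and final: "\<And>m'. I N m' \<Longrightarrow> Q m'"
    and cost: "3 + N * (T + 10 + acost e) + (4 + acost e) \<le> R"
  shows "runs (For v e c) m R Q"
proof -
  let ?b = "Less (Get v (Lit 0)) e"
  let ?c = "Seq c (Assign v (Lit 0) (Plus (Get v (Lit 0)) (Lit 1)))"
  \<comment> \<open>Induction on the number \<open>k\<close> of remaining iterations.\<close>
  have *: "runs (While ?b ?c) m (k * (T + 10 + acost e) + (4 + acost e)) Q"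
    if "I (N - k) m" "m v 0 = real (N - k)" "k \<le> N" for k m
    using that
  proof (induction k arbitrary: m)
    case 0
    have "\<not> bval ?b m" using 0 bound[OF 0(1)] by simp
    then show ?case
      by (intro runs_While, intro runs_Cond[where T = 0]) (use 0 final in \<open>simp_all add: runs_Skip\<close>)
  next
    case (Suc k)
    have lt: "N - Suc k < N" and S: "Suc (N - Suc k) = N - k" using Suc.prems by auto
    have b: "bval ?b m" unfolding bval.simps bound[OF Suc.prems(1)]
      using Suc.prems(2) lt by simp
    have "runs c m T (\<lambda>m'. runs (Assign v (Lit 0) (Plus (Get v (Lit 0)) (Lit 1))) m' 6
        (\<lambda>m'. I (N - k) m' \<and> m' v 0 = real (N - k)))"
    proof (rule runs_mono[OF step[OF lt Suc.prems(1,2)]], unfold S)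
      fix m' assume m': "m' v 0 = real (N - Suc k) \<and> I (N - k) (store v 0 (real (N - k)) m')"
      have "real (N - Suc k) + 1 = real (N - k)" unfolding S[symmetric] by simp
      then have "store v (addr (aval (Lit 0) m')) (aval (Plus (Get v (Lit 0)) (Lit 1)) m') m'
          = store v 0 (real (N - k)) m'" using m' by simp
      then show "runs (Assign v (Lit 0) (Plus (Get v (Lit 0)) (Lit 1))) m' 6
        (\<lambda>m'. I (N - k) m' \<and> m' v 0 = real (N - k))"
        using m' by (intro runs_Assign) simp_all
    qed (rule le_refl)
    then have "runs ?c m (T + 6) (\<lambda>m'. I (N - k) m' \<and> m' v 0 = real (N - k))"
      by (rule runs_Seq) simp
    then have "runs ?c m (T + 6) (\<lambda>m'. runs (While ?b ?c) m' (k * (T + 10 + acost e) + (4 + acost e)) Q)"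
      by (rule runs_mono) (use Suc.IH Suc.prems(3) in auto)
    then have "runs (Seq ?c (While ?b ?c)) m (T + 6 + (k * (T + 10 + acost e) + (4 + acost e))) Q"
      by (rule runs_Seq) simp
    with b show ?case
      by (intro runs_While, intro runs_Cond[where T = "T + 6 + (k * (T + 10 + acost e) + (4 + acost e))"]) simp_all
  qed
  have "runs (While ?b ?c) (store v 0 0 m) (N * (T + 10 + acost e) + (4 + acost e)) Q"
  proof (rule *[of N])
    show "I (N - N) (store v 0 0 m)" using init by simp
  qed (simp_all add: store_def)
  then have "runs (Assign v (Lit 0) (Lit 0)) m 3
      (\<lambda>m'. runs (While ?b ?c) m' (N * (T + 10 + acost e) + (4 + acost e)) Q)"
    by (intro runs_Assign) simp_all
  then show ?thesis unfolding For_def by (rule runs_Seq) (use cost in simp)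
qed

section \<open>Expected values over executions, and loops with bounded expected growth\<close>

definition expect :: "(memory \<times> nat) pmf \<Rightarrow> (memory \<Rightarrow> real) \<Rightarrow> real" where
  "expect \<mu> \<Phi> = measure_pmf.expectation \<mu> (\<lambda>x. \<Phi> (fst x))"

lemma expect_tick: "expect (tick k \<mu>) \<Phi> = expect \<mu> \<Phi>"
  unfolding expect_def tick_def by (simp add: case_prod_unfold)

lemma expect_return [simp]: "expect (return_pmf (m, t)) \<Phi> = \<Phi> m"
  unfolding expect_def by simp

text \<open>The tower rule. Every execution has finite support by \<open>exec_finite\<close>, which
  disposes of integrability.\<close>

lemma expect_bind:
  assumes "finite (set_pmf \<mu>)" "\<And>m t. (m, t) \<in> set_pmf \<mu> \<Longrightarrow> finite (set_pmf (\<nu> m))"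
  shows "expect (bind_pmf \<mu> (\<lambda>(m, t). tick t (\<nu> m))) \<Phi> = expect \<mu> (\<lambda>m. expect (\<nu> m) \<Phi>)"
proof -
  have "expect (bind_pmf \<mu> (\<lambda>(m, t). tick t (\<nu> m))) \<Phi>
      = measure_pmf.expectation \<mu> (\<lambda>x. expect (tick (snd x) (\<nu> (fst x))) \<Phi>)"
    unfolding expect_def
    by (subst pmf_expectation_bind[where A = "set_pmf \<mu>"])
      (use assms in \<open>auto simp: case_prod_unfold tick_def integral_measure_pmf[where A = "set_pmf \<mu>"] scaleR_conv_of_real\<close>)
  then show ?thesis by (simp add: expect_tick expect_def[of \<mu>] case_prod_unfold)
qed

lemma expect_mono:
  assumes "finite (set_pmf \<mu>)" "\<And>m t. (m, t) \<in> set_pmf \<mu> \<Longrightarrow> \<Phi> m \<le> \<Psi> m"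
  shows "expect \<mu> \<Phi> \<le> expect \<mu> \<Psi>"
  unfolding expect_def
  by (intro integral_mono_AE integrable_measure_pmf_finite)
    (use assms in \<open>auto simp: AE_measure_pmf_iff\<close>)

lemma expect_add_const:
  assumes "finite (set_pmf \<mu>)"
  shows "expect \<mu> (\<lambda>m. \<Phi> m + c) = expect \<mu> \<Phi> + c"
proof -
  have "integrable (measure_pmf \<mu>) (\<lambda>x. \<Phi> (fst x))"
    by (rule integrable_measure_pmf_finite[OF assms])
  then show ?thesis unfolding expect_def by (simp add: case_prod_unfold measure_pmf.prob_space)
qed

text \<open>Additive drift: each round raises the expectation of \<open>\<Phi>\<close> by at most
  \<open>q\<close>. The step hypothesis derives \<open>j < J\<close> from the invariant and the loop
  guard, so the bound on the number of rounds holds for every outcome of the random choices, not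
  merely on average.\<close>

lemma exec_While_expect:
  assumes step: "\<And>j m. I j m \<Longrightarrow> bval e m \<Longrightarrow> j < J \<and>
      (\<exists>\<mu>. exec c m \<mu> \<and> (\<forall>(m', t)\<in>set_pmf \<mu>. t \<le> T \<and> I (Suc j) m') \<and> expect \<mu> \<Phi> \<le> \<Phi> m + q)"
    and "I j m" "j \<le> J" "0 \<le> q"
  shows "\<exists>\<mu>. exec (While e c) m \<mu> \<and>
    (\<forall>(m', t)\<in>set_pmf \<mu>. t \<le> (J - j) * (T + bcost e) + bcost e \<and> (\<exists>j'. I j' m') \<and> \<not> bval e m') \<and>
    expect \<mu> \<Phi> \<le> \<Phi> m + real (J - j) * q"
  using assms(2,3)
proof (induction "J - j" arbitrary: j m rule: less_induct)
  case less
  show ?case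
  proof (cases "bval e m")
    case False
    have "exec (While e c) m (return_pmf (m, bcost e + 0))"
      using False by (intro exec.While exec_Cond_return) (simp add: exec.Skip)
    moreover have "0 \<le> real (J - j) * q" using \<open>0 \<le> q\<close> by simp
    ultimately show ?thesis using False less.prems
      by (intro exI[of _ "return_pmf (m, bcost e + 0)"]) auto
  next
    case True
    with step[OF less.prems(1)] obtain \<mu> where j: "j < J" and \<mu>: "exec c m \<mu>"
      "\<And>m' t. (m', t) \<in> set_pmf \<mu> \<Longrightarrow> t \<le> T \<and> I (Suc j) m'" "expect \<mu> \<Phi> \<le> \<Phi> m + q"
      by fast
    let ?P = "\<lambda>m' \<nu>. exec (While e c) m' \<nu> \<and>
      (\<forall>(m'', t)\<in>set_pmf \<nu>. t \<le> (J - Suc j) * (T + bcost e) + bcost e \<and> (\<exists>j'. I j' m'') \<and> \<not> bval e m'') \<and>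
      expect \<nu> \<Phi> \<le> \<Phi> m' + real (J - Suc j) * q"
    have "\<exists>\<nu>. ?P m' \<nu>" if "(m', t) \<in> set_pmf \<mu>" for m' t
    proof (rule less.hyps)
      show "J - Suc j < J - j" "Suc j \<le> J" using j by linarith+
      show "I (Suc j) m'" using \<mu>(2)[OF that] by blast
    qed
    \<comment> \<open>\<open>exec.Seq\<close> needs one function from intermediate memories to
      distributions; choice provides it.\<close>
    then have \<nu>: "?P m' (SOME \<nu>. ?P m' \<nu>)" if "(m', t) \<in> set_pmf \<mu>" for m' t
      using that someI_ex[of "?P m'"] by blast
    define \<nu> where "\<nu> m' = (SOME \<nu>. ?P m' \<nu>)" for m'
    note \<nu> = \<nu>[folded \<nu>_def]
    define \<kappa> where "\<kappa> = bind_pmf \<mu> (\<lambda>(m', t). tick t (\<nu> m'))"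
    have fin: "finite (set_pmf \<mu>)" "\<And>m' t. (m', t) \<in> set_pmf \<mu> \<Longrightarrow> finite (set_pmf (\<nu> m'))"
      using exec_finite \<mu>(1) \<nu> by blast+
    have Suc_diff: "J - j = Suc (J - Suc j)" using j by simp
    have "exec (Seq c (While e c)) m \<kappa>"
      unfolding \<kappa>_def using \<mu>(1) \<nu> by (intro exec.Seq) blast+
    then have "exec (While e c) m (tick (bcost e) \<kappa>)"
      using True by (intro exec.While exec.Cond) simp
    moreover have "t \<le> (J - j) * (T + bcost e) + bcost e \<and> (\<exists>j'. I j' m') \<and> \<not> bval e m'"
      if "(m', t) \<in> set_pmf (tick (bcost e) \<kappa>)" for m' t
    proof -
      from that obtain m1 t1 t2 where "(m1, t1) \<in> set_pmf \<mu>" "(m', t2) \<in> set_pmf (\<nu> m1)"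
        "t = bcost e + (t1 + t2)" by (auto simp: tick_def \<kappa>_def)
      moreover from this have "t1 \<le> T" "t2 \<le> (J - Suc j) * (T + bcost e) + bcost e"
        "\<exists>j'. I j' m'" "\<not> bval e m'" using \<mu>(2) \<nu> by blast+
      ultimately show ?thesis unfolding Suc_diff by simp
    qed
    moreover have "expect (tick (bcost e) \<kappa>) \<Phi> \<le> \<Phi> m + real (J - j) * q"
    proof -
      have "expect (tick (bcost e) \<kappa>) \<Phi> = expect \<mu> (\<lambda>m'. expect (\<nu> m') \<Phi>)"
        unfolding \<kappa>_def expect_tick using fin by (rule expect_bind)
      also have "\<dots> \<le> expect \<mu> (\<lambda>m'. \<Phi> m' + real (J - Suc j) * q)"
        using fin(1) \<nu> by (intro expect_mono) blast+
      also have "\<dots> \<le> \<Phi> m + q + real (J - Suc j) * q"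
        using \<mu>(3) fin(1) by (simp add: expect_add_const)
      finally show ?thesis unfolding Suc_diff of_nat_Suc by (simp only: algebra_simps)
    qed
    ultimately show ?thesis by blast
  qed
qed

section \<open>Random grids\<close>

text \<open>Nested floors collapse: for a positive integer \<open>K\<close>, the floor of
  \<open>y / K\<close> is the floor of \<open>y\<close>, divided by \<open>K\<close> with
  \<open>div\<close>.\<close>

lemma floor_add_fraction: "0 < K \<Longrightarrow> \<lfloor>x + real k / real K\<rfloor> = (\<lfloor>real K * x\<rfloor> + int k) div int K"
proof -
  assume "0 < K"
  then have "x + real k / real K = (real K * x + real_of_int (int k)) / real_of_int (int K)"
    by (simp add: field_simps)
  then show ?thesis
    by (simp only: floor_divide_real_eq_div floor_add_int of_nat_0_le_iff)
qed

text \<open>Moving a window of \<open>K\<close> consecutive integers up by one loses the term at its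
  lower end and gains one that is larger by exactly 1.\<close>

lemma sum_floor_shift:
  assumes "0 < K"
  shows "(\<Sum>k<K. (z + int m + int k) div int K) = (\<Sum>k<K. (z + int k) div int K) + int m"
proof (induction m)
  case (Suc m)
  let ?g = "\<lambda>k. (z + int m + int k) div int K"
  have "(\<Sum>k<K. (z + int (Suc m) + int k) div int K) = (\<Sum>k<K. ?g (Suc k))"
    by (intro sum.cong) (simp_all add: algebra_simps)
  also have "\<dots> = (\<Sum>k<K. ?g k) + ?g K - ?g 0"
    using sum.lessThan_Suc_shift[of ?g K] by simp
  also have "?g K = ?g 0 + 1" using assms by simp
  finally show ?case using Suc.IH by simp
qed simp

text \<open>By Hermite's identity the floors of \<open>y + k / K\<close> exceed those of \<open>x + k / K\<close> by
  \<open>\<lfloor>K y\<rfloor> - \<lfloor>K x\<rfloor>\<close> in total.\<close>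

lemma card_floor_neq_aux:
  assumes "0 < K" "x \<le> y"
  shows "real (card {k. k < K \<and> \<lfloor>x + real k / real K\<rfloor> \<noteq> \<lfloor>y + real k / real K\<rfloor>}) \<le> real K * (y - x) + 1"
proof -
  let ?F = "\<lambda>x k. \<lfloor>x + real k / real K\<rfloor>"
  have le: "?F x k \<le> ?F y k" for k using assms by (intro floor_mono) simp
  have "\<lfloor>real K * x\<rfloor> \<le> \<lfloor>real K * y\<rfloor>" using assms by (intro floor_mono mult_left_mono) simp_all
  then obtain m where m: "\<lfloor>real K * y\<rfloor> = \<lfloor>real K * x\<rfloor> + int m"
    using zle_iff_zadd by blast
  have "int (card {k. k < K \<and> ?F x k \<noteq> ?F y k}) = (\<Sum>k<K. if ?F x k \<noteq> ?F y k then 1 else 0)"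
    by (simp add: sum.If_cases Int_def)
  also have "\<dots> \<le> (\<Sum>k<K. ?F y k - ?F x k)" 
  proof (rule sum_mono)
    fix k show "(if ?F x k \<noteq> ?F y k then 1 else 0) \<le> ?F y k - ?F x k" using le[of k] by auto
  qed
  also have "\<dots> = int m"
    using sum_floor_shift[OF assms(1), of "\<lfloor>real K * x\<rfloor>" m] m
    by (simp add: sum_subtractf floor_add_fraction[OF assms(1)])
  finally have "real (card {k. k < K \<and> ?F x k \<noteq> ?F y k}) \<le> real m" by linarith
  also have "real m \<le> real K * (y - x) + 1" using m unfolding right_diff_distrib by linarith
  finally show ?thesis .
qed

lemma card_floor_neq:
  assumes "0 < K"
  shows "real (card {k. k < K \<and> \<lfloor>x + real k / real K\<rfloor> \<noteq> \<lfloor>y + real k / real K\<rfloor>}) \<le> real K * \<bar>x - y\<bar> + 1"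
proof (cases "x \<le> y")
  case True
  then show ?thesis using card_floor_neq_aux[OF assms True] by simp
next
  case False
  then have "y \<le> x" by simp
  from card_floor_neq_aux[OF assms this] False show ?thesis by (simp add: eq_commute[of "\<lfloor>x + _\<rfloor>"])
qed

text \<open>All coordinates use the same shift \<open>u\<close>. Cuts are estimated by a union bound
  over the coordinates, which holds without independence, so one random number per level
  suffices.\<close>

definition grid :: "nat \<Rightarrow> real \<Rightarrow> real \<Rightarrow> point \<Rightarrow> int list" where
  "grid d a u p = map (\<lambda>t. \<lfloor>p ! t / a + u\<rfloor>) [0..<d]"

text \<open>Cauchy-Schwarz against the all-ones vector.\<close>

lemma sum_abs_le_sqrt: "(\<Sum>t<d. \<bar>v t\<bar>) \<le> sqrt (real d) * L2_set v {..<d}"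
  using L2_set_mult_ineq[of "\<lambda>_. 1" v "{..<d}"] by (simp add: L2_set_def)

text \<open>Divided by \<open>K\<close>, this bounds the probability of a cut under a uniform shift
  by \<open>sqrt d * euclid_dist p q / a\<close>, plus \<open>d / K\<close> because each coordinate
  contributes a rounding error of one shift.\<close>

lemma card_grid_neq:
  assumes "0 < K" "0 < a" "length p = d"
  shows "real (card {k. k < K \<and> grid d a (real k / real K) p \<noteq> grid d a (real k / real K) q})
    \<le> real K * (sqrt (real d) * euclid_dist p q / a) + real d"
proof -
  let ?S = "\<lambda>t. {k. k < K \<and> \<lfloor>p ! t / a + real k / real K\<rfloor> \<noteq> \<lfloor>q ! t / a + real k / real K\<rfloor>}"
  have "{k. k < K \<and> grid d a (real k / real K) p \<noteq> grid d a (real k / real K) q} \<subseteq> (\<Union>t<d. ?S t)"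
    by (auto simp: grid_def)
  then have "card {k. k < K \<and> grid d a (real k / real K) p \<noteq> grid d a (real k / real K) q} \<le> card (\<Union>t<d. ?S t)"
    by (intro card_mono) auto
  also have "\<dots> \<le> (\<Sum>t<d. card (?S t))" by (rule card_UN_le) simp
  finally have "real (card {k. k < K \<and> grid d a (real k / real K) p \<noteq> grid d a (real k / real K) q})
      \<le> (\<Sum>t<d. real (card (?S t)))" by (simp flip: of_nat_sum)
  also have "\<dots> \<le> (\<Sum>t<d. real K * \<bar>p ! t / a - q ! t / a\<bar> + 1)"
    by (intro sum_mono card_floor_neq assms)
  also have "\<dots> = real K * ((\<Sum>t<d. \<bar>p ! t - q ! t\<bar>) / a) + real d"
    using assms(2) by (simp add: sum.distrib sum_distrib_left sum_divide_distrib flip: diff_divide_distrib)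
  also have "\<dots> \<le> real K * (sqrt (real d) * euclid_dist p q / a) + real d"
    using assms sum_abs_le_sqrt[of "\<lambda>t. p ! t - q ! t" d]
    by (intro add_right_mono mult_left_mono divide_right_mono) (simp_all add: euclid_dist_def)
  finally show ?thesis .
qed

lemma grid_eq_dist:
  assumes "grid d a u p = grid d a u q" "0 < a" "length p = d"
  shows "euclid_dist p q \<le> sqrt (real d) * a"
proof -
  have *: "\<bar>p ! t - q ! t\<bar> \<le> a" if "t < d" for t
  proof -
    have "\<lfloor>p ! t / a + u\<rfloor> = \<lfloor>q ! t / a + u\<rfloor>"
      using arg_cong[OF assms(1), of "\<lambda>l. l ! t"] that by (simp add: grid_def)
    then have "\<bar>p ! t / a - q ! t / a\<bar> < 1" by linarith
    then show ?thesis using assms(2) by (simp add: flip: diff_divide_distrib)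
  qed
  have "(\<Sum>t<d. (p ! t - q ! t)\<^sup>2) \<le> (\<Sum>t<d. a\<^sup>2)"
    using * by (intro sum_mono) (metis abs_le_square_iff abs_of_pos assms(2) lessThan_iff)
  then have "sqrt (\<Sum>t<d. (p ! t - q ! t)\<^sup>2) \<le> sqrt (real d * a\<^sup>2)" by simp
  then show ?thesis using assms by (simp add: euclid_dist_def L2_set_def real_sqrt_mult)
qed

section \<open>Fairlets from a balanced pool\<close>

lemma rank_bij:
  assumes "finite (S :: nat set)"
  shows "bij_betw (\<lambda>i. card {j\<in>S. j < i}) S {..<card S}"
proof -
  let ?r = "\<lambda>i. card {j\<in>S. j < i}"
  have less: "?r i < ?r i'" if "i \<in> S" "i < i'" for i i'
  proof (rule psubset_card_mono)
    have "i \<notin> {j\<in>S. j < i}" "i \<in> {j\<in>S. j < i'}" using that by simp_all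
    moreover have "{j\<in>S. j < i} \<subseteq> {j\<in>S. j < i'}" using that by auto
    ultimately show "{j\<in>S. j < i} \<subset> {j\<in>S. j < i'}" by blast
  qed (use assms in simp)
  have inj: "inj_on ?r S"
  proof (rule inj_onI, rule ccontr)
    fix i i' assume "i \<in> S" "i' \<in> S" "?r i = ?r i'" "i \<noteq> i'"
    then show False using less[of i i'] less[of i' i] by (cases "i < i'") auto
  qed
  have "?r i < card S" if "i \<in> S" for i
    using that assms by (intro psubset_card_mono) auto
  then have "?r ` S \<subseteq> {..<card S}" by blast
  then have "?r ` S = {..<card S}"
    using card_image[OF inj] by (intro card_subset_eq) auto
  with inj show ?thesis by (simp add: bij_betw_def)
qed

text \<open>Ranks run through \<open>{..<card S}\<close> exactly once, so a condition on ranks is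
  counted on an initial segment of the naturals. Kept points, pool points and fairlets are all
  selected by rank and counted this way.\<close>

lemma card_rank_filter:
  assumes "finite (S :: nat set)"
  shows "card {i\<in>S. Q (card {j\<in>S. j < i})} = card {p. p < card S \<and> Q p}"
proof -
  let ?r = "\<lambda>i. card {j\<in>S. j < i}"
  have b: "bij_betw ?r S {..<card S}" by (rule rank_bij[OF assms])
  have "bij_betw ?r {i\<in>S. Q (?r i)} {p. p < card S \<and> Q p}"
    unfolding bij_betw_def
  proof
    show "inj_on ?r {i\<in>S. Q (?r i)}" using b by (auto simp: bij_betw_def inj_on_def)
    show "?r ` {i\<in>S. Q (?r i)} = {p. p < card S \<and> Q p}"
    proof safe
      fix i assume "i \<in> S" "Q (?r i)"
      then show "?r i < card S" using bij_betw_apply[OF b] by auto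
    next
      fix p assume "p < card S" "Q p"
      then obtain i where "i \<in> S" "p = ?r i" using bij_betw_imp_surj_on[OF b] by blast
      with \<open>Q p\<close> show "p \<in> ?r ` {i\<in>S. Q (?r i)}" by blast
    qed
  qed
  then show ?thesis by (rule bij_betw_same_card)
qed

text \<open>\<open>block r b p M M'\<close> is the fairlet of the point of rank \<open>p\<close> of its colour, in a balanced set with
  \<open>M\<close> points of that colour and \<open>M'\<close> of the other: first come \<open>k\<close> fairlets with \<open>r + b\<close> points,
  then one that absorbs the remainder \<open>e\<close>, then pairs.\<close>

definition block_count :: "nat \<Rightarrow> nat \<Rightarrow> nat \<Rightarrow> nat" where
  "block_count r b z = z div (r - b)"

definition block_rest :: "nat \<Rightarrow> nat \<Rightarrow> nat \<Rightarrow> nat" where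
  "block_rest r b z = z - block_count r b z * (r - b)"

text \<open>The quotient \<open>b * e / (r - b)\<close> rounded up: the least \<open>y\<close> with
  \<open>b * (y + e) \<le> r * y\<close>, that is, the least number of minority points that balances
  \<open>y + e\<close> majority points.\<close>

definition block_mid :: "nat \<Rightarrow> nat \<Rightarrow> nat \<Rightarrow> nat" where
  "block_mid r b z = (b * block_rest r b z + (r - b - 1)) div (r - b)"

text \<open>The index names the fairlet: \<open>0, ..., k - 1\<close> for the full ones,
  \<open>k\<close> for the middle one, \<open>k + 1, ...\<close> for the pairs. Used for both
  colours, with their own \<open>u\<close> and \<open>v\<close>, it matches up the two halves of
  each fairlet.\<close>

definition cut_index :: "nat \<Rightarrow> nat \<Rightarrow> nat \<Rightarrow> nat \<Rightarrow> nat" where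
  "cut_index u k v p = (if p < u * k then p div u else if p < u * k + v then k else p + 1 + k - (u * k + v))"

definition block :: "nat \<Rightarrow> nat \<Rightarrow> nat \<Rightarrow> nat \<Rightarrow> nat \<Rightarrow> nat" where
  "block r b p M M' = (let z = max M M' - min M M'; k = block_count r b z; y = block_mid r b z in
     if M' < M then cut_index r k (y + block_rest r b z) p else cut_index b k y p)"

lemma card_cut_index:
  assumes "1 \<le> u" "u * k + v \<le> M"
  shows "card {p. p < M \<and> cut_index u k v p = l} =
    (if l < k then u else if l = k then v else if l - k - 1 < M - (u * k + v) then 1 else 0)"
proof -
  have div: "p div u < k" if "p < u * k" for p using that assms(1) by (simp add: less_mult_imp_div_less mult.commute)
  consider "l < k" | "l = k" | "k < l" "l - k - 1 < M - (u * k + v)" | "k < l" "\<not> l - k - 1 < M - (u * k + v)"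
    by linarith
  then show ?thesis
  proof cases
    case 1
    have "u * l + u \<le> u * k" using 1 by (metis Suc_leI mult_Suc_right mult_le_mono2 add.commute)
    have "p < M \<and> cut_index u k v p = l \<longleftrightarrow> u * l \<le> p \<and> p < u * l + u" for p
    proof
      assume p: "p < M \<and> cut_index u k v p = l"
      then have "p div u = l" using 1 by (auto simp: cut_index_def split: if_splits)
      then have "p = u * l + p mod u" "p mod u < u" using assms(1) by auto
      then show "u * l \<le> p \<and> p < u * l + u" by linarith
    next
      assume p: "u * l \<le> p \<and> p < u * l + u"
      then have "p div u = l" by (intro div_nat_eqI) (simp_all add: mult.commute)
      then show "p < M \<and> cut_index u k v p = l"
        using p \<open>u * l + u \<le> u * k\<close> assms(2) by (simp add: cut_index_def)
    qed
    then have "{p. p < M \<and> cut_index u k v p = l} = {u * l..<u * l + u}"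
      by (intro set_eqI) (simp only: mem_Collect_eq atLeastLessThan_iff)
    then show ?thesis using 1 by simp
  next
    case 2
    then have "p < M \<and> cut_index u k v p = l \<longleftrightarrow> p \<in> {u * k..<u * k + v}" for p
      using assms(2) div[of p] by (auto simp: cut_index_def)
    then have "{p. p < M \<and> cut_index u k v p = l} = {u * k..<u * k + v}"
      by (intro set_eqI) (simp only: mem_Collect_eq)
    then show ?thesis using 2 by simp
  next
    case 3
    then have "p < M \<and> cut_index u k v p = l \<longleftrightarrow> p \<in> {u * k + v + (l - k - 1)}" for p
      using assms(2) div[of p] by (auto simp: cut_index_def)
    then have "{p. p < M \<and> cut_index u k v p = l} = {u * k + v + (l - k - 1)}"
      by (intro set_eqI) (simp only: mem_Collect_eq)
    then show ?thesis using 3 by simp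
  next
    case 4
    then have "p < M \<and> cut_index u k v p = l \<longleftrightarrow> p \<in> {}" for p
      using assms(2) div[of p] by (auto simp: cut_index_def)
    then have "{p. p < M \<and> cut_index u k v p = l} = {}"
      by (intro set_eqI) (simp only: mem_Collect_eq)
    then show ?thesis using 4 by simp
  qed
qed

text \<open>The last two claims are the size limit for the middle fairlet and the minimality of
  \<open>y\<close>. If \<open>r = b\<close>, the divisions by zero yield 0, and the hypothesis that
  then \<open>z = 0\<close> keeps the identities true.\<close>

lemma block_mid_bounds:
  assumes "1 \<le> b" "b \<le> r"
    and e: "e = block_rest r b z" and y: "y = block_mid r b z" and k: "k = block_count r b z"
    and z: "r = b \<longrightarrow> z = 0"
  shows "z = (r - b) * k + e" "b * e \<le> (r - b) * y" "2 * y + e \<le> r + b"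
    "b * e \<le> (r - b) * w \<Longrightarrow> y \<le> w"
proof -
  have e': "e = z mod (r - b)"
    unfolding e block_rest_def block_count_def by (simp add: minus_div_mult_eq_mod)
  show zk: "z = (r - b) * k + e" unfolding e' k block_count_def by simp
  have y': "y = (b * e + (r - b - 1)) div (r - b)" unfolding y block_mid_def e ..
  have all: "b * e \<le> (r - b) * y \<and> 2 * y + e \<le> r + b \<and> (b * e \<le> (r - b) * w \<longrightarrow> y \<le> w)" for w
  proof (cases "r = b")
    case True
    with z e' y' show ?thesis by simp
  next
    case False
    then have s: "0 < r - b" using assms by simp
    have "e < r - b" using s e' by simp
    have d: "(r - b) * y + (b * e + (r - b - 1)) mod (r - b) = b * e + (r - b - 1)"
      unfolding y' by simp
    have m: "(b * e + (r - b - 1)) mod (r - b) < r - b" using s by simp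
    have 1: "b * e \<le> (r - b) * y" using d m s by linarith
    have 2: "y \<le> w" if "b * e \<le> (r - b) * w" for w
    proof (rule ccontr)
      assume "\<not> y \<le> w"
      then have "(r - b) * (w + 1) \<le> (r - b) * y" by (intro mult_le_mono2) simp
      moreover have "(r - b) * y \<le> b * e + (r - b - 1)" using d by linarith
      ultimately show False using that s unfolding distrib_left by linarith
    qed
    \<comment> \<open>So \<open>w = b\<close> is admissible and \<open>y \<le> b\<close>; with
      \<open>e < r - b\<close> the middle fairlet has at most \<open>2 * b + (r - b)\<close>
      points.\<close>
    have "b * e \<le> (r - b) * b" using \<open>e < r - b\<close> by (simp add: mult.commute)
    from 2[OF this] have "2 * y + e \<le> r + b" using \<open>e < r - b\<close> by linarith
    with 1 2 show ?thesis by blast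
  qed
  show "b * e \<le> (r - b) * y" "2 * y + e \<le> r + b" "b * e \<le> (r - b) * w \<Longrightarrow> y \<le> w"
    using all by blast+
qed

text \<open>The surplus of the majority is \<open>(r - b) * k + e\<close>. The full fairlets take up
  \<open>(r - b) * k\<close> of it and the middle one \<open>e\<close>, so equally many points of
  both colours remain for the pairs. That the minority suffices follows from
  \<open>b * M \<le> r * M'\<close>: it gives \<open>b * k \<le> M'\<close>, and then minimality of
  \<open>y\<close> gives \<open>y \<le> M' - b * k\<close>.\<close>

lemma block_fair_aux:
  assumes "1 \<le> b" "b \<le> r" "b * M \<le> r * M'" "M' \<le> M"
    and s: "s = card {p. p < M \<and> block r b p M M' = l}" and t: "t = card {p. p < M' \<and> block r b p M' M = l}"
  shows "b * s \<le> r * t \<and> b * t \<le> r * s \<and> s + t \<le> r + b"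
proof -
  define z where "z = M - M'"
  define k where "k = block_count r b z"
  define e where "e = block_rest r b z"
  define y where "y = block_mid r b z"
  have z0: "r = b \<longrightarrow> z = 0" using assms by (auto simp: z_def)
  note y = block_mid_bounds[OF assms(1,2) e_def y_def k_def z0]
  have zM: "M = M' + ((r - b) * k + e)" using y(1) assms(4) by (simp add: z_def)
  have rb: "(r - b) * x + b * x = r * x" for x using assms(2) by (simp flip: add_mult_distrib)
  have "b * M' + b * ((r - b) * k) + b * e \<le> r * M'"
    using assms(3) unfolding zM by (simp add: algebra_simps)
  also have "r * M' = (r - b) * M' + b * M'" by (simp add: rb)
  finally have 1: "(r - b) * (b * k) + b * e \<le> (r - b) * M'" by (simp add: mult.left_commute)
  have "b * k \<le> M'"
  proof (cases "r = b")
    case True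
    then show ?thesis using assms by (simp add: k_def block_count_def)
  next
    case False
    then have "0 < r - b" using assms(2) by simp
    moreover have "(r - b) * (b * k) \<le> (r - b) * M'" using 1 by linarith
    ultimately show ?thesis by simp
  qed
  moreover from this have "b * e \<le> (r - b) * (M' - b * k)" using 1 by (simp add: diff_mult_distrib2)
  then have "y \<le> M' - b * k" by (rule y(4))
  ultimately have yM: "b * k + y \<le> M'" by linarith
  have rk: "r * k = (r - b) * k + b * k" by (simp add: rb)
  then have yM2: "r * k + (y + e) \<le> M" "M - (r * k + (y + e)) = M' - (b * k + y)" using yM zM by linarith+
  have mm: "max M M' - min M M' = z" "max M' M - min M' M = z" using assms(4) by (simp_all add: z_def)
  have own: "block r b p M M' = cut_index r k (y + e) p" if "M' < M" for p
    unfolding block_def mm Let_def using that by (simp add: k_def y_def e_def)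
  have oth: "block r b p M' M = cut_index b k y p" for p
    unfolding block_def mm Let_def using assms(4) by (simp add: k_def y_def)
  have tt: "t = (if l < k then b else if l = k then y else if l - k - 1 < M' - (b * k + y) then 1 else 0)"
    unfolding t oth by (rule card_cut_index[OF assms(1) yM])
  show ?thesis
  proof (cases "M' < M")
    case True
    have "s = (if l < k then r else if l = k then y + e else if l - k - 1 < M' - (b * k + y) then 1 else 0)"
      unfolding s own[OF True] using card_cut_index[OF _ yM2(1)] assms(1,2) unfolding yM2(2) by simp
    moreover have "b * (y + e) \<le> r * y" using y(2) rb[of y] by (simp add: distrib_left)
    moreover have "b * y \<le> r * (y + e)" using assms(2) by (simp add: mult_le_mono)
    moreover have "b * b \<le> r * r" using assms(2) by (simp add: mult_le_mono)
    ultimately show ?thesis unfolding tt using y(3) assms(1,2)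
      by (simp split: if_split)
  next
    \<comment> \<open>For equal counts both colours are cut by the second branch of
      \<open>block\<close>; then \<open>k\<close>, \<open>e\<close> and \<open>y\<close> are 0 and
      all fairlets are pairs.\<close>
    case False
    then have "M = M'" using assms(4) by simp
    then have "s = t" unfolding s t by simp
    have "z = 0" using \<open>M = M'\<close> by (simp add: z_def)
    then have "k = 0" "e = 0" by (simp_all add: k_def e_def block_count_def block_rest_def)
    then have "y = 0" using y(4)[of 0] by simp
    have "t \<le> 1" using tt \<open>k = 0\<close> \<open>y = 0\<close> by (auto split: if_splits)
    then show ?thesis using \<open>s = t\<close> assms(1,2) by simp
  qed
qed

lemma block_fair:
  assumes "1 \<le> b" "b \<le> r" "b * M \<le> r * M'" "b * M' \<le> r * M"
    and s: "s = card {p. p < M \<and> block r b p M M' = l}" and t: "t = card {p. p < M' \<and> block r b p M' M = l}"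
  shows "b * s \<le> r * t \<and> b * t \<le> r * s \<and> s + t \<le> r + b"
proof (cases "M' \<le> M")
  case True
  show ?thesis by (rule block_fair_aux[OF assms(1,2,3) True s t])
next
  case False
  then have "M \<le> M'" by simp
  from block_fair_aux[OF assms(1,2,4) this t s] show ?thesis by linarith
qed

section \<open>Balancing the pool\<close>

text \<open>\<open>ext r b ke kf pe pf\<close> moves points from a cell that keeps \<open>ke\<close> and \<open>kf\<close> points of the two
  colours to a pool with \<open>pe\<close> and \<open>pf\<close> points, when \<open>e\<close> is in excess in the pool. The first
  step moves points of colour \<open>f\<close> only; the second brings the cell to the extreme ratio \<open>r : b\<close>.\<close>

definition ext_move :: "nat \<Rightarrow> nat \<Rightarrow> nat \<Rightarrow> nat \<Rightarrow> nat \<Rightarrow> nat \<Rightarrow> nat" where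
  "ext_move r b ke kf pe pf = min ((r * kf - b * ke) div r) ((b * pe - r * pf + (r - 1)) div r)"

definition ext :: "nat \<Rightarrow> nat \<Rightarrow> nat \<Rightarrow> nat \<Rightarrow> nat \<Rightarrow> nat \<Rightarrow> nat \<times> nat \<times> nat \<times> nat" where
  "ext r b ke kf pe pf =
     (if b * pe \<le> r * pf then (ke, kf, pe, pf)
      else let t = ext_move r b ke kf pe pf; h = ke div r in
        if r * t < b * pe - r * pf then (r * h, b * h, pe + (ke - r * h), pf + (kf - b * h))
        else (ke, kf - t, pe, pf + t))"

definition bal2 :: "nat \<Rightarrow> nat \<Rightarrow> nat \<Rightarrow> nat \<Rightarrow> bool" where
  "bal2 r b x y \<longleftrightarrow> b * x \<le> r * y \<and> b * y \<le> r * x"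

text \<open>Write \<open>ke = r * h + i\<close>, \<open>kf = b * h + j\<close> and \<open>s\<close>
  for the slack \<open>r * kf - b * ke\<close>; then \<open>r * j = b * i + s\<close>. For
  \<open>s = 0\<close> coprimality forces \<open>i = 0\<close>, and nothing is removed; for
  \<open>s > 0\<close> one has \<open>i + j \<le> r + b\<close>, at most \<open>(r + b) * s\<close>.
  So the cost of rounding the cell down to \<open>r * h\<close> and \<open>b * h\<close> points is
  charged to its slack.\<close>

lemma extreme_ratio:
  assumes "1 \<le> (b :: nat)" "b \<le> r" "coprime r b" "b * ke \<le> r * kf" "r * kf < b * ke + r"
  shows "b * (ke div r) \<le> kf" "(ke - r * (ke div r)) + (kf - b * (ke div r)) \<le> (r + b) * (r * kf - b * ke)"
    "bal2 r b (r * (ke div r)) (b * (ke div r))"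
proof -
  define h i where "h = ke div r" and "i = ke mod r"
  have ke: "ke = r * h + i" by (simp add: h_def i_def)
  have i: "i < r" using assms(1,2) by (simp add: i_def)
  have "b * ke = r * (b * h) + b * i" unfolding ke by (simp add: algebra_simps)
  then have "r * (b * h) \<le> r * kf" using assms(4) by linarith
  then show le: "b * (ke div r) \<le> kf" using assms(1,2) by (simp add: h_def)
  define j where "j = kf - b * h"
  have kf: "kf = b * h + j" using le by (simp add: j_def h_def)
  define s where "s = r * kf - b * ke"
  have "r * kf = b * ke + s" using assms(4) by (simp add: s_def)
  then have rj: "r * j = b * i + s" unfolding ke kf by (simp add: algebra_simps)
  have s: "s < r" using assms(1,2,5) by (simp add: s_def)
  have "i + j \<le> (r + b) * s"
  proof (cases "s = 0")
    case True
    then have "r dvd b * i" using rj by (metis add.right_neutral dvd_triv_left)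
    then have "r dvd i" using assms(3) by (simp add: coprime_dvd_mult_right_iff)
    then have "i = 0" using i by (meson dvd_imp_le not_le zero_less_iff_neq_zero)
    then show ?thesis using rj True assms(1,2) by simp
  next
    case False
    have "b * (i + 1) \<le> b * r" using i by (intro mult_le_mono2) simp
    then have "r * j < r * (b + 1)" using rj s unfolding distrib_left by (simp add: mult.commute)
    then have "j < b + 1" by (simp only: mult_less_cancel1)
    then have "j \<le> b" by simp
    then have "i + j \<le> r + b" using i by simp
    also have "\<dots> \<le> (r + b) * s" using False by simp
    finally show ?thesis .
  qed
  moreover have "i = ke - r * h" using ke by simp
  ultimately show "(ke - r * (ke div r)) + (kf - b * (ke div r)) \<le> (r + b) * (r * kf - b * ke)"
    by (simp only: j_def s_def h_def)
  have "b * (b * h) \<le> r * (r * h)" using assms(2) by (simp add: mult_le_mono)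
  then show "bal2 r b (r * (ke div r)) (b * (ke div r))"
    by (simp add: bal2_def h_def mult.left_commute)
qed

text \<open>The last claim is an amortisation: the size of the pool plus \<open>r + b\<close> times
  its deficit \<open>b * pe - r * pf\<close> never grows, so every moved point is paid for by a
  smaller deficit. A pool that stays short leaves the cell at exactly the ratio
  \<open>r : b\<close>; a pool that is served overshoots by less than \<open>r\<close>.\<close>

lemma ext_props:
  assumes rb: "1 \<le> b" "b \<le> r" "coprime r b"
    and cell: "bal2 r b ke kf" and ex: "r * pf < b * pe"
    and eq: "ext r b ke kf pe pf = (ke', kf', pe', pf')"
  shows "ke' \<le> ke" "kf' \<le> kf" "pe' + ke' = pe + ke" "pf' + kf' = pf + kf" "bal2 r b ke' kf'"
    "(r * pf' < b * pe' \<and> r * kf' = b * ke') \<or> (b * pe' \<le> r * pf' \<and> r * pf' < b * pe' + r)"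
    "int (pe' + pf') + int (r + b) * (int (b * pe') - int (r * pf'))
       \<le> int (pe + pf) + int (r + b) * (int (b * pe) - int (r * pf))"
proof -
  have r: "1 \<le> r" using rb by simp
  \<comment> \<open>\<open>\<delta>\<close> is the deficit of the pool and \<open>\<sigma>\<close>
    the slack of the cell; moving one point of colour \<open>f\<close> lowers both by
    \<open>r\<close>.\<close>
  define \<delta> where "\<delta> = b * pe - r * pf"
  define \<sigma> where "\<sigma> = r * kf - b * ke"
  define t where "t = ext_move r b ke kf pe pf"
  define h where "h = ke div r"
  have \<delta>: "b * pe = r * pf + \<delta>" "0 < \<delta>" using ex by (simp_all add: \<delta>_def)
  have \<sigma>: "r * kf = b * ke + \<sigma>" using cell by (simp add: \<sigma>_def bal2_def)
  have t: "t = min (\<sigma> div r) ((\<delta> + (r - 1)) div r)" by (simp add: t_def ext_move_def \<sigma>_def \<delta>_def)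
  have "r * (\<sigma> div r) \<le> \<sigma>" by simp
  then have t\<sigma>: "r * t \<le> \<sigma>" unfolding t by (meson le_trans min.cobounded1 mult_le_mono2)
  have "r * ((\<delta> + (r - 1)) div r) \<le> \<delta> + (r - 1)" by simp
  then have t\<delta>: "r * t < \<delta> + r" unfolding t using r
    by (meson le_trans min.cobounded2 mult_le_mono2 add_less_cancel_left diff_less less_one order_le_less_trans zero_less_one less_le_trans)
  have "r * t \<le> r * kf" using t\<sigma> \<sigma> by simp
  then have tk: "t \<le> kf" using r by simp
  \<comment> \<open>If the moved points do not meet the deficit, then \<open>t\<close> was limited
    by the slack, of which less than \<open>r\<close> is left.\<close>
  have full: "\<sigma> < r * t + r" if "r * t < \<delta>"
  proof -
    have "\<not> (\<delta> + (r - 1)) div r \<le> t"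
    proof
      assume "(\<delta> + (r - 1)) div r \<le> t"
      then have "r * ((\<delta> + (r - 1)) div r) \<le> r * t" by (rule mult_le_mono2)
      moreover have "(\<delta> + (r - 1)) mod r < r" using r by simp
      moreover have "\<delta> + (r - 1) = r * ((\<delta> + (r - 1)) div r) + (\<delta> + (r - 1)) mod r" by simp
      ultimately show False using that by linarith
    qed
    then have "t = \<sigma> div r" unfolding t by (simp add: min_def split: if_splits)
    then have "\<sigma> = r * t + \<sigma> mod r" "\<sigma> mod r < r" using r by simp_all
    then show ?thesis by linarith
  qed
  have goals: "ke' \<le> ke \<and> kf' \<le> kf \<and> pe' + ke' = pe + ke \<and> pf' + kf' = pf + kf \<and> bal2 r b ke' kf' \<and>
    ((r * pf' < b * pe' \<and> r * kf' = b * ke') \<or> (b * pe' \<le> r * pf' \<and> r * pf' < b * pe' + r)) \<and>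
    int (pe' + pf') + int (r + b) * (int (b * pe') - int (r * pf'))
       \<le> int (pe + pf) + int (r + b) * (int (b * pe) - int (r * pf))"
  proof (cases "r * t < \<delta>")
    case False
    then have eq': "ke' = ke" "kf' = kf - t" "pe' = pe" "pf' = pf + t"
      using eq ex unfolding ext_def by (simp_all add: Let_def flip: t_def \<delta>_def)
    have rkf: "r * kf' = r * kf - r * t" unfolding eq' by (simp add: diff_mult_distrib2)
    have b1: "b * ke' \<le> r * kf'" unfolding rkf eq'(1) using t\<sigma> \<sigma> by linarith
    have b2: "b * kf' \<le> r * ke'" unfolding eq' using cell unfolding bal2_def
      by (meson diff_le_self le_trans mult_le_mono2)
    have p: "r * pf' = r * pf + r * t" unfolding eq' by (simp add: distrib_left)
    have q: "b * pe' \<le> r * pf'" "r * pf' < b * pe' + r" unfolding p eq'(3) using False \<delta> t\<delta> by linarith+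
    have "int t \<le> int (r + b) * int (r * t)"
    proof -
      have "1 * t \<le> (r + b) * r * t" using r by (intro mult_le_mono1) simp
      then have "int t \<le> int ((r + b) * (r * t))" by (simp only: of_nat_le_iff mult.assoc mult_1)
      then show ?thesis by (simp only: of_nat_mult)
    qed
    then have "int (pe' + pf') + int (r + b) * (int (b * pe') - int (r * pf'))
       \<le> int (pe + pf) + int (r + b) * (int (b * pe) - int (r * pf))"
      unfolding p eq'(3) eq'(4) by (simp add: algebra_simps)
    then show ?thesis using b1 b2 q tk eq' by (simp add: bal2_def)
  next
    case True
    then have "ext r b ke kf pe pf = (r * h, b * h, pe + (ke - r * h), pf + (kf - b * h))"
      using ex unfolding ext_def by (simp add: Let_def flip: t_def \<delta>_def h_def)
    from eq[unfolded this prod.inject] have eq': "ke' = r * h" "kf' = b * h"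
      "pe' = pe + (ke - r * h)" "pf' = pf + (kf - b * h)" by blast+
    have kt: "r * (kf - t) = b * ke + (\<sigma> - r * t)" using \<sigma> t\<sigma> by (simp add: diff_mult_distrib2)
    have kt1: "b * ke \<le> r * (kf - t)" and kt2: "r * (kf - t) < b * ke + r"
      using full[OF True] t\<sigma> r unfolding kt by linarith+
    have X: "b * h \<le> kf - t" "(ke - r * h) + (kf - t - b * h) \<le> (r + b) * (r * (kf - t) - b * ke)"
      "bal2 r b (r * h) (b * h)"
      using extreme_ratio[OF rb kt1 kt2] by (simp_all only: h_def)
    have le: "r * h \<le> ke" by (simp add: h_def)
    have ipe: "int pe' = int pe + int ke - int r * int h"
      unfolding eq' of_nat_add of_nat_diff[OF le] by simp
    have "b * h \<le> kf" using X(1) by simp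
    then have ipf: "int pf' = int pf + int kf - int b * int h"
      unfolding eq' by (simp add: of_nat_diff)
    have bpe: "int (b * pe') = int (b * pe) + int (b * ke) - int (b * (r * h))"
      unfolding of_nat_mult ipe by (simp add: algebra_simps)
    have rpf: "int (r * pf') = int (r * pf) + int (r * kf) - int (b * (r * h))"
      unfolding of_nat_mult ipf by (simp add: algebra_simps)
    \<comment> \<open>A cell at ratio \<open>r : b\<close> has slack 0, so its entire slack has been
      taken off the deficit, which may thereby become negative, but by less than
      \<open>r\<close>.\<close>
    have diff: "int (b * pe') - int (r * pf') = int \<delta> - int \<sigma>" unfolding bpe rpf \<delta>(1) \<sigma> by simp
    have "int \<sigma> < int \<delta> + int r" using full[OF True] True by linarith
    then have alt: "(r * pf' < b * pe' \<and> r * kf' = b * ke') \<or> (b * pe' \<le> r * pf' \<and> r * pf' < b * pe' + r)"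
    proof -
      have "int (r * pf') < int (b * pe') + int r" using diff \<open>int \<sigma> < int \<delta> + int r\<close> by linarith
      then have "r * pf' < b * pe' + r" by (simp only: of_nat_less_iff flip: of_nat_add)
      moreover have "r * kf' = b * ke'" unfolding eq' by (simp only: mult.left_commute)
      ultimately show ?thesis by linarith
    qed
    have "int (ke - r * h) + int (kf - b * h) \<le> int (r + b) * int \<sigma>"
    proof -
      have "(ke - r * h) + (kf - t - b * h) + t \<le> (r + b) * (\<sigma> - r * t) + t" using X(2) kt by simp
      also have "t \<le> (r + b) * (r * t)"
      proof -
        have "1 * t \<le> (r + b) * r * t" using r by (intro mult_le_mono1) simp
        then show ?thesis by (simp only: mult.assoc mult_1)
      qed
      then have "(r + b) * (\<sigma> - r * t) + t \<le> (r + b) * (\<sigma> - r * t) + (r + b) * (r * t)" by simp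
      also have "\<dots> = (r + b) * \<sigma>" using t\<sigma> by (simp flip: distrib_left)
      finally have "(ke - r * h) + (kf - b * h) \<le> (r + b) * \<sigma>" using X(1) tk by linarith
      then have "int ((ke - r * h) + (kf - b * h)) \<le> int ((r + b) * \<sigma>)" by (simp only: of_nat_le_iff)
      then show ?thesis by (simp only: of_nat_add of_nat_mult)
    qed
    then have "int (pe' + pf') + int (r + b) * (int (b * pe') - int (r * pf'))
       \<le> int (pe + pf) + int (r + b) * (int (b * pe) - int (r * pf))"
      unfolding diff unfolding eq'(3,4) \<delta>(1) by (simp add: algebra_simps)
    then show ?thesis using alt X le tk eq' by simp
  qed
  show "ke' \<le> ke" "kf' \<le> kf" "pe' + ke' = pe + ke" "pf' + kf' = pf + kf" "bal2 r b ke' kf'"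
    "(r * pf' < b * pe' \<and> r * kf' = b * ke') \<or> (b * pe' \<le> r * pf' \<and> r * pf' < b * pe' + r)"
    "int (pe' + pf') + int (r + b) * (int (b * pe') - int (r * pf'))
       \<le> int (pe + pf) + int (r + b) * (int (b * pe) - int (r * pf))"
    using goals by blast+
qed

text \<open>For a balanced pool the value is 0 by default; \<open>ext\<close> then changes nothing,
  see \<open>ext_step_bal\<close>.\<close>

definition excess :: "nat \<Rightarrow> nat \<Rightarrow> (nat \<Rightarrow> nat) \<Rightarrow> nat" where
  "excess r b p = (if r * p 0 < b * p 1 then 1 else 0)"

definition ext_step ::
  "nat \<Rightarrow> nat \<Rightarrow> nat \<Rightarrow> nat \<Rightarrow> (nat \<Rightarrow> nat \<Rightarrow> nat) \<times> (nat \<Rightarrow> nat \<Rightarrow> nat) \<Rightarrow> (nat \<Rightarrow> nat \<Rightarrow> nat) \<times> (nat \<Rightarrow> nat \<Rightarrow> nat)"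
where
  "ext_step r b c g = (\<lambda>(K, P). let e = excess r b (P g); f = 1 - e in
     case ext r b (K c e) (K c f) (P g e) (P g f) of (ke, kf, pe, pf) \<Rightarrow>
       (K(c := (K c)(e := ke, f := kf)), P(g := (P g)(e := pe, f := pf))))"

text \<open>Cells are known only as labels of points, so the run visits them through their points in
  the order of the indices; a cell may be visited several times.\<close>

primrec ext_run where
  "ext_run r b C G S 0 = S"
| "ext_run r b C G S (Suc i) = ext_step r b (C i) (G i) (ext_run r b C G S i)"

lemma sum_colour: "e < 2 \<Longrightarrow> h e + h (1 - e) = h 0 + (h 1 :: nat)" for e :: nat
  by (cases e) (auto simp: less_Suc_eq numeral_2_eq_2)

lemma bal2_colour: "e < 2 \<Longrightarrow> bal2 r b (h e) (h (1 - e)) = bal2 r b (h 0) (h 1)" for e :: nat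
  by (cases e) (auto simp: less_Suc_eq numeral_2_eq_2 bal2_def)

lemma ext_step_bal:
  assumes "bal2 r b (P g 0) (P g 1)"
  shows "ext_step r b c g (K, P) = (K, P)"
proof -
  define e where "e = excess r b (P g)"
  have "e < 2" by (simp add: e_def excess_def)
  then have "b * P g e \<le> r * P g (1 - e)" using bal2_colour[of e r b "P g"] assms by (simp add: bal2_def)
  then have "ext r b (K c e) (K c (1 - e)) (P g e) (P g (1 - e)) = (K c e, K c (1 - e), P g e, P g (1 - e))"
    by (simp add: ext_def)
  then show ?thesis by (simp add: ext_step_def Let_def flip: e_def)
qed

text \<open>As \<open>b \<le> r\<close>, a colour in excess has at least as many points as the
  other, so the two colours cannot both be in excess.\<close>

lemma excess_eq:
  assumes "1 \<le> b" "b \<le> r" "e < 2" "r * p (1 - e) < b * p e"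
  shows "excess r b p = e"
proof -
  have le: "p (1 - e) \<le> p e"
  proof (rule ccontr)
    assume "\<not> p (1 - e) \<le> p e"
    then have "b * p e \<le> r * p (1 - e)" using assms by (intro mult_le_mono) auto
    with assms show False by simp
  qed
  consider "e = 0" | "e = 1" using assms(3) by linarith
  then show ?thesis
  proof cases
    case 1
    have "b * p 1 \<le> r * p 0" using le 1 assms by (intro mult_le_mono) simp_all
    then show ?thesis using 1 by (simp add: excess_def)
  qed (use assms in \<open>simp add: excess_def\<close>)
qed

text \<open>As long as the pool is short, every visited cell of the group has exactly the ratio
  \<open>r : b\<close> in favour of the colour in excess. If this held for all cells at the end, the
  short pool would make the whole group unbalanced; so the pool gets settled, and then the group is
  left alone. The size of the pool is controlled by the amortised quantity of
  \<open>ext_props\<close>.\<close>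

lemma ext_run_spec:
  fixes C G :: "nat \<Rightarrow> nat" and n g :: nat and K0 P0 :: "nat \<Rightarrow> nat \<Rightarrow> nat"
  defines "S \<equiv> C ` {i. i < n \<and> G i = g}"
  assumes rb: "1 \<le> b" "b \<le> r" "coprime r b"
    and refine: "\<And>i j. i < n \<Longrightarrow> j < n \<Longrightarrow> C i = C j \<Longrightarrow> G i = G j"
    and cells: "\<And>c. c \<in> S \<Longrightarrow> bal2 r b (K0 c 0) (K0 c 1)"
    and total: "bal2 r b (P0 g 0 + (\<Sum>c\<in>S. K0 c 0)) (P0 g 1 + (\<Sum>c\<in>S. K0 c 1))"
    and run: "ext_run r b C G (K0, P0) n = (K, P)"
  shows "\<And>c x. c \<in> S \<Longrightarrow> x < 2 \<Longrightarrow> K c x \<le> K0 c x"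
    "\<And>c. c \<in> S \<Longrightarrow> bal2 r b (K c 0) (K c 1)"
    "\<And>x. x < 2 \<Longrightarrow> P g x + (\<Sum>c\<in>S. K c x) = P0 g x + (\<Sum>c\<in>S. K0 c x)"
    "bal2 r b (P g 0) (P g 1)"
    "P g 0 + P g 1 \<le> (1 + (r + b)\<^sup>2) * (P0 g 0 + P0 g 1)"
proof -
  have finS: "finite S" by (simp add: S_def)
  let ?tot = "\<lambda>K P x. P g x + (\<Sum>c\<in>S. K c x)"
  have S_mem: "C j \<in> S" if "j < n" "G j = g" for j using that unfolding S_def by blast
  define base where "base K P \<longleftrightarrow> (\<forall>c\<in>S. bal2 r b (K c 0) (K c 1) \<and> (\<forall>x<2. K c x \<le> K0 c x)) \<and>
    (\<forall>x<2. ?tot K P x = ?tot K0 P0 x)" for K P :: "nat \<Rightarrow> nat \<Rightarrow> nat"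
  have base0: "base K0 P0" using cells by (simp add: base_def)
  have other: "fst (ext_step r b (C i) (G i) (K, P)) c = K c"
    if "i < n" "G i \<noteq> g" "c \<in> S" for i c K and P :: "nat \<Rightarrow> nat \<Rightarrow> nat"
  proof -
    obtain j where "j < n" "G j = g" "c = C j" using \<open>c \<in> S\<close> unfolding S_def by blast
    then have "c \<noteq> C i" using refine[of j i] that(1,2) by auto
    then show ?thesis by (simp add: ext_step_def Let_def split: prod.split)
  qed
  have otherP: "snd (ext_step r b c g' (K, P)) g = P g" if "g' \<noteq> g"
    for c g' K and P :: "nat \<Rightarrow> nat \<Rightarrow> nat"
    using that by (simp add: ext_step_def Let_def split: prod.split)
  have concl: "(\<forall>c\<in>S. bal2 r b (K c 0) (K c 1) \<and> (\<forall>x<2. K c x \<le> K0 c x)) \<and>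
    (\<forall>x<2. ?tot K P x = ?tot K0 P0 x) \<and> bal2 r b (P g 0) (P g 1) \<and>
    P g 0 + P g 1 \<le> (1 + (r + b)\<^sup>2) * (P0 g 0 + P0 g 1)"
  proof (cases "bal2 r b (P0 g 0) (P0 g 1)")
    case True
    have "i \<le> n \<Longrightarrow> (\<forall>c\<in>S. fst (ext_run r b C G (K0, P0) i) c = K0 c) \<and> snd (ext_run r b C G (K0, P0) i) g = P0 g" for i
    proof (induction i)
      case (Suc i)
      obtain K1 P1 where 1: "ext_run r b C G (K0, P0) i = (K1, P1)" by fastforce
      with Suc have IH: "\<forall>c\<in>S. K1 c = K0 c" "P1 g = P0 g" by simp_all
      show ?case
      proof (cases "G i = g")
        case T: True
        then have "ext_step r b (C i) (G i) (K1, P1) = (K1, P1)"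
          using True IH(2) by (intro ext_step_bal) simp
        then show ?thesis using IH 1 by simp
      next
        case False
        have "i < n" using Suc.prems by simp
        then show ?thesis using IH 1 other[OF _ False] otherP[OF False] by simp
      qed
    qed simp
    from this[of n] run have "\<forall>c\<in>S. K c = K0 c" "P g = P0 g" by simp_all
    then show ?thesis using True cells by simp
  next
    case False
    define e :: nat where "e = (if b * P0 g 0 \<le> r * P0 g 1 then 1 else 0)"
    define f where "f = 1 - e"
    have e2: "e < 2" "f < 2" "e \<noteq> f" "1 - e = f" by (simp_all add: e_def f_def)
    have e0: "r * P0 g f < b * P0 g e" using False by (auto simp: e_def f_def bal2_def)
    have both: "x = e \<or> x = f" if "x < 2" for x using that by (auto simp: e_def f_def)
    define pot where "pot P = int (P g e + P g f) + int (r + b) * (int (b * P g e) - int (r * P g f))"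
      for P :: "nat \<Rightarrow> nat \<Rightarrow> nat"
    define settled where "settled P \<longleftrightarrow> b * P g e \<le> r * P g f \<and> r * P g f < b * P g e + r"
      for P :: "nat \<Rightarrow> nat \<Rightarrow> nat"
    \<comment> \<open>An overshoot below \<open>r\<close> gives at most as many points of colour
      \<open>f\<close> as of colour \<open>e\<close>, so the balance is not lost on the other
      side.\<close>
    have settled_bal: "bal2 r b (P g 0) (P g 1)" if "settled P" for P
    proof -
      have "b * P g e \<le> r * P g e" using rb by simp
      then have "r * P g f < r * (P g e + 1)" using that unfolding settled_def distrib_left by linarith
      then have "P g f < P g e + 1" by (simp only: mult_less_cancel1)
      then have "P g f \<le> P g e" by simp
      then have "b * P g f \<le> r * P g e" using rb by (intro mult_le_mono) simp_all
      then have "bal2 r b (P g e) (P g (1 - e))" using that e2 by (simp add: settled_def bal2_def)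
      then show ?thesis using bal2_colour[OF e2(1), of r b "P g"] by simp
    qed
    define inv where "inv i K P \<longleftrightarrow> base K P \<and> pot P \<le> pot P0 \<and>
       (settled P \<or> r * P g f < b * P g e \<and> (\<forall>j<i. G j = g \<longrightarrow> r * K (C j) f = b * K (C j) e))"
      for i and K P :: "nat \<Rightarrow> nat \<Rightarrow> nat"
    have inv: "i \<le> n \<Longrightarrow> inv i (fst (ext_run r b C G (K0, P0) i)) (snd (ext_run r b C G (K0, P0) i))" for i
    proof (induction i)
      case 0
      show ?case using base0 e0 by (simp add: inv_def)
    next
      case (Suc i)
      obtain K1 P1 where 1: "ext_run r b C G (K0, P0) i = (K1, P1)" by fastforce
      with Suc have IH: "inv i K1 P1" by simp
      have i: "i < n" using Suc.prems by simp
      show ?case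
      proof (cases "G i = g")
        case Gi: False
        obtain K2 P2 where 2: "ext_step r b (C i) (G i) (K1, P1) = (K2, P2)" by fastforce
        have same: "K2 c = K1 c" if "c \<in> S" for c using other[OF i Gi that, of K1 P1] 2 by simp
        have P2: "P2 g = P1 g" using otherP[OF Gi, of "C i" K1 P1] 2 by simp
        have "base K2 P2" using IH same P2 by (simp add: inv_def base_def)
        moreover have "pot P2 = pot P1" "settled P2 = settled P1" using P2 by (simp_all add: pot_def settled_def)
        moreover have "K2 (C j) = K1 (C j)" if "j < Suc i" "G j = g" for j
          using same S_mem[of j] that i by simp
        ultimately show ?thesis using IH Gi P2 1 2 by (auto simp: inv_def less_Suc_eq)
      next
        case Gi: True
        show ?thesis
        proof (cases "settled P1")
          case True
          then have "ext_step r b (C i) (G i) (K1, P1) = (K1, P1)"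
            using Gi settled_bal[OF True] by (intro ext_step_bal) simp
          then show ?thesis using 1 IH True by (simp add: inv_def)
        next
          case nd: False
          define c where "c = C i"
          have cS: "c \<in> S" using S_mem[OF i Gi] by (simp add: c_def)
          have ex: "r * P1 g f < b * P1 g e" using IH nd by (simp add: inv_def)
          have prev: "\<And>j. j < i \<Longrightarrow> G j = g \<Longrightarrow> r * K1 (C j) f = b * K1 (C j) e"
            using IH nd by (simp add: inv_def)
          have exc: "excess r b (P1 g) = e"
            using ex e2 by (intro excess_eq rb) simp_all
          obtain ke kf pe pf where q: "ext r b (K1 c e) (K1 c f) (P1 g e) (P1 g f) = (ke, kf, pe, pf)"
            by (metis prod_cases4)
          have b1: "bal2 r b (K1 c 0) (K1 c 1)" "\<forall>x<2. K1 c x \<le> K0 c x" "\<forall>x<2. ?tot K1 P1 x = ?tot K0 P0 x"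
            using IH cS by (auto simp: inv_def base_def)
          have "bal2 r b (K1 c e) (K1 c f)" using bal2_colour[OF e2(1), of r b "K1 c"] b1(1) e2(4) by simp
          note props = ext_props[OF rb this ex q]
          define K2 where "K2 = K1(c := (K1 c)(e := ke, f := kf))"
          define P2 where "P2 = P1(g := (P1 g)(e := pe, f := pf))"
          have 2: "ext_step r b (C i) (G i) (K1, P1) = (K2, P2)"
            using q exc e2(4) Gi by (simp add: ext_step_def Let_def K2_def P2_def flip: c_def)
          have K2c: "K2 c e = ke" "K2 c f = kf" and P2g: "P2 g e = pe" "P2 g f = pf"
            using e2(3) by (simp_all add: K2_def P2_def)
          have K2o: "K2 c' = K1 c'" if "c' \<noteq> c" for c' using that by (simp add: K2_def)
          have split: "(\<Sum>c'\<in>S. h c' x) = h c x + (\<Sum>c'\<in>S - {c}. h c' x)" for h :: "nat \<Rightarrow> nat \<Rightarrow> nat" and x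
            using finS cS by (rule sum.remove)
          have rest: "(\<Sum>c'\<in>S - {c}. K2 c' x) = (\<Sum>c'\<in>S - {c}. K1 c' x)" for x
            using K2o by (intro sum.cong) simp_all
          have tot2: "?tot K2 P2 x = ?tot K1 P1 x" if "x < 2" for x
            using both[OF that] props(3,4) unfolding split rest by (auto simp: K2c P2g)
          have bal: "bal2 r b (K2 c 0) (K2 c 1)"
            using bal2_colour[OF e2(1), of r b "K2 c"] props(5) e2(4) K2c by simp
          have le: "K2 c x \<le> K0 c x" if "x < 2" for x
            using both[OF that] props(1,2) b1(2) e2 K2c by (metis le_trans)
          have "base K2 P2"
            unfolding base_def
          proof (intro conjI ballI allI impI)
            fix c' assume "c' \<in> S"
            then show "bal2 r b (K2 c' 0) (K2 c' 1)"
              using bal K2o[of c'] IH by (cases "c' = c") (simp_all add: inv_def base_def)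
            fix x :: nat assume "x < 2"
            then show "K2 c' x \<le> K0 c' x"
              using le K2o[of c'] IH \<open>c' \<in> S\<close> by (cases "c' = c") (simp_all add: inv_def base_def)
          next
            fix x :: nat assume "x < 2"
            then show "?tot K2 P2 x = ?tot K0 P0 x" using tot2 b1(3) by simp
          qed
          moreover have "pot P2 \<le> pot P1" using props(7) by (simp only: pot_def P2g)
          moreover have "settled P2 \<or> r * P2 g f < b * P2 g e \<and> (\<forall>j<Suc i. G j = g \<longrightarrow> r * K2 (C j) f = b * K2 (C j) e)"
          proof (cases "settled P2")
            case False
            then have x: "r * pf < b * pe" "r * kf = b * ke" using props(6) P2g by (auto simp: settled_def)
            have "r * K2 (C j) f = b * K2 (C j) e" if "j < Suc i" "G j = g" for j
            proof (cases "C j = c")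
              case True
              then show ?thesis using x(2) K2c by simp
            next
              case False
              then have "j < i" using that(1) by (auto simp: less_Suc_eq c_def)
              then show ?thesis using prev that(2) K2o[OF False] by simp
            qed
            then show ?thesis using x(1) P2g by simp
          qed simp
          moreover have "pot P1 \<le> pot P0" using IH by (simp add: inv_def)
          ultimately show ?thesis using 1 2 by (simp add: inv_def)
        qed
      qed
    qed
    from inv[of n] run have fin: "inv n K P" by simp
    have dn: "settled P"
    proof (rule ccontr)
      assume "\<not> settled P"
      then have x: "r * P g f < b * P g e" "\<And>j. j < n \<Longrightarrow> G j = g \<Longrightarrow> r * K (C j) f = b * K (C j) e"
        using fin by (simp_all add: inv_def)
      have "r * K c f = b * K c e" if "c \<in> S" for c using that x(2) by (auto simp: S_def)
      then have "r * (\<Sum>c\<in>S. K c f) = b * (\<Sum>c\<in>S. K c e)" by (simp add: sum_distrib_left)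
      moreover have "b * ?tot K P e \<le> r * ?tot K P f"
      proof -
        have "?tot K P e = ?tot K0 P0 e" "?tot K P f = ?tot K0 P0 f"
          using fin e2 by (simp_all add: inv_def base_def)
        moreover have "b * ?tot K0 P0 e \<le> r * ?tot K0 P0 f"
          using total bal2_colour[OF e2(1), of r b "?tot K0 P0"] e2(4) by (simp add: bal2_def)
        ultimately show ?thesis by simp
      qed
      ultimately show False using x(1) unfolding distrib_left by linarith
    qed
    \<comment> \<open>One pool point is enough to absorb the additive overshoot
      \<open>(r + b) * r\<close> into the factor \<open>1 + (r + b)^2\<close>.\<close>
    have "1 \<le> P0 g e" using e0 by (cases "P0 g e") simp_all
    have "int (P g e + P g f) \<le> pot P0 + int (r + b) * int r"
    proof -
      have "int (r * P g f) < int (b * P g e) + int r"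
        using dn unfolding settled_def by (simp only: of_nat_less_iff flip: of_nat_add)
      then have "int (r * P g f) - int (b * P g e) \<le> int r" by linarith
      then have "int (r + b) * (int (r * P g f) - int (b * P g e)) \<le> int (r + b) * int r"
        by (intro mult_left_mono) simp_all
      then show ?thesis using fin unfolding inv_def pot_def by (simp add: algebra_simps)
    qed
    also have "pot P0 \<le> int (P0 g e + P0 g f) + int (r + b) * int (b * P0 g e)"
      unfolding pot_def by (intro add_left_mono mult_left_mono) simp_all
    also have "int (P0 g e + P0 g f) + int (r + b) * int (b * P0 g e) + int (r + b) * int r
        \<le> int (P0 g e + P0 g f) + int (r + b) * int (b * P0 g e) + int (r + b) * int (r * P0 g e)"
    proof (intro add_left_mono mult_left_mono)
      have "r * 1 \<le> r * P0 g e" using \<open>1 \<le> P0 g e\<close> by (rule mult_le_mono2)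
      then show "int r \<le> int (r * P0 g e)" by (simp only: of_nat_le_iff mult_1_right)
    qed simp
    also have "\<dots> = int ((P0 g e + P0 g f) + (r + b) * (r + b) * P0 g e)" by (simp add: algebra_simps)
    finally have "P g e + P g f \<le> (P0 g e + P0 g f) + (r + b) * (r + b) * P0 g e"
      by (simp only: of_nat_le_iff)
    also have "\<dots> \<le> (1 + (r + b)\<^sup>2) * (P0 g e + P0 g f)"
      by (simp add: algebra_simps power2_eq_square)
    finally have "P g e + P g f \<le> (1 + (r + b)\<^sup>2) * (P0 g e + P0 g f)" .
    then have "P g 0 + P g 1 \<le> (1 + (r + b)\<^sup>2) * (P0 g 0 + P0 g 1)"
      using sum_colour[OF e2(1), of "P g"] sum_colour[OF e2(1), of "P0 g"] e2(4) by simp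
    then show ?thesis using fin settled_bal[OF dn] by (simp add: inv_def base_def)
  qed
  show "\<And>c x. c \<in> S \<Longrightarrow> x < 2 \<Longrightarrow> K c x \<le> K0 c x"
    "\<And>c. c \<in> S \<Longrightarrow> bal2 r b (K c 0) (K c 1)"
    "\<And>x. x < 2 \<Longrightarrow> P g x + (\<Sum>c\<in>S. K c x) = P0 g x + (\<Sum>c\<in>S. K0 c x)"
    "bal2 r b (P g 0) (P g 1)"
    "P g 0 + P g 1 \<le> (1 + (r + b)\<^sup>2) * (P0 g 0 + P0 g 1)"
    using concl by blast+
qed

section \<open>One level of the decomposition\<close>

lemma card_by_image:
  assumes "finite A" "finite T" "h ` A \<subseteq> T"
  shows "card A = (\<Sum>c\<in>T. card {i\<in>A. h i = c})"
  using sum.group[OF assms, of "\<lambda>_. 1 :: nat"] by simp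

locale fairness =
  fixes n r b :: nat and cl :: "nat \<Rightarrow> nat"
  assumes rb: "1 \<le> b" "b \<le> r" "coprime r b"
    and cl: "\<And>i. cl i < 2"
begin

definition cnt :: "nat set \<Rightarrow> nat \<Rightarrow> nat" where
  "cnt S x = card {i\<in>S. cl i = x}"

definition balanced :: "nat set \<Rightarrow> bool" where
  "balanced S \<longleftrightarrow> bal2 r b (cnt S 0) (cnt S 1)"

lemma cnt_add: "finite S \<Longrightarrow> cnt S 0 + cnt S 1 = card S"
proof -
  assume "finite S"
  moreover have "cl ` S \<subseteq> {0, 1}" 
  proof
    fix x assume "x \<in> cl ` S"
    then have "x < 2" using cl by blast
    then show "x \<in> {0, 1}" by auto
  qed
  ultimately have "card S = (\<Sum>x\<in>{0, 1}. card {i\<in>S. cl i = x})"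
    by (intro card_by_image) simp_all
  then show ?thesis by (simp add: cnt_def)
qed

definition rank :: "(nat \<Rightarrow> nat) \<Rightarrow> nat \<Rightarrow> nat" where
  "rank C i = card {j. j < i \<and> C j = C i \<and> cl j = cl i}"

definition cell_count :: "(nat \<Rightarrow> nat) \<Rightarrow> nat \<Rightarrow> nat \<Rightarrow> nat" where
  "cell_count C c x = card {i. i < n \<and> C i = c \<and> cl i = x}"

text \<open>The other colour, even if kept entirely, balances at most \<open>r / b\<close> times as
  many points of colour \<open>x\<close>; the surplus over this has to go in any balanced part of
  the cell.\<close>

definition keep0 :: "(nat \<Rightarrow> nat) \<Rightarrow> nat \<Rightarrow> nat \<Rightarrow> nat" where
  "keep0 C c x = min (cell_count C c x) (r * cell_count C c (1 - x) div b)"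

definition pool0 :: "(nat \<Rightarrow> nat) \<Rightarrow> (nat \<Rightarrow> nat) \<Rightarrow> nat \<Rightarrow> nat \<Rightarrow> nat" where
  "pool0 G C g x = card {i. i < n \<and> G i = g \<and> cl i = x \<and> keep0 C (C i) x \<le> rank C i}"

definition final :: "(nat \<Rightarrow> nat) \<Rightarrow> (nat \<Rightarrow> nat) \<Rightarrow> (nat \<Rightarrow> nat \<Rightarrow> nat) \<times> (nat \<Rightarrow> nat \<Rightarrow> nat)" where
  "final G C = ext_run r b C G (keep0 C, pool0 G C) n"

text \<open>The key of a cell becomes the number of a group of the next level, and 0 marks the
  points that have a fairlet. Whether a point is kept is decided by its rank alone, so no list of
  kept points has to be stored.\<close>

definition newG :: "(nat \<Rightarrow> nat) \<Rightarrow> (nat \<Rightarrow> nat) \<Rightarrow> nat \<Rightarrow> nat" where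
  "newG G C i = (if 0 < G i \<and> rank C i < fst (final G C) (C i) (cl i) then C i else 0)"

definition pooled :: "(nat \<Rightarrow> nat) \<Rightarrow> (nat \<Rightarrow> nat) \<Rightarrow> nat \<Rightarrow> bool" where
  "pooled G C i \<longleftrightarrow> 0 < G i \<and> fst (final G C) (C i) (cl i) \<le> rank C i"

definition pool_rank :: "(nat \<Rightarrow> nat) \<Rightarrow> (nat \<Rightarrow> nat) \<Rightarrow> nat \<Rightarrow> nat" where
  "pool_rank G C i = card {j. j < i \<and> G j = G i \<and> cl j = cl i \<and> pooled G C j}"

definition pool_block :: "(nat \<Rightarrow> nat) \<Rightarrow> (nat \<Rightarrow> nat) \<Rightarrow> nat \<Rightarrow> nat" where
  "pool_block G C i = block r b (pool_rank G C i)
     (snd (final G C) (G i) (cl i)) (snd (final G C) (G i) (1 - cl i))"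

lemma bal2_keep0: "bal2 r b (keep0 C c 0) (keep0 C c 1)"
proof -
  have *: "b * min N (r * M div b) \<le> r * min M (r * N div b)" for N M
  proof -
    have "b * (r * M div b) \<le> r * M" by simp
    then have 1: "b * min N (r * M div b) \<le> r * M"
      by (meson le_trans min.cobounded2 mult_le_mono2)
    have "b * N \<le> r * N" using rb by simp
    then have "N \<le> r * N div b" using rb by (simp add: less_eq_div_iff_mult_less_eq mult.commute)
    then have "b * min N (r * M div b) \<le> r * (r * N div b)"
      using rb by (intro mult_le_mono) auto
    with 1 show ?thesis by (simp add: min_def)
  qed
  show ?thesis unfolding bal2_def keep0_def using * by simp
qed

text \<open>Conservation of colours in a group: by \<open>refine\<close> a group is a union of
  cells, and in each cell the points of rank at least \<open>K c x\<close> complement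
  \<open>K c x\<close> kept ones.\<close>

lemma pool_count:
  fixes G C :: "nat \<Rightarrow> nat" and g :: nat
  defines "S \<equiv> C ` {i. i < n \<and> G i = g}"
  assumes refine: "\<And>i j. i < n \<Longrightarrow> j < n \<Longrightarrow> C i = C j \<Longrightarrow> G i = G j"
    and le: "\<And>c. c \<in> S \<Longrightarrow> K c x \<le> cell_count C c x"
  shows "card {i. i < n \<and> G i = g \<and> cl i = x \<and> K (C i) x \<le> rank C i} + (\<Sum>c\<in>S. K c x)
    = cnt {i. i < n \<and> G i = g} x"
    "cnt {i. i < n \<and> G i = g} x = (\<Sum>c\<in>S. cell_count C c x)"
proof -
  have cell: "{i\<in>A. C i = c} = {i. i < n \<and> C i = c \<and> Q i}"
    if "c \<in> S" "A = {i. i < n \<and> G i = g \<and> Q i}" for A Q c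
  proof -
    obtain j where "j < n" "G j = g" "C j = c" using \<open>c \<in> S\<close> unfolding S_def by blast
    then have "G i = g" if "i < n" "C i = c" for i using refine[of i j] that by simp
    with that(2) show ?thesis by auto
  qed
  have 1: "card {i. i < n \<and> G i = g \<and> cl i = x \<and> K (C i) x \<le> rank C i}
      = (\<Sum>c\<in>S. cell_count C c x - K c x)"
  proof -
    have "card {i. i < n \<and> G i = g \<and> cl i = x \<and> K (C i) x \<le> rank C i}
      = (\<Sum>c\<in>S. card {i\<in>{i. i < n \<and> G i = g \<and> cl i = x \<and> K (C i) x \<le> rank C i}. C i = c})"
      by (intro card_by_image) (auto simp: S_def)
    also have "\<dots> = (\<Sum>c\<in>S. cell_count C c x - K c x)"
    proof (intro sum.cong refl)
      fix c assume c: "c \<in> S"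
      let ?T = "{i. i < n \<and> C i = c \<and> cl i = x}"
      have "{i\<in>{i. i < n \<and> G i = g \<and> cl i = x \<and> K (C i) x \<le> rank C i}. C i = c}
        = {i. i < n \<and> C i = c \<and> cl i = x \<and> K (C i) x \<le> rank C i}"
        by (rule cell[OF c refl])
      also have "\<dots> = {i\<in>?T. K c x \<le> card {j\<in>?T. j < i}}"
      proof (intro Collect_cong)
        fix i
        have "rank C i = card {j\<in>?T. j < i}" if "i \<in> ?T"
          using that by (auto simp: rank_def intro!: arg_cong[where f = card])
        then show "(i < n \<and> C i = c \<and> cl i = x \<and> K (C i) x \<le> rank C i) =
          (i \<in> ?T \<and> K c x \<le> card {j\<in>?T. j < i})" by auto
      qed
      finally have "card {i\<in>{i. i < n \<and> G i = g \<and> cl i = x \<and> K (C i) x \<le> rank C i}. C i = c}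
          = card {i\<in>?T. K c x \<le> card {j\<in>?T. j < i}}" by (rule arg_cong[where f = card])
      also have "\<dots> = card {p. p < card ?T \<and> K c x \<le> p}"
        by (rule card_rank_filter) simp
      also have "\<dots> = card {K c x..<card ?T}" by (rule arg_cong[where f = card]) auto
      finally show "card {i\<in>{i. i < n \<and> G i = g \<and> cl i = x \<and> K (C i) x \<le> rank C i}. C i = c}
        = cell_count C c x - K c x" by (simp add: cell_count_def)
    qed
    finally show ?thesis .
  qed
  have 2: "cnt {i. i < n \<and> G i = g} x = (\<Sum>c\<in>S. cell_count C c x)"
  proof -
    have "card {i. i < n \<and> G i = g \<and> cl i = x}
      = (\<Sum>c\<in>S. card {i\<in>{i. i < n \<and> G i = g \<and> cl i = x}. C i = c})"
      by (intro card_by_image) (auto simp: S_def)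
    also have "\<dots> = (\<Sum>c\<in>S. cell_count C c x)"
      using cell[OF _ refl, of _ "\<lambda>i. cl i = x"] by (intro sum.cong) (simp_all add: cell_count_def)
    finally show ?thesis by (simp add: cnt_def conj_ac)
  qed
  show "cnt {i. i < n \<and> G i = g} x = (\<Sum>c\<in>S. cell_count C c x)" by (rule 2)
  show "card {i. i < n \<and> G i = g \<and> cl i = x \<and> K (C i) x \<le> rank C i} + (\<Sum>c\<in>S. K c x)
    = cnt {i. i < n \<and> G i = g} x"
    unfolding 1 2 using le by (simp flip: sum.distrib)
qed

end

locale refinement = fairness +
  fixes G C :: "nat \<Rightarrow> nat"
  assumes refine: "\<And>i j. i < n \<Longrightarrow> j < n \<Longrightarrow> C i = C j \<Longrightarrow> G i = G j"
    and pos: "\<And>i. i < n \<Longrightarrow> 0 < G i \<Longrightarrow> 0 < C i"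
    and groups: "\<And>g. 0 < g \<Longrightarrow> balanced {i. i < n \<and> G i = g}"
begin

definition K where "K = fst (final G C)"
definition P where "P = snd (final G C)"

lemma keep0_le: "keep0 C c x \<le> cell_count C c x"
  by (simp add: keep0_def)

lemma final_spec:
  assumes "0 < g"
  shows "\<And>c x. c \<in> C ` {i. i < n \<and> G i = g} \<Longrightarrow> x < 2 \<Longrightarrow> K c x \<le> keep0 C c x"
    "\<And>c. c \<in> C ` {i. i < n \<and> G i = g} \<Longrightarrow> bal2 r b (K c 0) (K c 1)"
    "\<And>x. x < 2 \<Longrightarrow> P g x = card {i. i < n \<and> G i = g \<and> cl i = x \<and> K (C i) x \<le> rank C i}"
    "bal2 r b (P g 0) (P g 1)"
    "P g 0 + P g 1 \<le> (1 + (r + b)\<^sup>2) * (pool0 G C g 0 + pool0 G C g 1)"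
proof -
  let ?S = "C ` {i. i < n \<and> G i = g}"
  have tot0: "pool0 G C g x + (\<Sum>c\<in>?S. keep0 C c x) = cnt {i. i < n \<and> G i = g} x" for x
    unfolding pool0_def by (rule pool_count(1), rule refine, assumption+, rule keep0_le)
  have run: "ext_run r b C G (keep0 C, pool0 G C) n = (K, P)" by (simp add: K_def P_def final_def)
  have bal: "bal2 r b (pool0 G C g 0 + (\<Sum>c\<in>?S. keep0 C c 0)) (pool0 G C g 1 + (\<Sum>c\<in>?S. keep0 C c 1))"
    unfolding tot0 using groups[OF assms] by (simp add: balanced_def)
  note spec = ext_run_spec[OF rb _ bal2_keep0 bal run]
  show le: "K c x \<le> keep0 C c x" if "c \<in> ?S" "x < 2" for c x
    by (rule spec(1), erule (2) refine) (rule that)+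
  show "bal2 r b (K c 0) (K c 1)" if "c \<in> ?S" for c
    by (rule spec(2), erule (2) refine) (rule that)
  show "bal2 r b (P g 0) (P g 1)" by (rule spec(4), erule (2) refine)
  show "P g 0 + P g 1 \<le> (1 + (r + b)\<^sup>2) * (pool0 G C g 0 + pool0 G C g 1)"
    by (rule spec(5), erule (2) refine)
  fix x :: nat assume x: "x < 2"
  have "card {i. i < n \<and> G i = g \<and> cl i = x \<and> K (C i) x \<le> rank C i} + (\<Sum>c\<in>?S. K c x)
      = cnt {i. i < n \<and> G i = g} x"
    by (rule pool_count(1), rule refine, assumption+, rule le_trans[OF le[OF _ x] keep0_le])
  moreover have "P g x + (\<Sum>c\<in>?S. K c x) = cnt {i. i < n \<and> G i = g} x"
    by (rule trans[OF spec(3) tot0]) (erule (2) refine, rule x)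
  ultimately show "P g x = card {i. i < n \<and> G i = g \<and> cl i = x \<and> K (C i) x \<le> rank C i}" by simp
qed

lemma newG_eq: "newG G C i = (if 0 < G i \<and> rank C i < K (C i) (cl i) then C i else 0)"
  by (simp add: newG_def K_def)

lemma pooled_eq: "pooled G C i \<longleftrightarrow> 0 < G i \<and> K (C i) (cl i) \<le> rank C i"
  by (simp add: pooled_def K_def)

lemma newG_0: "i < n \<Longrightarrow> newG G C i = 0 \<longleftrightarrow> G i = 0 \<or> pooled G C i"
  using pos[of i] by (auto simp: newG_eq pooled_eq)

lemma newG_balanced:
  assumes "0 < c"
  shows "balanced {i. i < n \<and> newG G C i = c}"
proof (cases "\<exists>i<n. newG G C i = c")
  case False
  then have empty: "{i. i < n \<and> newG G C i = c} = {}" by blast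
  show ?thesis unfolding empty by (simp add: balanced_def cnt_def bal2_def)
next
  case True
  then obtain i0 where i0: "i0 < n" "0 < G i0" "C i0 = c"
    using assms by (auto simp: newG_eq split: if_splits)
  then have c: "c \<in> C ` {i. i < n \<and> G i = G i0}" by auto
  have "cnt {i. i < n \<and> newG G C i = c} x = K c x" if "x < 2" for x
  proof -
    let ?T = "{i. i < n \<and> C i = c \<and> cl i = x}"
    have rk: "rank C i = card {j\<in>?T. j < i}" if "i \<in> ?T" for i
      using that by (auto simp: rank_def intro!: arg_cong[where f = card])
    have act: "0 < G i" if "i < n" "C i = c" for i using refine[of i i0] i0 that by simp
    have "{i\<in>{i. i < n \<and> newG G C i = c}. cl i = x} = {i\<in>?T. card {j\<in>?T. j < i} < K c x}"
    proof (intro Collect_cong)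
      fix i
      show "(i \<in> {i. i < n \<and> newG G C i = c} \<and> cl i = x) = (i \<in> ?T \<and> card {j\<in>?T. j < i} < K c x)"
        using rk[of i] act[of i] assms unfolding newG_eq by (auto split: if_splits)
    qed
    then have "cnt {i. i < n \<and> newG G C i = c} x = card {p. p < card ?T \<and> p < K c x}"
      unfolding cnt_def by (simp only: card_rank_filter[of ?T "\<lambda>p. p < K c x"] finite_Collect_conjI finite_Collect_less_nat simp_thms)
    also have "\<dots> = card {..<min (card ?T) (K c x)}" by (rule arg_cong[where f = card]) auto
    also have "\<dots> = K c x"
    proof -
      have "K c x \<le> card ?T"
        using final_spec(1)[OF i0(2) c that] keep0_le[of c x] unfolding cell_count_def by (rule le_trans)
      then show ?thesis by simp
    qed
    finally show ?thesis .
  qed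
  then show ?thesis using final_spec(2)[OF i0(2) c] by (simp add: balanced_def)
qed

lemma pool_card:
  "x < 2 \<Longrightarrow> 0 < g \<Longrightarrow> card {i. i < n \<and> G i = g \<and> cl i = x \<and> pooled G C i} = P g x"
  using final_spec(3) by (auto simp: pooled_eq intro!: arg_cong[where f = card])

lemma pool_fairlet:
  fixes g l :: nat
  assumes "0 < g"
  defines "D \<equiv> {i. i < n \<and> G i = g \<and> pooled G C i \<and> pool_block G C i = l}"
  shows "balanced D \<and> card D \<le> r + b"
proof -
  have c: "cnt D x = card {p. p < P g x \<and> block r b p (P g x) (P g (1 - x)) = l}" if "x < 2" for x
  proof -
    let ?T = "{i. i < n \<and> G i = g \<and> cl i = x \<and> pooled G C i}"
    have rk: "pool_rank G C i = card {j\<in>?T. j < i}" if "i \<in> ?T" for i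
      using that by (auto simp: pool_rank_def intro!: arg_cong[where f = card])
    have "{i\<in>D. cl i = x} = {i\<in>?T. block r b (card {j\<in>?T. j < i}) (P g x) (P g (1 - x)) = l}"
    proof (intro Collect_cong)
      fix i
      show "(i \<in> D \<and> cl i = x) = (i \<in> ?T \<and> block r b (card {j\<in>?T. j < i}) (P g x) (P g (1 - x)) = l)"
        using rk[of i] unfolding D_def pool_block_def by (auto simp: P_def)
    qed
    then have "cnt D x = card {p. p < card ?T \<and> block r b p (P g x) (P g (1 - x)) = l}"
      unfolding cnt_def
      by (simp only: card_rank_filter[of ?T "\<lambda>p. block r b p (P g x) (P g (1 - x)) = l"]
        finite_Collect_conjI finite_Collect_less_nat simp_thms)
    then show ?thesis by (simp only: pool_card[OF that assms(1)])
  qed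
  have "finite D" by (simp add: D_def)
  have "bal2 r b (P g 0) (P g 1)" by (rule final_spec(4)[OF assms(1)])
  then have "b * cnt D 0 \<le> r * cnt D 1 \<and> b * cnt D 1 \<le> r * cnt D 0 \<and> cnt D 0 + cnt D 1 \<le> r + b"
    using c[of 0] c[of 1] by (intro block_fair[OF rb(1,2), of "P g 0" "P g 1"]) (simp_all add: bal2_def)
  then show ?thesis using cnt_add[OF \<open>finite D\<close>] by (simp add: balanced_def bal2_def)
qed

end

section \<open>Loose points and the potential\<close>

text \<open>Each point of \<open>J\<close> affects at most its own class.\<close>

lemma card_classes_le:
  assumes "\<And>v. card {i. i < (n :: nat) \<and> h i = v} \<le> q" "finite J"
  shows "card {i. i < n \<and> (\<exists>j\<in>J. h j = h i)} \<le> q * card J"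
proof -
  have "{i. i < n \<and> (\<exists>j\<in>J. h j = h i)} = (\<Union>j\<in>J. {i. i < n \<and> h i = h j})" by auto
  then have "card {i. i < n \<and> (\<exists>j\<in>J. h j = h i)} \<le> (\<Sum>j\<in>J. card {i. i < n \<and> h i = h j})"
    using card_UN_le[OF assms(2), of "\<lambda>j. {i. i < n \<and> h i = h j}"] by simp
  also have "\<dots> \<le> (\<Sum>j\<in>J. q)" by (intro sum_mono assms(1))
  finally show ?thesis by (simp add: mult.commute)
qed

text \<open>\<open>opt\<close> labels the fairlets of the decomposition used for comparison, and
  \<open>ctr\<close> sends a point to the centre of its fairlet. Only fairness enters here;
  optimality comes in when the locale is instantiated.\<close>

locale solution = fairness +
  fixes \<delta> :: "nat \<Rightarrow> nat \<Rightarrow> real" and opt ctr :: "nat \<Rightarrow> nat"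
  assumes opt_bal: "\<And>v. balanced {i. i < n \<and> opt i = v}"
    and opt_card: "\<And>v. card {i. i < n \<and> opt i = v} \<le> r + b"
    and ctr: "\<And>i. i < n \<Longrightarrow> ctr i < n" "\<And>i. i < n \<Longrightarrow> opt (ctr i) = opt i"
      "\<And>i j. i < n \<Longrightarrow> j < n \<Longrightarrow> opt i = opt j \<Longrightarrow> ctr i = ctr j"
    and \<delta>_nonneg: "\<And>i j. 0 \<le> \<delta> i j"
begin

definition active :: "(nat \<Rightarrow> nat) \<Rightarrow> nat set" where
  "active G = {i. i < n \<and> 0 < G i}"

definition loose :: "nat set \<Rightarrow> (nat \<Rightarrow> nat) \<Rightarrow> nat set" where
  "loose A C = {i\<in>A. \<exists>j<n. opt j = opt i \<and> C j \<noteq> C i}"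

text \<open>Inserting 0 gives \<open>Max\<close> a nonempty set even when no group is left.\<close>

definition diam :: "(nat \<Rightarrow> nat) \<Rightarrow> real" where
  "diam G = Max (insert 0 {\<delta> i j | i j. i < n \<and> j < n \<and> G i = G j \<and> 0 < G i})"

definition parts :: "(nat \<Rightarrow> nat) \<Rightarrow> (nat \<Rightarrow> nat) \<Rightarrow> nat set set" where
  "parts G L = (\<lambda>l. {j. j < n \<and> G j = 0 \<and> L j = l}) ` L ` {i. i < n \<and> G i = 0}"

definition paid :: "(nat \<Rightarrow> nat) \<Rightarrow> (nat \<Rightarrow> nat) \<Rightarrow> real" where
  "paid G L = (\<Sum>D\<in>parts G L. cost_median \<delta> D)"

definition valid_parts :: "(nat \<Rightarrow> nat) \<Rightarrow> (nat \<Rightarrow> nat) \<Rightarrow> bool" where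
  "valid_parts G L \<longleftrightarrow> (\<forall>D\<in>parts G L. balanced D \<and> card D \<le> r + b)"

lemma finite_active [simp]: "finite (active G)" "finite (loose (active G) C)"
  by (simp_all add: active_def loose_def)

lemma finite_diam_set: "finite {\<delta> i j | i j. i < n \<and> j < n \<and> G i = G j \<and> 0 < G i}"
proof -
  have "{\<delta> i j | i j. i < n \<and> j < n \<and> G i = G j \<and> 0 < G i} \<subseteq> (\<lambda>(i, j). \<delta> i j) ` ({..<n} \<times> {..<n})"
    by auto
  then show ?thesis by (rule finite_subset) simp
qed

lemma diam_ge: "i < n \<Longrightarrow> j < n \<Longrightarrow> G i = G j \<Longrightarrow> 0 < G i \<Longrightarrow> \<delta> i j \<le> diam G"
  unfolding diam_def by (rule Max_ge) (simp add: finite_diam_set, blast)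

lemma diam_nonneg: "0 \<le> diam G"
  unfolding diam_def using finite_diam_set by (intro Max_ge) auto

lemma diam_le:
  assumes "0 \<le> x" "\<And>i j. i < n \<Longrightarrow> j < n \<Longrightarrow> G i = G j \<Longrightarrow> 0 < G i \<Longrightarrow> \<delta> i j \<le> x"
  shows "diam G \<le> x"
  unfolding diam_def using finite_diam_set assms by (subst Max_le_iff) auto

lemma cost_median_le:
  assumes "finite S" "p \<in> S" "\<And>q. q \<in> S \<Longrightarrow> \<delta> p q \<le> x"
  shows "cost_median \<delta> S \<le> x * card S"
proof -
  have "cost_median \<delta> S \<le> (\<Sum>q\<in>S. \<delta> p q)"
    unfolding cost_median_def using assms by (intro Min_le) auto
  also have "\<dots> \<le> (\<Sum>q\<in>S. x)" by (intro sum_mono assms)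
  finally show ?thesis by (simp add: mult.commute)
qed

text \<open>A fairlet inside a group can be cut only if one of its points is separated from the
  centre, and such a point accounts for at most \<open>r + b\<close> loose points. Comparing with
  the centre, not with all pairs, is what leads to the sum of \<open>\<delta> j (ctr j)\<close>, the
  median cost.\<close>

lemma loose_cut:
  assumes "\<And>i j. i < n \<Longrightarrow> j < n \<Longrightarrow> G i = G j \<Longrightarrow> f i = f j \<Longrightarrow> C i = C j"
  shows "card (loose (active G) C) \<le> card (loose (active G) G) + (r + b) * card {j. j < n \<and> f j \<noteq> f (ctr j)}"
proof -
  let ?J = "{j. j < n \<and> f j \<noteq> f (ctr j)}"
  have "loose (active G) C \<subseteq> loose (active G) G \<union> {i. i < n \<and> (\<exists>j\<in>?J. opt j = opt i)}"
  proof
    fix i assume i: "i \<in> loose (active G) C"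
    then obtain j where j: "i < n" "j < n" "opt j = opt i" "C j \<noteq> C i"
      by (auto simp: loose_def active_def)
    show "i \<in> loose (active G) G \<union> {i. i < n \<and> (\<exists>j\<in>?J. opt j = opt i)}"
    proof (cases "G j = G i")
      case False
      then show ?thesis using i j by (auto simp: loose_def)
    next
      case True
      then have "f j \<noteq> f i" using assms[OF j(2,1)] j(4) by blast
      moreover have "ctr j = ctr i" using ctr(3)[OF j(2,1,3)] .
      ultimately have "j \<in> ?J \<or> i \<in> ?J" using j by auto
      then show ?thesis using j by blast
    qed
  qed
  then have "card (loose (active G) C) \<le> card (loose (active G) G \<union> {i. i < n \<and> (\<exists>j\<in>?J. opt j = opt i)})"
    by (rule card_mono[rotated]) simp
  also have "\<dots> \<le> card (loose (active G) G) + card {i. i < n \<and> (\<exists>j\<in>?J. opt j = opt i)}" by (rule card_Un_le)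
  also have "\<dots> \<le> card (loose (active G) G) + (r + b) * card ?J"
    using card_classes_le[OF opt_card, where J = ?J] by simp
  finally show ?thesis .
qed

end

locale level = solution + refinement
begin

text \<open>The points that are not loose form whole fairlets of \<open>opt\<close>, and the balance
  inequalities are linear, so they add up.\<close>

lemma unloose_balanced:
  fixes c :: nat
  defines "T \<equiv> {i. i < n \<and> C i = c \<and> i \<notin> loose (active G) C}"
  assumes act: "\<And>i. i < n \<Longrightarrow> C i = c \<Longrightarrow> 0 < G i"
  shows "balanced T"
proof -
  have cls: "{i\<in>T. opt i = v} = {i. i < n \<and> opt i = v}" if v: "v \<in> opt ` T" for v
  proof -
    obtain i0 where i0: "i0 \<in> T" "v = opt i0" using v by blast
    have i0': "i0 < n" "C i0 = c" "0 < G i0" using i0(1) act by (auto simp: T_def)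
    have all: "C j = c" if "j < n" "opt j = v" for j
      using i0 i0' that by (auto simp: T_def loose_def active_def)
    have "j \<in> T" if "j < n" "opt j = v" for j
      using all that by (auto simp: T_def loose_def)
    then show ?thesis by (auto simp: T_def)
  qed
  have fin: "finite T" by (simp add: T_def)
  have c: "cnt T x = (\<Sum>v\<in>opt ` T. cnt {i. i < n \<and> opt i = v} x)" for x
  proof -
    have "cnt T x = (\<Sum>v\<in>opt ` T. card {i\<in>{i\<in>T. cl i = x}. opt i = v})"
      unfolding cnt_def using fin by (intro card_by_image) auto
    also have "\<dots> = (\<Sum>v\<in>opt ` T. cnt {i. i < n \<and> opt i = v} x)"
    proof (intro sum.cong refl)
      fix v assume "v \<in> opt ` T"
      have "{i\<in>{i\<in>T. cl i = x}. opt i = v} = {i\<in>{i\<in>T. opt i = v}. cl i = x}" by auto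
      then show "card {i\<in>{i\<in>T. cl i = x}. opt i = v} = cnt {i. i < n \<and> opt i = v} x"
        unfolding cnt_def cls[OF \<open>v \<in> opt ` T\<close>] by simp
    qed
    finally show ?thesis .
  qed
  have "b * cnt {i. i < n \<and> opt i = v} 0 \<le> r * cnt {i. i < n \<and> opt i = v} 1"
    "b * cnt {i. i < n \<and> opt i = v} 1 \<le> r * cnt {i. i < n \<and> opt i = v} 0" for v
    using opt_bal[of v] unfolding balanced_def bal2_def by blast+
  then show ?thesis
    unfolding balanced_def bal2_def c sum_distrib_left by (intro conjI sum_mono)
qed

text \<open>Dropping the loose points is one way to balance the cell, and \<open>keep0\<close> keeps
  at least as many points of either colour.\<close>

lemma cell_excess:
  assumes act: "\<And>i. i < n \<Longrightarrow> C i = c \<Longrightarrow> 0 < G i"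
  shows "card {i. i < n \<and> C i = c \<and> keep0 C c (cl i) \<le> rank C i} \<le> card {i\<in>loose (active G) C. C i = c}"
proof -
  let ?S = "{i. i < n \<and> C i = c}"
  let ?T = "{i. i < n \<and> C i = c \<and> i \<notin> loose (active G) C}"
  let ?L = "{i\<in>loose (active G) C. C i = c}"
  have L: "?L \<subseteq> ?S" by (auto simp: loose_def active_def)
  have N: "cell_count C c x = cnt ?T x + cnt ?L x" for x
  proof -
    have "{i. i < n \<and> C i = c \<and> cl i = x} = {i\<in>?T. cl i = x} \<union> {i\<in>?L. cl i = x}" using L by auto
    moreover have "card ({i\<in>?T. cl i = x} \<union> {i\<in>?L. cl i = x}) = card {i\<in>?T. cl i = x} + card {i\<in>?L. cl i = x}"
      by (intro card_Un_disjoint) auto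
    ultimately show ?thesis by (simp only: cell_count_def cnt_def)
  qed
  have T: "b * cnt ?T x \<le> r * cnt ?T (1 - x)" if "x < 2" for x
  proof -
    have "bal2 r b (cnt ?T x) (cnt ?T (1 - x))"
      using unloose_balanced[OF act] bal2_colour[OF that, of r b "cnt ?T"] by (simp add: balanced_def)
    then show ?thesis by (simp add: bal2_def)
  qed
  have keep: "cell_count C c x - keep0 C c x \<le> cnt ?L x" if "x < 2" for x
  proof -
    have "b * cnt ?T x \<le> r * cnt ?T (1 - x)" by (rule T[OF that])
    also have "\<dots> \<le> r * cell_count C c (1 - x)" unfolding N by simp
    finally have "cnt ?T x \<le> r * cell_count C c (1 - x) div b"
      using rb by (simp add: less_eq_div_iff_mult_less_eq mult.commute)
    then have "cnt ?T x \<le> keep0 C c x" unfolding keep0_def using N[of x] by simp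
    then show ?thesis using N[of x] by simp
  qed
  have ex: "card {i. i < n \<and> C i = c \<and> cl i = x \<and> keep0 C c x \<le> rank C i} = cell_count C c x - keep0 C c x" for x
  proof -
    let ?X = "{i. i < n \<and> C i = c \<and> cl i = x}"
    have "rank C i = card {j\<in>?X. j < i}" if "i \<in> ?X" for i
      using that by (auto simp: rank_def intro!: arg_cong[where f = card])
    then have "{i. i < n \<and> C i = c \<and> cl i = x \<and> keep0 C c x \<le> rank C i}
        = {i\<in>?X. keep0 C c x \<le> card {j\<in>?X. j < i}}" by (intro Collect_cong) auto
    then have "card {i. i < n \<and> C i = c \<and> cl i = x \<and> keep0 C c x \<le> rank C i}
        = card {i\<in>?X. keep0 C c x \<le> card {j\<in>?X. j < i}}" by (rule arg_cong[where f = card])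
    also have "\<dots> = card {p. p < card ?X \<and> keep0 C c x \<le> p}" by (rule card_rank_filter) simp
    also have "\<dots> = card {keep0 C c x..<card ?X}" by (rule arg_cong[where f = card]) auto
    finally show ?thesis by (simp add: cell_count_def)
  qed
  let ?A = "{i. i < n \<and> C i = c \<and> keep0 C c (cl i) \<le> rank C i}"
  have "{i\<in>?A. cl i = x} = {i. i < n \<and> C i = c \<and> cl i = x \<and> keep0 C c x \<le> rank C i}" for x by auto
  then have A: "cnt ?A x = cell_count C c x - keep0 C c x" for x by (simp only: cnt_def ex)
  have "card ?A = cnt ?A 0 + cnt ?A 1" by (rule cnt_add[symmetric]) simp
  also have "\<dots> \<le> cnt ?L 0 + cnt ?L 1" unfolding A by (intro add_mono keep) simp_all
  also have "\<dots> = card ?L" by (rule cnt_add) simp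
  finally show ?thesis .
qed

lemma pool0_le: "card {i\<in>active G. keep0 C (C i) (cl i) \<le> rank C i} \<le> card (loose (active G) C)"
proof -
  let ?A = "{i\<in>active G. keep0 C (C i) (cl i) \<le> rank C i}"
  have "card ?A = (\<Sum>c\<in>C ` active G. card {i\<in>?A. C i = c})" by (intro card_by_image) auto
  also have "\<dots> \<le> (\<Sum>c\<in>C ` active G. card {i\<in>loose (active G) C. C i = c})"
  proof (intro sum_mono)
    fix c assume "c \<in> C ` active G"
    then obtain i0 where i0: "i0 < n" "0 < G i0" "C i0 = c" by (auto simp: active_def)
    have act: "0 < G i" if "i < n" "C i = c" for i using refine[of i i0] that i0 by simp
    have "{i\<in>?A. C i = c} = {i. i < n \<and> C i = c \<and> keep0 C c (cl i) \<le> rank C i}"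
      using act by (auto simp: active_def)
    then show "card {i\<in>?A. C i = c} \<le> card {i\<in>loose (active G) C. C i = c}"
      using cell_excess[OF act] by simp
  qed
  also have "\<dots> = card (loose (active G) C)"
    by (rule card_by_image[symmetric]) (auto simp: loose_def active_def)
  finally show ?thesis .
qed

definition pool :: "nat set" where
  "pool = {i. i < n \<and> pooled G C i}"

lemma finite_pool [simp]: "finite pool" by (simp add: pool_def)

lemma pool_le: "card pool \<le> (1 + (r + b)\<^sup>2) * card (loose (active G) C)"
proof -
  let ?T = "G ` active G"
  have "card pool = (\<Sum>g\<in>?T. card {i\<in>pool. G i = g})"
    by (intro card_by_image) (auto simp: pool_def pooled_def active_def)
  also have "\<dots> = (\<Sum>g\<in>?T. P g 0 + P g 1)"
  proof (intro sum.cong refl)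
    fix g assume "g \<in> ?T"
    then have g: "0 < g" by (auto simp: active_def)
    have "cnt {i\<in>pool. G i = g} x = P g x" if "x < 2" for x
    proof -
      have "{i\<in>{i\<in>pool. G i = g}. cl i = x} = {i. i < n \<and> G i = g \<and> cl i = x \<and> pooled G C i}"
        by (auto simp: pool_def)
      then show ?thesis using pool_card[OF that g] by (simp only: cnt_def)
    qed
    then show "card {i\<in>pool. G i = g} = P g 0 + P g 1"
      using cnt_add[of "{i\<in>pool. G i = g}"] by simp
  qed
  also have "\<dots> \<le> (\<Sum>g\<in>?T. (1 + (r + b)\<^sup>2) * (pool0 G C g 0 + pool0 G C g 1))"
    by (intro sum_mono final_spec(5)) (auto simp: active_def)
  also have "\<dots> = (1 + (r + b)\<^sup>2) * (\<Sum>g\<in>?T. pool0 G C g 0 + pool0 G C g 1)" by (simp add: sum_distrib_left)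
  also have "(\<Sum>g\<in>?T. pool0 G C g 0 + pool0 G C g 1) = card {i\<in>active G. keep0 C (C i) (cl i) \<le> rank C i}"
  proof -
    let ?A = "{i\<in>active G. keep0 C (C i) (cl i) \<le> rank C i}"
    have "card ?A = (\<Sum>g\<in>?T. card {i\<in>?A. G i = g})" by (intro card_by_image) auto
    also have "\<dots> = (\<Sum>g\<in>?T. pool0 G C g 0 + pool0 G C g 1)"
    proof (intro sum.cong refl)
      fix g assume "g \<in> ?T"
      then have g: "0 < g" by (auto simp: active_def)
      have "{i\<in>{i\<in>?A. G i = g}. cl i = x} = {i. i < n \<and> G i = g \<and> cl i = x \<and> keep0 C (C i) x \<le> rank C i}" for x
        using g by (auto simp: active_def)
      then have "cnt {i\<in>?A. G i = g} x = pool0 G C g x" for x by (simp only: cnt_def pool0_def)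
      then show "card {i\<in>?A. G i = g} = pool0 G C g 0 + pool0 G C g 1"
        using cnt_add[of "{i\<in>?A. G i = g}"] by simp
    qed
    finally show ?thesis ..
  qed
  also have "(1 + (r + b)\<^sup>2) * card {i\<in>active G. keep0 C (C i) (cl i) \<le> rank C i}
      \<le> (1 + (r + b)\<^sup>2) * card (loose (active G) C)"
    by (intro mult_le_mono2 pool0_le)
  finally show ?thesis .
qed

text \<open>A point is loose at the next level either because of the cells or because its fairlet
  lost a member to the pool; each pool point does the latter to at most \<open>r + b\<close>
  points.\<close>

lemma loose_new: "card (loose (active (newG G C)) (newG G C)) \<le> card (loose (active G) C) + (r + b) * card pool"
proof -
  let ?G = "newG G C"
  have "loose (active ?G) ?G \<subseteq> loose (active G) C \<union> {i. i < n \<and> (\<exists>j\<in>pool. opt j = opt i)}"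
  proof
    fix i assume "i \<in> loose (active ?G) ?G"
    then obtain j where i: "i < n" "0 < ?G i" and j: "j < n" "opt j = opt i" "?G j \<noteq> ?G i"
      by (auto simp: loose_def active_def)
    have i': "?G i = C i" "0 < G i" using i(2) by (auto simp: newG_eq split: if_splits)
    show "i \<in> loose (active G) C \<union> {i. i < n \<and> (\<exists>j\<in>pool. opt j = opt i)}"
    proof (cases "j \<in> pool")
      case True
      then show ?thesis using i j by blast
    next
      case False
      have "C j \<noteq> C i"
      proof
        assume "C j = C i"
        then have "0 < G j" using refine[OF j(1) i(1)] i' by simp
        then have "?G j \<noteq> 0" using False newG_0[OF j(1)] j(1) by (simp add: pool_def)
        then have "?G j = C j" by (auto simp: newG_eq)
        then show False using \<open>C j = C i\<close> i' j(3) by simp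
      qed
      then show ?thesis using i i' j by (auto simp: loose_def active_def)
    qed
  qed
  then have "card (loose (active ?G) ?G) \<le> card (loose (active G) C \<union> {i. i < n \<and> (\<exists>j\<in>pool. opt j = opt i)})"
    by (rule card_mono[rotated]) simp
  also have "\<dots> \<le> card (loose (active G) C) + card {i. i < n \<and> (\<exists>j\<in>pool. opt j = opt i)}" by (rule card_Un_le)
  also have "\<dots> \<le> card (loose (active G) C) + (r + b) * card pool"
    using card_classes_le[OF opt_card, where J = pool] by simp
  finally show ?thesis .
qed

lemma new_parts:
  assumes "\<And>i j. i < n \<Longrightarrow> G i = 0 \<Longrightarrow> j \<in> pool \<Longrightarrow> L' i \<noteq> L' j"
    and "\<And>i. i < n \<Longrightarrow> G i = 0 \<Longrightarrow> L' i = L i"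
  shows "parts (newG G C) L' = parts G L \<union> (\<lambda>l. {j\<in>pool. L' j = l}) ` L' ` pool"
proof -
  let ?Z = "{i. i < n \<and> G i = 0}"
  have disj: "G i > 0" if "i \<in> pool" for i using that by (simp add: pool_def pooled_def)
  have Z': "{i. i < n \<and> newG G C i = 0} = ?Z \<union> pool"
    using newG_0 by (auto simp: pool_def)
  have mem: "(j < n \<and> newG G C j = 0 \<and> L' j = l) \<longleftrightarrow> (j \<in> ?Z \<union> pool \<and> L' j = l)" for j l
    using Z' by blast
  have 1: "{j. j < n \<and> newG G C j = 0 \<and> L' j = L' i} = {j. j < n \<and> G j = 0 \<and> L j = L i}" if "i \<in> ?Z" for i
    using assms that unfolding mem by fastforce
  have 2: "{j. j < n \<and> newG G C j = 0 \<and> L' j = L' i} = {j\<in>pool. L' j = L' i}" if "i \<in> pool" for i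
    using assms(1) that unfolding mem by fastforce
  have "parts (newG G C) L' = (\<lambda>i. {j. j < n \<and> newG G C j = 0 \<and> L' j = L' i}) ` (?Z \<union> pool)"
    unfolding parts_def Z' by (simp only: image_image)
  also have "\<dots> = (\<lambda>i. {j. j < n \<and> G j = 0 \<and> L j = L i}) ` ?Z \<union> (\<lambda>i. {j\<in>pool. L' j = L' i}) ` pool"
    unfolding image_Un using 1 2 by (intro arg_cong2[where f = "(\<union>)"] image_cong) simp_all
  finally show ?thesis unfolding parts_def by (simp only: image_image)
qed

text \<open>Every new fairlet lies in one group, so with any of its points as median it costs at
  most \<open>diam G\<close> per point.\<close>

lemma paid_new:
  assumes "\<And>i j. i < n \<Longrightarrow> G i = 0 \<Longrightarrow> j \<in> pool \<Longrightarrow> L' i \<noteq> L' j"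
    and "\<And>i. i < n \<Longrightarrow> G i = 0 \<Longrightarrow> L' i = L i"
    and lab: "\<And>i j. i \<in> pool \<Longrightarrow> j \<in> pool \<Longrightarrow> L' i = L' j \<longleftrightarrow> G i = G j \<and> pool_block G C i = pool_block G C j"
    and valid: "valid_parts G L"
  shows "valid_parts (newG G C) L'" "paid (newG G C) L' \<le> paid G L + diam G * card pool"
proof -
  let ?new = "\<lambda>l. {j\<in>pool. L' j = l}"
  have np: "parts (newG G C) L' = parts G L \<union> ?new ` L' ` pool"
    by (rule new_parts) (rule assms(1,2); assumption)+
  have pool_G: "0 < G i" "i < n" if "i \<in> pool" for i using that by (simp_all add: pool_def pooled_def)
  have new_ok: "balanced (?new l) \<and> card (?new l) \<le> r + b" if "l \<in> L' ` pool" for l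
  proof -
    from that obtain i where i: "i \<in> pool" "l = L' i" by blast
    have "?new l = {j. j < n \<and> G j = G i \<and> pooled G C j \<and> pool_block G C j = pool_block G C i}"
    proof (intro Collect_cong)
      fix j
      have "j \<in> pool \<Longrightarrow> L' i = L' j \<longleftrightarrow> G i = G j \<and> pool_block G C i = pool_block G C j"
        by (rule lab[OF i(1)])
      moreover have "j \<in> pool \<longleftrightarrow> j < n \<and> pooled G C j" by (simp add: pool_def)
      ultimately show "(j \<in> pool \<and> L' j = l) =
        (j < n \<and> G j = G i \<and> pooled G C j \<and> pool_block G C j = pool_block G C i)"
        unfolding i(2) by metis
    qed
    then show ?thesis using pool_fairlet[OF pool_G(1)[OF i(1)]] by simp
  qed
  show "valid_parts (newG G C) L'"
    unfolding valid_parts_def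
  proof
    fix D assume "D \<in> parts (newG G C) L'"
    then consider "D \<in> parts G L" | "D \<in> ?new ` L' ` pool" unfolding np by (rule UnE)
    then show "balanced D \<and> card D \<le> r + b"
    proof cases
      case 1
      then show ?thesis using valid by (simp add: valid_parts_def)
    next
      case 2
      then obtain l where "l \<in> L' ` pool" "D = ?new l" by (rule imageE)
      then show ?thesis using new_ok by simp
    qed
  qed
  have old: "finite (parts G L)" by (simp add: parts_def)
  have disj: "parts G L \<inter> ?new ` L' ` pool = {}"
  proof -
    have "\<exists>i\<in>?new l. 0 < G i" if "l \<in> L' ` pool" for l using that pool_G by fastforce
    moreover have "\<forall>i\<in>D. G i = 0" if "D \<in> parts G L" for D using that by (auto simp: parts_def)
    ultimately show ?thesis by fastforce
  qed
  have inj: "inj_on ?new (L' ` pool)"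
  proof (rule inj_onI)
    fix l l' assume l: "l \<in> L' ` pool" and e: "?new l = ?new l'"
    from l obtain i where "i \<in> ?new l" by blast
    then show "l = l'" using e by blast
  qed
  have "cost_median \<delta> (?new l) \<le> diam G * card (?new l)" if "l \<in> L' ` pool" for l
  proof -
    from that obtain i where i: "i \<in> pool" "l = L' i" by blast
    show ?thesis
    proof (rule cost_median_le)
      show "finite (?new l)" "i \<in> ?new l" using i by auto
      fix j assume "j \<in> ?new l"
      then have "j \<in> pool" "L' i = L' j" using i by auto
      then have "G i = G j" using lab[OF i(1)] by blast
      then show "\<delta> i j \<le> diam G" using pool_G[OF i(1)] pool_G[OF \<open>j \<in> pool\<close>] by (intro diam_ge) auto
    qed
  qed
  then have "(\<Sum>l\<in>L' ` pool. cost_median \<delta> (?new l)) \<le> (\<Sum>l\<in>L' ` pool. diam G * card (?new l))"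
    by (rule sum_mono)
  also have "\<dots> = diam G * card pool"
  proof -
    have "card pool = (\<Sum>l\<in>L' ` pool. card (?new l))" by (intro card_by_image) auto
    then show ?thesis by (simp add: sum_distrib_left)
  qed
  finally have "(\<Sum>D\<in>?new ` L' ` pool. cost_median \<delta> D) \<le> diam G * card pool"
    by (subst sum.reindex[OF inj]) (simp add: o_def)
  then show "paid (newG G C) L' \<le> paid G L + diam G * card pool"
    unfolding paid_def np using old disj by (subst sum.union_disjoint) simp_all
qed

text \<open>The weight \<open>4 (1 + (r + b)\<^sup>2)\<close> of the potential is what makes the decrease of the diameter by the
  factor \<open>2 (1 + (r + b) (1 + (r + b)\<^sup>2))\<close> pay for both the new fairlets and the new loose points.\<close>

lemma potential_step:
  assumes "\<And>i j. i < n \<Longrightarrow> G i = 0 \<Longrightarrow> j \<in> pool \<Longrightarrow> L' i \<noteq> L' j"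
    and "\<And>i. i < n \<Longrightarrow> G i = 0 \<Longrightarrow> L' i = L i"
    and "\<And>i j. i \<in> pool \<Longrightarrow> j \<in> pool \<Longrightarrow> L' i = L' j \<longleftrightarrow> G i = G j \<and> pool_block G C i = pool_block G C j"
    and "valid_parts G L"
    and f: "\<And>i j. i < n \<Longrightarrow> j < n \<Longrightarrow> G i = G j \<Longrightarrow> f i = f j \<Longrightarrow> C i = C j"
    and A: "A = 1 + (r + b)\<^sup>2" and B: "B = 1 + (r + b) * A"
    and shrink: "2 * real B * diam (newG G C) \<le> diam G"
  shows "paid (newG G C) L' + 4 * real A * diam (newG G C) * card (loose (active (newG G C)) (newG G C))
    \<le> paid G L + 4 * real A * diam G * card (loose (active G) G)
      + 4 * real A * diam G * (real (r + b) * card {j. j < n \<and> f j \<noteq> f (ctr j)})"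
proof -
  let ?u = "real (card (loose (active G) C))"
  let ?u' = "real (card (loose (active (newG G C)) (newG G C)))"
  have p: "real (card pool) \<le> real A * ?u"
    using pool_le unfolding A by (simp only: of_nat_le_iff flip: of_nat_mult)
  have "card (loose (active (newG G C)) (newG G C)) \<le> B * card (loose (active G) C)"
  proof -
    have "(r + b) * card pool \<le> (r + b) * (A * card (loose (active G) C))"
      unfolding A by (intro mult_le_mono2 pool_le)
    then show ?thesis using loose_new unfolding B by (simp add: algebra_simps)
  qed
  then have u': "?u' \<le> real B * ?u" by (simp only: of_nat_le_iff flip: of_nat_mult)
  have "2 * (diam (newG G C) * ?u') \<le> 2 * (diam (newG G C) * (real B * ?u))"
    using u' diam_nonneg by (intro mult_left_mono) simp_all
  also have "\<dots> = (2 * real B * diam (newG G C)) * ?u" by (simp add: mult_ac)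
  also have "\<dots> \<le> diam G * ?u" by (intro mult_right_mono shrink) simp
  finally have 1: "2 * (diam (newG G C) * ?u') \<le> diam G * ?u" .
  have "paid (newG G C) L' \<le> paid G L + diam G * card pool"
    by (rule paid_new(2)) (use assms(1-4) in blast)+
  also have "\<dots> \<le> paid G L + diam G * (real A * ?u)"
    using p diam_nonneg by (intro add_left_mono mult_left_mono)
  finally have "paid (newG G C) L' + 4 * real A * diam (newG G C) * ?u'
      \<le> paid G L + real A * (diam G * ?u) + 2 * real A * (2 * (diam (newG G C) * ?u'))"
    by (simp add: mult_ac)
  also have "\<dots> \<le> paid G L + real A * (diam G * ?u) + 2 * real A * (diam G * ?u)"
    using 1 by (intro add_left_mono mult_left_mono) simp_all
  also have "\<dots> \<le> paid G L + 4 * real A * diam G * ?u"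
    using diam_nonneg[of G] by (simp add: mult_ac)
  also have "\<dots> \<le> paid G L + 4 * real A * diam G *
      (real (card (loose (active G) G)) + real (r + b) * card {j. j < n \<and> f j \<noteq> f (ctr j)})"
  proof (intro add_left_mono mult_left_mono)
    have "card (loose (active G) C) \<le> card (loose (active G) G) + (r + b) * card {j. j < n \<and> f j \<noteq> f (ctr j)}"
      using f by (rule loose_cut)
    then show "?u \<le> real (card (loose (active G) G)) + real (r + b) * card {j. j < n \<and> f j \<noteq> f (ctr j)}"
      by (simp only: of_nat_le_iff flip: of_nat_mult of_nat_add)
  qed (simp add: diam_nonneg)
  finally show ?thesis by (simp add: algebra_simps)
qed

end

section \<open>The program\<close>

text \<open>Cells are identified by a single number, obtained by iterated pairing, that serves as a memory
  address: this is what makes grouping the points by cells take linear time.\<close>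

definition npair :: "nat \<Rightarrow> nat \<Rightarrow> nat" where
  "npair x y = (x + y)\<^sup>2 + y"

text \<open>The value lies from the square of \<open>x + y\<close> up to below the square of
  \<open>x + y + 1\<close>, so \<open>x + y\<close> can be read off.\<close>

lemma npair_inj: "npair x y = npair x' y' \<Longrightarrow> x = x' \<and> y = y'"
proof -
  assume e: "npair x y = npair x' y'"
  have *: "npair x y < npair x' y'" if "x + y < x' + y'" for x y x' y'
  proof -
    have "npair x y < (x + y + 1)\<^sup>2" by (simp add: npair_def power2_eq_square)
    also have "\<dots> \<le> (x' + y')\<^sup>2" using that by (intro power_mono) simp_all
    finally show ?thesis by (simp add: npair_def)
  qed
  have "x + y = x' + y'"
    using *[of x y x' y'] *[of x' y' x y] e by (cases "x + y < x' + y'"; cases "x' + y' < x + y") simp_all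
  then show ?thesis using e by (simp add: npair_def)
qed

lemma npair_ge: "x \<le> npair x y"
proof -
  have "x \<le> (x + y)\<^sup>2"
  proof (cases "x = 0")
    case False
    then have "x * 1 \<le> (x + y) * (x + y)" by (intro mult_le_mono) simp_all
    then show ?thesis by (simp add: power2_eq_square)
  qed simp
  then show ?thesis by (simp add: npair_def)
qed

text \<open>These are the triangular numbers, with index \<open>2 * z\<close> for
  \<open>z \<ge> 0\<close> and \<open>- 2 * z - 1\<close> for \<open>z < 0\<close>: an injection of
  the integers into the naturals given by one polynomial, without a case distinction.\<close>

definition enc :: "int \<Rightarrow> nat" where
  "enc z = nat (z * (2 * z + 1))"

lemma enc_nonneg: "0 \<le> z * (2 * z + 1)" for z :: int
  by (cases "0 \<le> z") (simp_all add: mult_nonpos_nonpos)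

lemma enc_inj: "enc z = enc z' \<Longrightarrow> z = z'"
proof -
  assume "enc z = enc z'"
  then have "z * (2 * z + 1) = z' * (2 * z' + 1)" using enc_nonneg[of z] enc_nonneg[of z'] by (simp add: enc_def)
  then have "(z - z') * (2 * (z + z') + 1) = 0" by (simp add: algebra_simps)
  moreover have "2 * (z + z') + 1 \<noteq> 0" by presburger
  ultimately show ?thesis by simp
qed

lemma enc_real: "real (enc z) = of_int z * (2 * of_int z + 1)"
proof -
  have "real (enc z) = of_int (z * (2 * z + 1))" using enc_nonneg[of z] by (simp add: enc_def)
  then show ?thesis by simp
qed

text \<open>The fold starts with the group, so equal keys also mean equal groups and no cell
  straddles two groups.\<close>

definition ckey :: "nat \<Rightarrow> int list \<Rightarrow> nat" where
  "ckey g zs = foldl (\<lambda>k z. npair k (enc z)) g zs"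

lemma ckey_inj: "length zs = length zs' \<Longrightarrow> ckey g zs = ckey g' zs' \<Longrightarrow> g = g' \<and> zs = zs'"
proof (induction zs arbitrary: zs' rule: rev_induct)
  case (snoc z zs)
  then obtain y ys where "zs' = ys @ [y]" by (metis length_0_conv rev_exhaust snoc_eq_iff_butlast)
  with snoc show ?case by (auto simp: ckey_def dest!: npair_inj enc_inj)
qed (simp add: ckey_def)

text \<open>Keys inside a group with positive number are positive, hence distinct from the mark 0 of
  finished points.\<close>

lemma ckey_ge: "g \<le> ckey g zs"
  unfolding ckey_def by (induction zs rule: rev_induct) (auto intro: le_trans[OF _ npair_ge])

text \<open>A frame condition at the granularity of arrays: only those in \<open>A\<close> may have
  changed.\<close>

definition eqx :: "nat set \<Rightarrow> memory \<Rightarrow> memory \<Rightarrow> bool" where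
  "eqx A m m' \<longleftrightarrow> (\<forall>a. a \<notin> A \<longrightarrow> m' a = m a)"

lemma eqx_refl [simp]: "eqx A m m" by (simp add: eqx_def)

lemma eqx_store: "eqx A m m' \<Longrightarrow> a \<in> A \<Longrightarrow> eqx A m (store a i x m')"
  by (auto simp: eqx_def store_def)

lemma eqx_trans: "eqx A m m' \<Longrightarrow> eqx B m' m'' \<Longrightarrow> A \<subseteq> E \<Longrightarrow> B \<subseteq> E \<Longrightarrow> eqx E m m''"
  unfolding eqx_def by (metis subsetD)

lemma eqxD: "eqx A m m' \<Longrightarrow> a \<notin> A \<Longrightarrow> m' a = m a" by (simp add: eqx_def)

text \<open>
  Array 20 holds the group of every point (0 for points that are already in a fairlet), 21 its cell, 22 its
  rank among the points of its colour in the cell, and 23 a point of every group. Arrays 24 to 27 are indexed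
  by \<open>2 * c + x\<close> for a cell or group \<open>c\<close> and a colour \<open>x\<close>: 24 counts the points of a cell, 25 those that
  are kept, 26 the pool of a group, 27 the pool points that already have a label. Single numbers live
  in cell 0 of the other arrays: 4 is the level, 5 and 6 are loop variables, 7 is the range of the random
  number 8, 9 and 10 are the squared radius of the groups and the scale of the grid, and 12 tells
  whether a group is left.
\<close>

abbreviation sc :: "nat \<Rightarrow> aexp" where "sc a \<equiv> Get a (Lit 0)"
abbreviation here :: "nat \<Rightarrow> aexp" where "here a \<equiv> Get a (sc 5)"
abbreviation setv :: "nat \<Rightarrow> aexp \<Rightarrow> com" where "setv a e \<equiv> Assign a (Lit 0) e"
abbreviation points :: aexp where "points \<equiv> Get 0 (Lit 0)"
abbreviation dims :: aexp where "dims \<equiv> Get 0 (Lit 1)"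
abbreviation coord :: "aexp \<Rightarrow> aexp" where "coord e \<equiv> Get 1 (Plus (Times e dims) (sc 6))"
abbreviation cell :: "aexp \<Rightarrow> aexp \<Rightarrow> aexp" where "cell e x \<equiv> Plus (Times (Lit 2) e) x"
abbreviation other :: aexp where "other \<equiv> Minus (Lit 1) (here 2)"

definition pass_pivot :: com where
  "pass_pivot = For 5 points (Assign 23 (here 20) (sc 5))"

definition dist_coord :: com where
  "dist_coord = Seq (setv 13 (Minus (coord (sc 5)) (coord (Get 23 (here 20)))))
     (Seq (setv 11 (Plus (sc 11) (Times (sc 13) (sc 13))))
     (Seq (Cond (Less (sc 13) (Lit 0)) (setv 13 (Minus (Lit 0) (sc 13))) Skip)
       (Cond (Less (sc 10) (sc 13)) (setv 10 (sc 13)) Skip)))"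

definition pass_dist :: com where
  "pass_dist = Seq (setv 9 (Lit 0)) (Seq (setv 10 (Lit 0)) (For 5 points
     (Cond (Less (Lit 0) (here 20))
       (Seq (setv 11 (Lit 0)) (Seq (For 6 dims dist_coord)
         (Cond (Less (sc 9) (sc 11)) (setv 9 (sc 11)) Skip)))
       Skip)))"

text \<open>Without square roots the radius cannot be turned into a grid side. The search starts
  from the largest coordinate difference \<open>w\<close>, for which
  \<open>w^2 \<le> R \<le> d * w^2\<close> with the squared radius \<open>R\<close>, and halves
  until \<open>d * s^2\<close> no longer exceeds \<open>R\<close>.\<close>

definition halve :: com where
  "halve = While (Less (sc 9) (Times (Times (sc 10) (sc 10)) dims)) (setv 10 (Divide (sc 10) (Lit 2)))"

text \<open>The grid has side \<open>s / D\<close> and shift \<open>k / Kr\<close>, where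
  \<open>s\<close>, \<open>k\<close>, \<open>Kr\<close> are the contents of arrays 10, 8, 7; the
  last two assignments are \<open>enc\<close> and \<open>npair\<close> spelled out.\<close>

definition key_coord :: "nat \<Rightarrow> com" where
  "key_coord D = Seq (setv 13 (Floor (Plus (Divide (coord (sc 5)) (Divide (sc 10) (Lit (int D)))) (Divide (sc 8) (sc 7)))))
     (Seq (setv 13 (Times (sc 13) (Plus (Times (Lit 2) (sc 13)) (Lit 1))))
       (setv 11 (Plus (Times (Plus (sc 11) (sc 13)) (Plus (sc 11) (sc 13))) (sc 13))))"

definition pass_key :: "nat \<Rightarrow> com" where
  "pass_key D = For 5 points (Seq (setv 11 (here 20)) (Seq (For 6 dims (key_coord D)) (Assign 21 (sc 5) (sc 11))))"

text \<open>Keys can be huge, so the tables are reset only at the addresses of current cells and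
  groups; this keeps the pass linear in \<open>n\<close>.\<close>

definition pass_clear :: com where
  "pass_clear = For 5 points
     (Seq (Assign 24 (cell (here 21) (Lit 0)) (Lit 0)) (Seq (Assign 24 (cell (here 21) (Lit 1)) (Lit 0))
     (Seq (Assign 25 (cell (here 21) (Lit 0)) (Lit 0)) (Seq (Assign 25 (cell (here 21) (Lit 1)) (Lit 0))
     (Seq (Assign 26 (cell (here 20) (Lit 0)) (Lit 0)) (Seq (Assign 26 (cell (here 20) (Lit 1)) (Lit 0))
     (Seq (Assign 27 (cell (here 20) (Lit 0)) (Lit 0)) (Assign 27 (cell (here 20) (Lit 1)) (Lit 0)))))))))"

text \<open>The counter before its increment is the rank of the point.\<close>

definition pass_count :: com where
  "pass_count = For 5 points
     (Seq (Assign 22 (sc 5) (Get 24 (cell (here 21) (here 2))))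
       (Assign 24 (cell (here 21) (here 2)) (Plus (here 22) (Lit 1))))"

text \<open>The result of a running maximum of nonnegative numbers started at 0, so the empty set is
  allowed.\<close>

definition maxset :: "real \<Rightarrow> real set \<Rightarrow> bool" where
  "maxset w S \<longleftrightarrow> 0 \<le> w \<and> (w = 0 \<or> w \<in> S) \<and> (\<forall>x\<in>S. x \<le> w)"

lemma maxset_insert: "maxset w S \<Longrightarrow> 0 \<le> x \<Longrightarrow> maxset (if w < x then x else w) (insert x S)"
  by (auto simp: maxset_def)

lemma maxset_insert': "maxset w S \<Longrightarrow> 0 \<le> x \<Longrightarrow> T = insert x S \<Longrightarrow> w' = (if w < x then x else w) \<Longrightarrow> maxset w' T"
  using maxset_insert by simp

lemma addr_index [simp]: "addr (real i * real d + real t) = i * d + t"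
  by (metis addr_of_nat(1) of_nat_add of_nat_mult)

lemma addr_cell [simp]: "addr (2 * real c + real x) = 2 * c + x" "addr (2 * real c) = 2 * c" "addr (2 * real c + 1) = Suc (2 * c)"
  by (metis addr_of_nat(1) of_nat_add of_nat_mult of_nat_numeral,
      metis addr_of_nat(1) of_nat_mult of_nat_numeral,
      metis addr_of_nat(1) of_nat_mult of_nat_numeral of_nat_Suc add.commute)

lemma real_other: "x < 2 \<Longrightarrow> 1 - real x = real (1 - x)" for x :: nat
  by (cases x) (auto simp: less_Suc_eq numeral_2_eq_2)

lemma cell_eq_iff: "x < 2 \<Longrightarrow> y < 2 \<Longrightarrow> 2 * c + x = 2 * c' + y \<longleftrightarrow> c = c' \<and> x = y" for x y c c' :: nat
  by presburger

section \<open>Correctness of the passes over the points\<close>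

locale prog = fairness +
  fixes d D :: nat and X :: "nat \<Rightarrow> nat \<Rightarrow> real"
begin

definition inp :: "memory \<Rightarrow> bool" where
  "inp m \<longleftrightarrow> m 0 0 = real n \<and> m 0 1 = real d \<and> (\<forall>i<n. m 2 i = real (cl i)) \<and>
     (\<forall>i<n. \<forall>t<d. m 1 (i * d + t) = X i t)"

lemma inp_eqx: "eqx A m m' \<Longrightarrow> {0, 1, 2} \<inter> A = {} \<Longrightarrow> inp m \<Longrightarrow> inp m'"
  by (auto simp: inp_def eqx_def)

definition grp :: "memory \<Rightarrow> (nat \<Rightarrow> nat) \<Rightarrow> bool" where
  "grp m G \<longleftrightarrow> (\<forall>i<n. m 20 i = real (G i))"

definition cel :: "memory \<Rightarrow> (nat \<Rightarrow> nat) \<Rightarrow> bool" where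
  "cel m C \<longleftrightarrow> (\<forall>i<n. m 21 i = real (C i))"

text \<open>Later points of a group overwrite its pivot; the invariant survives because it accepts
  any member of the group.\<close>

lemma pass_pivot:
  assumes m: "inp m" "grp m G"
  shows "runs pass_pivot m (9 + n * 20) (\<lambda>m'. eqx {5, 23} m m' \<and>
    (\<forall>i<n. \<exists>j<n. m' 23 (G i) = real j \<and> G j = G i))"
  unfolding pass_pivot_def
proof (rule runs_For[where N = n and T = 6 and
      I = "\<lambda>i m'. eqx {5, 23} m m' \<and> (\<forall>i'<i. \<exists>j<n. m' 23 (G i') = real j \<and> G j = G i')"], goal_cases)
  case (2 i m')
  then show ?case using m eqxD[of "{5, 23}" m m' 0] by (simp add: inp_def)
next
  case (3 i m')
  have 20: "m' 20 = m 20" using 3 eqxD[of "{5, 23}" m m' 20] by simp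
  then have G: "m' 20 i = real (G i)" using m 3(1) by (simp add: grp_def)
  show ?case
  proof (rule runs_straight, simp, intro conjI)
    show "eqx {5, 23} m (store 5 0 (real (Suc i)) (sem (Assign 23 (here 20) (sc 5)) m'))"
      using 3 by (simp add: eqx_store)
    show "\<forall>i'<Suc i. \<exists>j<n. store 5 0 (real (Suc i)) (sem (Assign 23 (here 20) (sc 5)) m') 23 (G i') = real j \<and> G j = G i'"
      using 3 G by (auto simp: less_Suc_eq)
  qed (use 3 in simp_all)
qed (auto intro: eqx_store)

end

lemma runs_While_exit: "\<not> bval e m \<Longrightarrow> Q m \<Longrightarrow> bcost e \<le> T \<Longrightarrow> runs (While e c) m T Q"
  by (rule runs_While, rule runs_Cond[where T = 0]) (simp_all add: runs_Skip)

lemma runs_While_step: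
  "bval e m \<Longrightarrow> runs (Seq c (While e c)) m S Q \<Longrightarrow> bcost e + S \<le> T \<Longrightarrow> runs (While e c) m T Q"
  by (rule runs_While, rule runs_Cond[where T = S]) simp_all

context prog
begin

lemma dist_inner:
  assumes m: "inp m" "m 20 i = real (G i)" "i < n" "m 5 0 = real i" "m 23 (G i) = real p" "p < n" "m 11 0 = 0"
    "maxset (m 10 0) W"
  shows "runs (For 6 dims dist_coord) m (9 + d * 112) (\<lambda>m'. eqx {6, 10, 11, 13} m m' \<and>
    m' 11 0 = (\<Sum>t<d. (X i t - X p t)\<^sup>2) \<and> maxset (m' 10 0) (W \<union> (\<lambda>t. \<bar>X i t - X p t\<bar>) ` {..<d}))"
proof (rule runs_For[where N = d and T = 100 and
      I = "\<lambda>t m'. eqx {6, 10, 11, 13} m m' \<and> m' 11 0 = (\<Sum>t<t. (X i t - X p t)\<^sup>2) \<and>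
        maxset (m' 10 0) (W \<union> (\<lambda>t. \<bar>X i t - X p t\<bar>) ` {..<t})"], goal_cases)
  case (2 t m')
  then show ?case using m eqxD[of "{6, 10, 11, 13}" m m' 0] by (simp add: inp_def)
next
  case (3 t m')
  have e: "m' 0 = m 0" "m' 1 = m 1" "m' 5 = m 5" "m' 20 = m 20" "m' 23 = m 23"
    using 3 eqxD[of "{6, 10, 11, 13}" m m'] by simp_all
  have X: "m' 1 (i * d + t) = X i t" "m' 1 (p * d + t) = X p t" "m' 0 1 = real d"
    using m 3(1) e by (simp_all add: inp_def)
  have r: "m' 5 0 = real i" "m' 20 i = real (G i)" "m' 23 (G i) = real p" using e m by simp_all
  define z where "z = X i t - X p t"
  have sem11: "sem dist_coord m' 11 0 = m' 11 0 + z\<^sup>2"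
    using X r 3(3) by (simp add: dist_coord_def z_def power2_eq_square)
  have sem10: "sem dist_coord m' 10 0 = (if m' 10 0 < \<bar>z\<bar> then \<bar>z\<bar> else m' 10 0)"
    using X r 3(3) by (simp add: dist_coord_def z_def abs_if)
  have eq: "eqx {6, 10, 11, 13} m (sem dist_coord m')"
    using 3 by (simp add: dist_coord_def eqx_store)
  have 6: "sem dist_coord m' 6 0 = real t" using 3 by (simp add: dist_coord_def)
  show ?case
  proof (rule runs_straight)
    show "straight dist_coord" "wcost dist_coord \<le> 100" by (simp_all add: dist_coord_def)
    have "maxset (sem dist_coord m' 10 0) (W \<union> (\<lambda>t. \<bar>X i t - X p t\<bar>) ` {..<Suc t})"
    proof (rule maxset_insert')
      show "maxset (m' 10 0) (W \<union> (\<lambda>t. \<bar>X i t - X p t\<bar>) ` {..<t})" using 3 by simp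
      show "W \<union> (\<lambda>t. \<bar>X i t - X p t\<bar>) ` {..<Suc t} = insert \<bar>z\<bar> (W \<union> (\<lambda>t. \<bar>X i t - X p t\<bar>) ` {..<t})"
        by (simp add: lessThan_Suc z_def)
    qed (simp_all add: sem10)
    then show "sem dist_coord m' 6 0 = real t \<and> eqx {6, 10, 11, 13} m (store 6 0 (real (Suc t)) (sem dist_coord m')) \<and>
      store 6 0 (real (Suc t)) (sem dist_coord m') 11 0 = (\<Sum>t<Suc t. (X i t - X p t)\<^sup>2) \<and>
      maxset (store 6 0 (real (Suc t)) (sem dist_coord m') 10 0) (W \<union> (\<lambda>t. \<bar>X i t - X p t\<bar>) ` {..<Suc t})"
      using eq 3 6 sem11 by (simp add: eqx_store z_def)
  qed
qed (use m in \<open>auto intro: eqx_store\<close>)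

definition dsq :: "(nat \<Rightarrow> nat) \<Rightarrow> nat \<Rightarrow> real" where
  "dsq pv i = (\<Sum>t<d. (X i t - X (pv i) t)\<^sup>2)"

definition spread :: "(nat \<Rightarrow> nat) \<Rightarrow> (nat \<Rightarrow> nat) \<Rightarrow> nat \<Rightarrow> real set" where
  "spread G pv i = (\<Union>j\<in>{j. j < i \<and> 0 < G j}. (\<lambda>t. \<bar>X j t - X (pv j) t\<bar>) ` {..<d})"

lemma pass_dist:
  assumes m: "inp m" "grp m G" and pv: "\<And>i. i < n \<Longrightarrow> m 23 (G i) = real (pv i) \<and> pv i < n"
  shows "runs pass_dist m (20 + n * (60 + d * 112)) (\<lambda>m'. eqx {5, 6, 9, 10, 11, 13} m m' \<and>
    maxset (m' 9 0) (dsq pv ` {i. i < n \<and> 0 < G i}) \<and> maxset (m' 10 0) (spread G pv n))"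
proof -
  let ?A = "{5, 6, 9, 10, 11, 13}"
  let ?I = "\<lambda>i m'. eqx ?A m m' \<and> maxset (m' 9 0) (dsq pv ` {j. j < i \<and> 0 < G j}) \<and> maxset (m' 10 0) (spread G pv i)"
  let ?body = "Cond (Less (Lit 0) (here 20)) (Seq (setv 11 (Lit 0)) (Seq (For 6 dims dist_coord)
         (Cond (Less (sc 9) (sc 11)) (setv 9 (sc 11)) Skip))) Skip"
  have loop: "runs (For 5 points ?body) m1 (9 + n * (60 + d * 112)) (\<lambda>m'. ?I n m')"
    if m1: "eqx ?A m m1" "m1 9 0 = 0" "m1 10 0 = 0" for m1
  proof (rule runs_For[where N = n and T = "40 + d * 112" and I = ?I], goal_cases)
    case 1
    then show ?case using m1 by (auto intro: eqx_store simp: maxset_def spread_def)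
  next
    case (2 i m')
    then show ?case using m eqxD[of ?A m m' 0] by (simp add: inp_def)
  next
    case (3 i m')
    have e: "m' 20 = m 20" "m' 23 = m 23" using 3(2) eqxD[of ?A m m'] by simp_all
    have inp: "inp m'" by (rule inp_eqx[of ?A m]) (use 3 m in auto)
    have G: "m' 20 i = real (G i)" using m 3(1) e by (simp add: grp_def)
    show ?case
    proof (cases "0 < G i")
      case False
      then have "{j. j < Suc i \<and> 0 < G j} = {j. j < i \<and> 0 < G j}" by (auto simp: less_Suc_eq)
      then show ?thesis using False G 3 
        by (intro runs_Cond[where T = 0]) (auto intro!: runs_Skip eqx_store simp: spread_def)
    next
      case True
      then have ins: "{j. j < Suc i \<and> 0 < G j} = insert i {j. j < i \<and> 0 < G j}" by (auto simp: less_Suc_eq)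
      have sp: "spread G pv (Suc i) = spread G pv i \<union> (\<lambda>t. \<bar>X i t - X (pv i) t\<bar>) ` {..<d}"
        unfolding spread_def ins by auto
      define m2 where "m2 = store 11 0 0 m'"
      have "runs (For 6 dims dist_coord) m2 (9 + d * 112) (\<lambda>m''. eqx {6, 10, 11, 13} m2 m'' \<and>
        m'' 11 0 = (\<Sum>t<d. (X i t - X (pv i) t)\<^sup>2) \<and> maxset (m'' 10 0) (spread G pv i \<union> (\<lambda>t. \<bar>X i t - X (pv i) t\<bar>) ` {..<d}))"
      proof (rule dist_inner[where G = G])
        show "inp m2" unfolding m2_def by (rule inp_eqx[of "{11}" m']) (use inp in \<open>auto intro: eqx_store\<close>)
      qed (use 3 G e pv[OF 3(1)] in \<open>simp_all add: m2_def\<close>)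
      then have "runs (For 6 dims dist_coord) m2 (9 + d * 112) (\<lambda>m''.
          runs (Cond (Less (sc 9) (sc 11)) (setv 9 (sc 11)) Skip) m'' 9 (\<lambda>m''. m'' 5 0 = real i \<and> ?I (Suc i) (store 5 0 (real (Suc i)) m'')))"
      proof (rule runs_mono)
        fix m3 assume m3: "eqx {6, 10, 11, 13} m2 m3 \<and>
          m3 11 0 = (\<Sum>t<d. (X i t - X (pv i) t)\<^sup>2) \<and> maxset (m3 10 0) (spread G pv i \<union> (\<lambda>t. \<bar>X i t - X (pv i) t\<bar>) ` {..<d})"
        let ?c = "Cond (Less (sc 9) (sc 11)) (setv 9 (sc 11)) Skip"
        have e3: "m3 5 = m' 5" "m3 9 = m' 9" using m3 eqxD[of "{6, 10, 11, 13}" m2 m3] by (simp_all add: m2_def)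
        have "eqx ?A m m2" unfolding m2_def using 3(2) by (auto intro: eqx_store)
        then have "eqx ?A m m3" by (rule eqx_trans[OF _ conjunct1[OF m3]]) simp_all
        then have q: "eqx ?A m (sem ?c m3)" by (simp add: eqx_store)
        have "maxset (sem ?c m3 9 0) (dsq pv ` {j. j < Suc i \<and> 0 < G j})"
        proof (rule maxset_insert')
          show "maxset (m' 9 0) (dsq pv ` {j. j < i \<and> 0 < G j})" using 3(2) by simp
          show "dsq pv ` {j. j < Suc i \<and> 0 < G j} = insert (dsq pv i) (dsq pv ` {j. j < i \<and> 0 < G j})"
            unfolding ins by simp
          show "0 \<le> dsq pv i" by (simp add: dsq_def sum_nonneg)
          show "sem ?c m3 9 0 = (if m' 9 0 < dsq pv i then dsq pv i else m' 9 0)"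
            using m3 e3 by (simp add: dsq_def)
        qed
        then show "runs ?c m3 9 (\<lambda>m''. m'' 5 0 = real i \<and> ?I (Suc i) (store 5 0 (real (Suc i)) m''))"
          using q m3 e3 3(3) by (intro runs_straight) (simp_all add: eqx_store sp)
      qed simp
      then have "runs (Seq (For 6 dims dist_coord) (Cond (Less (sc 9) (sc 11)) (setv 9 (sc 11)) Skip)) m2 (18 + d * 112)
         (\<lambda>m''. m'' 5 0 = real i \<and> ?I (Suc i) (store 5 0 (real (Suc i)) m''))"
        by (rule runs_Seq) simp
      then have "runs (Seq (setv 11 (Lit 0)) (Seq (For 6 dims dist_coord) (Cond (Less (sc 9) (sc 11)) (setv 9 (sc 11)) Skip))) m' (21 + d * 112)
         (\<lambda>m''. m'' 5 0 = real i \<and> ?I (Suc i) (store 5 0 (real (Suc i)) m''))"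
        by (intro runs_Seq[where S = 3 and T = "18 + d * 112" and c = "setv 11 (Lit 0)"], intro runs_Assign)
          (simp_all add: m2_def)
      then show ?thesis using True G 3(3) by (intro runs_Cond[where T = "21 + d * 112"]) simp_all
    qed
  next
    case (4 m')
    then show ?case .
  qed simp
  show ?thesis unfolding pass_dist_def
  proof (rule runs_Seq[where S = 3 and T = "12 + n * (60 + d * 112)"], rule runs_Assign,
      rule runs_Seq[where S = 3 and T = "9 + n * (60 + d * 112)"], rule runs_Assign)
    show "runs (For 5 points ?body) (store 10 (addr (aval (Lit 0) (store 9 (addr (aval (Lit 0) m)) (aval (Lit 0) m) m)))
        (aval (Lit 0) (store 9 (addr (aval (Lit 0) m)) (aval (Lit 0) m) m)) (store 9 (addr (aval (Lit 0) m)) (aval (Lit 0) m) m))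
        (9 + n * (60 + d * 112)) (?I n)"
      by (rule loop) (simp_all add: eqx_store)
  qed simp_all
qed

text \<open>Each halving divides \<open>d * s^2\<close> by 4, so \<open>k\<close> of them suffice.
  It takes place only while \<open>R < d * s^2\<close>, with \<open>R\<close> the content of array
  9, and so preserves \<open>R \<le> 4 * (d * s^2)\<close>.\<close>

lemma halve:
  assumes "m 0 1 = real d" "0 \<le> m 10 0" "m 9 0 \<le> 4 * (real d * (m 10 0)\<^sup>2)" "real d * (m 10 0)\<^sup>2 \<le> 4 ^ k * m 9 0"
  shows "runs halve m (k * 20 + 12) (\<lambda>m'. eqx {10} m m' \<and> 0 \<le> m' 10 0 \<and>
    real d * (m' 10 0)\<^sup>2 \<le> m 9 0 \<and> m 9 0 \<le> 4 * (real d * (m' 10 0)\<^sup>2))"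
  unfolding halve_def using assms
proof (induction k arbitrary: m)
  case 0
  have b: "bval (Less (sc 9) (Times (Times (sc 10) (sc 10)) dims)) m \<longleftrightarrow> m 9 0 < real d * (m 10 0)\<^sup>2"
    using 0(1) by (simp add: power2_eq_square mult_ac)
  have "\<not> bval (Less (sc 9) (Times (Times (sc 10) (sc 10)) dims)) m" unfolding b using 0 by simp
  then show ?case by (rule runs_While_exit) (use 0 in simp_all)
next
  case (Suc k)
  let ?b = "Less (sc 9) (Times (Times (sc 10) (sc 10)) dims)"
  have b: "bval ?b m \<longleftrightarrow> m 9 0 < real d * (m 10 0)\<^sup>2"
    using Suc.prems(1) by (simp add: power2_eq_square mult_ac)
  show ?case
  proof (cases "bval ?b m")
    case False
    then have "real d * (m 10 0)\<^sup>2 \<le> m 9 0" using b by simp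
    with Suc.prems show ?thesis by (intro runs_While_exit[OF False]) simp_all
  next
    case True
    define m1 where "m1 = store 10 0 (m 10 0 / 2) m"
    have lt: "m 9 0 \<le> real d * (m 10 0)\<^sup>2" using True b by simp
    have "runs (While ?b (setv 10 (Divide (sc 10) (Lit 2)))) m1 (k * 20 + 12) (\<lambda>m'. eqx {10} m1 m' \<and> 0 \<le> m' 10 0 \<and>
      real d * (m' 10 0)\<^sup>2 \<le> m1 9 0 \<and> m1 9 0 \<le> 4 * (real d * (m' 10 0)\<^sup>2))"
      by (rule Suc.IH) (use Suc.prems lt in \<open>simp_all add: m1_def power_divide\<close>)
    then have "runs (While ?b (setv 10 (Divide (sc 10) (Lit 2)))) m1 (k * 20 + 12) (\<lambda>m'. eqx {10} m m' \<and> 0 \<le> m' 10 0 \<and>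
      real d * (m' 10 0)\<^sup>2 \<le> m 9 0 \<and> m 9 0 \<le> 4 * (real d * (m' 10 0)\<^sup>2))"
      by (rule runs_mono) (auto simp: m1_def eqx_def)
    then have "runs (Seq (setv 10 (Divide (sc 10) (Lit 2))) (While ?b (setv 10 (Divide (sc 10) (Lit 2))))) m (k * 20 + 18)
      (\<lambda>m'. eqx {10} m m' \<and> 0 \<le> m' 10 0 \<and> real d * (m' 10 0)\<^sup>2 \<le> m 9 0 \<and> m 9 0 \<le> 4 * (real d * (m' 10 0)\<^sup>2))"
      by (intro runs_Seq[where S = 6 and T = "k * 20 + 12"], intro runs_Assign) (simp_all add: m1_def)
    then show ?thesis by (rule runs_While_step[OF True]) simp
  qed
qed

end

context prog
begin

definition zs :: "real \<Rightarrow> real \<Rightarrow> nat \<Rightarrow> int list" where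
  "zs a u i = map (\<lambda>t. \<lfloor>X i t / a + u\<rfloor>) [0..<d]"

lemma key_inner:
  assumes m: "inp m" "i < n" "m 5 0 = real i" "m 11 0 = real g"
    and a: "a = m 10 0 / real D" and u: "u = m 8 0 / m 7 0"
  shows "runs (For 6 dims (key_coord D)) m (9 + d * 112)
    (\<lambda>m'. eqx {6, 11, 13} m m' \<and> m' 11 0 = real (ckey g (zs a u i)))"
proof (rule runs_For[where N = d and T = 100 and
      I = "\<lambda>t m'. eqx {6, 11, 13} m m' \<and> m' 11 0 = real (ckey g (map (\<lambda>t. \<lfloor>X i t / a + u\<rfloor>) [0..<t]))"], goal_cases)
  case 1
  then show ?case using m by (simp add: eqx_store ckey_def)
next
  case (2 t m')
  then show ?case using m eqxD[of "{6, 11, 13}" m m' 0] by (simp add: inp_def)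
next
  case (3 t m')
  have e: "m' 0 = m 0" "m' 1 = m 1" "m' 5 = m 5" "m' 7 = m 7" "m' 8 = m 8" "m' 10 = m 10"
    using 3 eqxD[of "{6, 11, 13}" m m'] by simp_all
  have X: "m' 1 (i * d + t) = X i t" "m' 0 1 = real d" "m' 5 0 = real i"
    using m 3(1) e by (simp_all add: inp_def)
  define z where "z = \<lfloor>X i t / a + u\<rfloor>"
  define k where "k = ckey g (map (\<lambda>t. \<lfloor>X i t / a + u\<rfloor>) [0..<t])"
  have z: "\<lfloor>X i t / (m 10 0 / real D) + m 8 0 / m 7 0\<rfloor> = z" by (simp add: z_def a u)
  have "ckey g (map (\<lambda>t. \<lfloor>X i t / a + u\<rfloor>) [0..<Suc t]) = npair k (enc z)"
    by (simp add: ckey_def k_def z_def)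
  moreover have "sem (key_coord D) m' 11 0 = real (npair k (enc z))"
    using X 3(2,3) e z by (simp add: key_coord_def npair_def enc_real k_def power2_eq_square)
  moreover have "sem (key_coord D) m' 6 0 = real t" "eqx {6, 11, 13} m (sem (key_coord D) m')"
    using 3 by (simp_all add: key_coord_def eqx_store)
  ultimately show ?case
    by (intro runs_straight) (simp_all add: eqx_store, simp_all add: key_coord_def)
qed (use m in \<open>simp_all add: zs_def eqx_store\<close>)

lemma pass_key:
  assumes m: "inp m" "grp m G" and a: "a = m 10 0 / real D" and u: "u = m 8 0 / m 7 0"
  shows "runs (pass_key D) m (20 + n * (40 + d * 112)) (\<lambda>m'. eqx {5, 6, 11, 13, 21} m m' \<and>
    cel m' (\<lambda>i. ckey (G i) (zs a u i)))"
  unfolding pass_key_def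
proof (rule runs_For[where N = n and T = "28 + d * 112" and
      I = "\<lambda>i m'. eqx {5, 6, 11, 13, 21} m m' \<and> (\<forall>j<i. m' 21 j = real (ckey (G j) (zs a u j)))"], goal_cases)
  case (2 i m')
  then show ?case using m eqxD[of "{5, 6, 11, 13, 21}" m m' 0] by (simp add: inp_def)
next
  case (3 i m')
  let ?A = "{5, 6, 11, 13, 21}"
  have e: "m' 20 = m 20" "m' 10 = m 10" "m' 7 = m 7" "m' 8 = m 8" using 3(2) eqxD[of ?A m m'] by simp_all
  have inp: "inp m'" by (rule inp_eqx[of ?A m]) (use 3 m in simp_all)
  have G: "m' 20 i = real (G i)" using m 3(1) e by (simp add: grp_def)
  define m2 where "m2 = store 11 0 (real (G i)) m'"
  have q: "eqx ?A m m2" using 3(2) by (simp add: m2_def eqx_store)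
  have "runs (For 6 dims (key_coord D)) m2 (9 + d * 112)
    (\<lambda>m''. eqx {6, 11, 13} m2 m'' \<and> m'' 11 0 = real (ckey (G i) (zs a u i)))"
  proof (rule key_inner)
    show "inp m2" unfolding m2_def by (rule inp_eqx[of "{11}" m']) (use inp in \<open>simp_all add: eqx_store\<close>)
  qed (use 3 e a u in \<open>simp_all add: m2_def\<close>)
  then have "runs (For 6 dims (key_coord D)) m2 (9 + d * 112) (\<lambda>m''. runs (Assign 21 (sc 5) (sc 11)) m'' 5
    (\<lambda>m'. m' 5 0 = real i \<and> eqx ?A m (store 5 0 (real (Suc i)) m') \<and>
      (\<forall>j<Suc i. store 5 0 (real (Suc i)) m' 21 j = real (ckey (G j) (zs a u j)))))"
  proof (rule runs_mono)
    fix m3 assume m3: "eqx {6, 11, 13} m2 m3 \<and> m3 11 0 = real (ckey (G i) (zs a u i))"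
    have e3: "m3 5 = m' 5" "m3 21 = m' 21"
      using m3 eqxD[of "{6, 11, 13}" m2 m3] by (simp_all add: m2_def)
    have q3: "eqx ?A m m3" using q by (rule eqx_trans[OF _ conjunct1[OF m3]]) simp_all
    show "runs (Assign 21 (sc 5) (sc 11)) m3 5
      (\<lambda>m'. m' 5 0 = real i \<and> eqx ?A m (store 5 0 (real (Suc i)) m') \<and>
        (\<forall>j<Suc i. store 5 0 (real (Suc i)) m' 21 j = real (ckey (G j) (zs a u j))))"
      by (rule runs_Assign) (use 3 m3 e3 q3 in \<open>auto simp: less_Suc_eq intro!: eqx_store\<close>)
  qed simp
  then have "runs (Seq (For 6 dims (key_coord D)) (Assign 21 (sc 5) (sc 11))) m2 (14 + d * 112)
    (\<lambda>m'. m' 5 0 = real i \<and> eqx ?A m (store 5 0 (real (Suc i)) m') \<and>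
      (\<forall>j<Suc i. store 5 0 (real (Suc i)) m' 21 j = real (ckey (G j) (zs a u j))))"
    by (rule runs_Seq) simp
  then have "runs (setv 11 (here 20)) m' 6 (\<lambda>m2. runs (Seq (For 6 dims (key_coord D)) (Assign 21 (sc 5) (sc 11))) m2 (14 + d * 112)
    (\<lambda>m'. m' 5 0 = real i \<and> eqx ?A m (store 5 0 (real (Suc i)) m') \<and>
      (\<forall>j<Suc i. store 5 0 (real (Suc i)) m' 21 j = real (ckey (G j) (zs a u j)))))"
    by (intro runs_Assign) (simp_all add: m2_def G 3(3))
  then show ?case by (rule runs_Seq) simp
qed (use m in \<open>simp_all add: eqx_store cel_def\<close>)

lemma lt2: "x < 2 \<longleftrightarrow> x = 0 \<or> x = (1 :: nat)" by auto

lemma pass_clear: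
  assumes m: "inp m" "grp m G" "cel m C"
  shows "runs pass_clear m (9 + n * 150) (\<lambda>m'. eqx {5, 24, 25, 26, 27} m m' \<and>
    (\<forall>j<n. \<forall>x<2. m' 24 (2 * C j + x) = 0 \<and> m' 25 (2 * C j + x) = 0 \<and> m' 26 (2 * G j + x) = 0 \<and> m' 27 (2 * G j + x) = 0))"
  unfolding pass_clear_def
proof (rule runs_For[where N = n and T = 120 and I = "\<lambda>i m'. eqx {5, 24, 25, 26, 27} m m' \<and>
    (\<forall>j<i. \<forall>x<2. m' 24 (2 * C j + x) = 0 \<and> m' 25 (2 * C j + x) = 0 \<and> m' 26 (2 * G j + x) = 0 \<and> m' 27 (2 * G j + x) = 0)"], goal_cases)
  case (2 i m')
  then show ?case using m eqxD[of "{5, 24, 25, 26, 27}" m m' 0] by (simp add: inp_def)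
next
  case (3 i m')
  have e: "m' 20 = m 20" "m' 21 = m 21" using 3(2) eqxD[of "{5, 24, 25, 26, 27}" m m'] by simp_all
  have G: "m' 20 i = real (G i)" "m' 21 i = real (C i)" using m 3(1) e by (simp_all add: grp_def cel_def)
  show ?case
    by (rule runs_straight) (use 3 G in \<open>simp_all add: eqx_store, simp_all add: lt2 less_Suc_eq all_conj_distrib\<close>)
qed (use m in \<open>simp_all add: eqx_store\<close>)

lemma pass_count:
  assumes m: "inp m" "cel m C" and z: "\<And>j x. j < n \<Longrightarrow> x < 2 \<Longrightarrow> m 24 (2 * C j + x) = 0"
  shows "runs pass_count m (9 + n * 60) (\<lambda>m'. eqx {5, 22, 24} m m' \<and>
    (\<forall>j<n. m' 22 j = real (rank C j)) \<and> (\<forall>j<n. \<forall>x<2. m' 24 (2 * C j + x) = real (cell_count C (C j) x)))"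
  unfolding pass_count_def
proof (rule runs_For[where N = n and T = 40 and I = "\<lambda>i m'. eqx {5, 22, 24} m m' \<and>
    (\<forall>j<i. m' 22 j = real (rank C j)) \<and>
    (\<forall>j<n. \<forall>x<2. m' 24 (2 * C j + x) = real (card {k. k < i \<and> C k = C j \<and> cl k = x}))"], goal_cases)
  case 1
  then show ?case using z by (simp add: eqx_store)
next
  case (2 i m')
  then show ?case using m eqxD[of "{5, 22, 24}" m m' 0] by (simp add: inp_def)
next
  case (3 i m')
  have e: "m' 21 = m 21" "m' 2 = m 2" using 3(2) eqxD[of "{5, 22, 24}" m m'] by simp_all
  have C: "m' 21 i = real (C i)" "m' 2 i = real (cl i)" using m 3(1) e by (simp_all add: cel_def inp_def)
  let ?c = "Seq (Assign 22 (sc 5) (Get 24 (cell (here 21) (here 2))))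
       (Assign 24 (cell (here 21) (here 2)) (Plus (here 22) (Lit 1)))"
  have 24: "m' 24 (2 * C i + cl i) = real (rank C i)"
    using 3(1,2) cl[of i] by (simp add: rank_def)
  have s22: "sem ?c m' 22 = (m' 22)(i := real (rank C i))" using 3 C 24 by (simp add: fun_upd_def)
  have s24: "sem ?c m' 24 = (m' 24)(2 * C i + cl i := real (rank C i) + 1)" using 3 C 24 by (simp add: fun_upd_def)
  have cs: "card {k. k < Suc i \<and> C k = C j \<and> cl k = x} =
      card {k. k < i \<and> C k = C j \<and> cl k = x} + (if C i = C j \<and> cl i = x then 1 else 0)" for j x
  proof -
    have "{k. k < Suc i \<and> C k = C j \<and> cl k = x} =
      (if C i = C j \<and> cl i = x then insert i {k. k < i \<and> C k = C j \<and> cl k = x} else {k. k < i \<and> C k = C j \<and> cl k = x})"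
      by (auto simp: less_Suc_eq)
    then show ?thesis by simp
  qed
  have "sem ?c m' 24 (2 * C j + x) = real (card {k. k < Suc i \<and> C k = C j \<and> cl k = x})" if "j < n" "x < 2" for j x
  proof (cases "C i = C j \<and> cl i = x")
    case True
    then show ?thesis unfolding cs s24 by (auto simp: rank_def)
  next
    case False
    then have "2 * C j + x \<noteq> 2 * C i + cl i" using cell_eq_iff[OF that(2) cl] by metis
    then show ?thesis unfolding cs s24 using False 3(2) that by auto
  qed
  moreover have "sem ?c m' 22 j = real (rank C j)" if "j < Suc i" for j
    unfolding s22 using 3(2) that by (auto simp: less_Suc_eq)
  moreover have "sem ?c m' 5 0 = real i" "eqx {5, 22, 24} m (sem ?c m')" using 3 by (simp_all add: eqx_store)
  ultimately show ?case
    by (intro runs_straight conjI) (simp_all del: sem.simps add: eqx_store)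
qed (use m in \<open>simp_all add: eqx_store cell_count_def\<close>)

end

lemma floor_mult_div: "real_of_int \<lfloor>real a * real c / real b\<rfloor> = real (a * c div b)"
  using floor_divide_of_nat_eq[of "a * c" b, where ?'a = real] by simp

lemma floor_nat_div: "real_of_int \<lfloor>real a / real b\<rfloor> = real (a div b)"
  using floor_divide_of_nat_eq[of a b, where ?'a = real] by simp

lemma addr_other: "x < 2 \<Longrightarrow> addr (2 * real c + 1 - real x) = 2 * c + (1 - x)"
  "x < 2 \<Longrightarrow> addr (2 * real c + (1 - real x)) = 2 * c + (1 - x)"
  using real_other[of x] addr_cell(1)[of c "1 - x"] by (simp_all add: algebra_simps)

context prog
begin

definition pass_keep :: com where
  "pass_keep = For 5 points
     (Seq (Assign 25 (cell (here 21) (here 2)) (Floor (Divide (Times (Lit (int r)) (Get 24 (cell (here 21) other))) (Lit (int b)))))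
     (Seq (Cond (Less (Get 24 (cell (here 21) (here 2))) (Get 25 (cell (here 21) (here 2))))
        (Assign 25 (cell (here 21) (here 2)) (Get 24 (cell (here 21) (here 2)))) Skip)
        (Cond (Less (here 22) (Get 25 (cell (here 21) (here 2)))) Skip
        (Assign 26 (cell (here 20) (here 2)) (Plus (Get 26 (cell (here 20) (here 2))) (Lit 1))))))"

lemma pass_keep:
  assumes m: "inp m" "grp m G" "cel m C"
    and rk: "\<And>j. j < n \<Longrightarrow> m 22 j = real (rank C j)"
    and N: "\<And>j x. j < n \<Longrightarrow> x < 2 \<Longrightarrow> m 24 (2 * C j + x) = real (cell_count C (C j) x)"
    and z: "\<And>j x. j < n \<Longrightarrow> x < 2 \<Longrightarrow> m 25 (2 * C j + x) = 0" "\<And>j x. j < n \<Longrightarrow> x < 2 \<Longrightarrow> m 26 (2 * G j + x) = 0"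
  shows "runs pass_keep m (9 + n * 200) (\<lambda>m'. eqx {5, 25, 26} m m' \<and>
    (\<forall>j<n. \<forall>x<2. m' 25 (2 * C j + x) = real (keep0 C (C j) x) \<and> m' 26 (2 * G j + x) = real (pool0 G C (G j) x)))"
  unfolding pass_keep_def
proof (rule runs_For[where N = n and T = 188 and I = "\<lambda>i m'. eqx {5, 25, 26} m m' \<and>
    (\<forall>j<n. \<forall>x<2. m' 25 (2 * C j + x) = (if \<exists>k<i. C k = C j \<and> cl k = x then real (keep0 C (C j) x) else 0) \<and>
      m' 26 (2 * G j + x) = real (card {k. k < i \<and> G k = G j \<and> cl k = x \<and> keep0 C (C k) x \<le> rank C k}))"], goal_cases)
  case 1
  then show ?case using z by (simp add: eqx_store)
next
  case (2 i m')
  then show ?case using m eqxD[of "{5, 25, 26}" m m' 0] by (simp add: inp_def)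
next
  case (3 i m')
  have e: "m' 20 = m 20" "m' 21 = m 21" "m' 2 = m 2" "m' 22 = m 22" "m' 24 = m 24"
    using 3(2) eqxD[of "{5, 25, 26}" m m'] by simp_all
  have C: "m' 20 i = real (G i)" "m' 21 i = real (C i)" "m' 2 i = real (cl i)" "m' 22 i = real (rank C i)"
    using m rk 3(1) e by (simp_all add: grp_def cel_def inp_def)
  have 24: "m' 24 (2 * C i + cl i) = real (cell_count C (C i) (cl i))"
    "m' 24 (2 * C i + (1 - cl i)) = real (cell_count C (C i) (1 - cl i))"
    unfolding e by (rule N[OF 3(1)]; use cl[of i] in simp)+
  have 26: "m' 26 (2 * G i + cl i) = real (card {k. k < i \<and> G k = G i \<and> cl k = cl i \<and> keep0 C (C k) (cl i) \<le> rank C k})"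
    using 3(1,2) cl[of i] by simp
  let ?c = "(Seq (Assign 25 (cell (here 21) (here 2)) (Floor (Divide (Times (Lit (int r)) (Get 24 (cell (here 21) other))) (Lit (int b)))))
     (Seq (Cond (Less (Get 24 (cell (here 21) (here 2))) (Get 25 (cell (here 21) (here 2))))
        (Assign 25 (cell (here 21) (here 2)) (Get 24 (cell (here 21) (here 2)))) Skip)
        (Cond (Less (here 22) (Get 25 (cell (here 21) (here 2)))) Skip
        (Assign 26 (cell (here 20) (here 2)) (Plus (Get 26 (cell (here 20) (here 2))) (Lit 1))))))"
  note ao = addr_other[OF cl[of i], of "C i"]
  have s25: "sem ?c m' 25 = (m' 25)(2 * C i + cl i := real (keep0 C (C i) (cl i)))"
    using 3(3) C 24 ao by (auto simp: keep0_def floor_mult_div fun_upd_def min_def)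
  have s26: "sem ?c m' 26 = (if keep0 C (C i) (cl i) \<le> rank C i then (m' 26)(2 * G i + cl i := m' 26 (2 * G i + cl i) + 1) else m' 26)"
    using 3(3) C 24 ao by (auto simp: keep0_def floor_mult_div fun_upd_def min_def)
  have cs: "card {k. k < Suc i \<and> G k = G j \<and> cl k = x \<and> keep0 C (C k) x \<le> rank C k} =
      card {k. k < i \<and> G k = G j \<and> cl k = x \<and> keep0 C (C k) x \<le> rank C k} +
      (if G i = G j \<and> cl i = x \<and> keep0 C (C i) x \<le> rank C i then 1 else 0)" for j x
  proof -
    have "{k. k < Suc i \<and> G k = G j \<and> cl k = x \<and> keep0 C (C k) x \<le> rank C k} =
      (if G i = G j \<and> cl i = x \<and> keep0 C (C i) x \<le> rank C i
       then insert i {k. k < i \<and> G k = G j \<and> cl k = x \<and> keep0 C (C k) x \<le> rank C k}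
       else {k. k < i \<and> G k = G j \<and> cl k = x \<and> keep0 C (C k) x \<le> rank C k})"
      by (auto simp: less_Suc_eq)
    then show ?thesis by simp
  qed
  have A: "sem ?c m' 25 (2 * C j + x) = (if \<exists>k<Suc i. C k = C j \<and> cl k = x then real (keep0 C (C j) x) else 0)"
    if "j < n" "x < 2" for j x
  proof (cases "C i = C j \<and> cl i = x")
    case True
    then show ?thesis unfolding s25 by auto
  next
    case False
    then have "2 * C j + x \<noteq> 2 * C i + cl i" using cell_eq_iff[OF that(2) cl] by metis
    moreover have "(\<exists>k<Suc i. C k = C j \<and> cl k = x) \<longleftrightarrow> (\<exists>k<i. C k = C j \<and> cl k = x)"
      using False by (auto simp: less_Suc_eq)
    ultimately show ?thesis unfolding s25 using 3(2) that by simp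
  qed
  have B: "sem ?c m' 26 (2 * G j + x) = real (card {k. k < Suc i \<and> G k = G j \<and> cl k = x \<and> keep0 C (C k) x \<le> rank C k})"
    if "j < n" "x < 2" for j x
  proof (cases "G i = G j \<and> cl i = x")
    case True
    then show ?thesis unfolding cs s26 using 26 by (auto simp: conj_ac)
  next
    case False
    then have "2 * G j + x \<noteq> 2 * G i + cl i" using cell_eq_iff[OF that(2) cl] by metis
    then show ?thesis unfolding cs s26 using False 3(2) that by auto
  qed
  have s5: "sem ?c m' 5 0 = real i" and q: "eqx {5, 25, 26} m (sem ?c m')" using 3 by (simp_all add: eqx_store)
  have st: "store 5 0 v m'' 25 = m'' 25" "store 5 0 v m'' 26 = m'' 26" for v m'' by simp_all
  show ?case
    by (rule runs_straight, simp, unfold st) (use s5 eqx_store[OF q, of 5] A B in blast, simp)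
next
  case (4 m')
  \<comment> \<open>An entry whose colour is absent from the cell was never written and still holds
    the cleared value 0, which is also the value of \<open>keep0\<close>.\<close>
  have "keep0 C (C j) x = 0" if "\<not> (\<exists>k<n. C k = C j \<and> cl k = x)" for j x
  proof -
    have e0: "{i. i < n \<and> C i = C j \<and> cl i = x} = {}" using that by blast
    show ?thesis unfolding keep0_def cell_count_def e0 by simp
  qed
  then show ?case using 4 by (auto simp: pool0_def)
qed simp

definition ext_load :: com where
  "ext_load = Seq (setv 14 (Lit 0))
     (Seq (Cond (Less (Times (Lit (int r)) (Get 26 (cell (here 20) (Lit 0)))) (Times (Lit (int b)) (Get 26 (cell (here 20) (Lit 1)))))
       (setv 14 (Lit 1)) Skip)
     (Seq (setv 18 (Minus (Lit 1) (sc 14)))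
     (Seq (setv 31 (Get 25 (cell (here 21) (sc 14)))) (Seq (setv 32 (Get 25 (cell (here 21) (sc 18))))
     (Seq (setv 33 (Get 26 (cell (here 20) (sc 14)))) (Seq (setv 34 (Get 26 (cell (here 20) (sc 18))))
       (setv 15 (Minus (Times (Lit (int b)) (sc 33)) (Times (Lit (int r)) (sc 34))))))))))"

definition ext_prep :: com where
  "ext_prep = Seq (setv 16 (Floor (Divide (Minus (Times (Lit (int r)) (sc 32)) (Times (Lit (int b)) (sc 31))) (Lit (int r)))))
     (Seq (setv 17 (Floor (Divide (Plus (sc 15) (Lit (int (r - 1)))) (Lit (int r)))))
     (Seq (Cond (Less (sc 17) (sc 16)) (setv 16 (sc 17)) Skip)
       (setv 17 (Floor (Divide (sc 31) (Lit (int r)))))))"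

definition ext_move_cells :: com where
  "ext_move_cells = Cond (Less (Times (Lit (int r)) (sc 16)) (sc 15))
     (Seq (Assign 26 (cell (here 20) (sc 14)) (Plus (sc 33) (Minus (sc 31) (Times (Lit (int r)) (sc 17)))))
     (Seq (Assign 26 (cell (here 20) (sc 18)) (Plus (sc 34) (Minus (sc 32) (Times (Lit (int b)) (sc 17)))))
     (Seq (Assign 25 (cell (here 21) (sc 14)) (Times (Lit (int r)) (sc 17)))
       (Assign 25 (cell (here 21) (sc 18)) (Times (Lit (int b)) (sc 17))))))
     (Seq (Assign 25 (cell (here 21) (sc 18)) (Minus (sc 32) (sc 16)))
       (Assign 26 (cell (here 20) (sc 18)) (Plus (sc 34) (sc 16))))"

definition ext_code :: com where
  "ext_code = Seq ext_load (Cond (Less (Lit 0) (sc 15)) (Seq ext_prep ext_move_cells) Skip)"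

definition pass_ext :: com where
  "pass_ext = For 5 points ext_code"

lemma ext_load:
  assumes "m 5 0 = real i" "m 20 i = real g" "m 21 i = real c" "e = excess r b (P g)"
    and K: "\<And>x. x < 2 \<Longrightarrow> m 25 (2 * c + x) = real (K c x)" and P: "\<And>x. x < 2 \<Longrightarrow> m 26 (2 * g + x) = real (P g x)"
  shows "sem ext_load m 14 0 = real e" "sem ext_load m 18 0 = real (1 - e)"
    "sem ext_load m 31 0 = real (K c e)" "sem ext_load m 32 0 = real (K c (1 - e))"
    "sem ext_load m 33 0 = real (P g e)" "sem ext_load m 34 0 = real (P g (1 - e))"
    "sem ext_load m 15 0 = real b * real (P g e) - real r * real (P g (1 - e))"
    "\<And>a. a \<notin> {14, 15, 18, 31, 32, 33, 34} \<Longrightarrow> sem ext_load m a = m a"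
proof -
  have v: "m 25 (2 * c) = real (K c 0)" "m 25 (Suc (2 * c)) = real (K c 1)"
    "m 26 (2 * g) = real (P g 0)" "m 26 (Suc (2 * g)) = real (P g 1)"
    using K[of 0] K[of 1] P[of 0] P[of 1] by simp_all
  have c: "real r * real (P g 0) < real b * real (P g 1) \<longleftrightarrow> r * P g 0 < b * P g 1"
    by (metis of_nat_less_iff of_nat_mult)
  show "sem ext_load m 14 0 = real e" "sem ext_load m 18 0 = real (1 - e)"
    "sem ext_load m 31 0 = real (K c e)" "sem ext_load m 32 0 = real (K c (1 - e))"
    "sem ext_load m 33 0 = real (P g e)" "sem ext_load m 34 0 = real (P g (1 - e))"
    "sem ext_load m 15 0 = real b * real (P g e) - real r * real (P g (1 - e))"
    using assms(1-3) v c unfolding assms(4) excess_def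
    by (cases "r * P g 0 < b * P g 1"; simp add: ext_load_def)+
  show "\<And>a. a \<notin> {14, 15, 18, 31, 32, 33, 34} \<Longrightarrow> sem ext_load m a = m a"
    by (simp add: ext_load_def)
qed

text \<open>The machine subtracts reals where \<open>ext\<close> uses truncated subtraction. The
  guard on the deficit, balance of the cell and the bounds of \<open>ext_props\<close> make the
  differences that are used nonnegative, so both agree.\<close>

lemma ext_code:
  assumes m: "m 5 0 = real i" "m 20 i = real g" "m 21 i = real c"
    and K: "\<And>x. x < 2 \<Longrightarrow> m 25 (2 * c + x) = real (K c x)" and P: "\<And>x. x < 2 \<Longrightarrow> m 26 (2 * g + x) = real (P g x)"
    and bal: "bal2 r b (K c 0) (K c 1)" and KP': "ext_step r b c g (K, P) = (K', P')"
  shows "\<And>x. x < 2 \<Longrightarrow> sem ext_code m 25 (2 * c + x) = real (K' c x)"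
    "\<And>x. x < 2 \<Longrightarrow> sem ext_code m 26 (2 * g + x) = real (P' g x)"
    "\<And>a. (\<And>x. x < 2 \<Longrightarrow> a \<noteq> 2 * c + x) \<Longrightarrow> sem ext_code m 25 a = m 25 a"
    "\<And>a. (\<And>x. x < 2 \<Longrightarrow> a \<noteq> 2 * g + x) \<Longrightarrow> sem ext_code m 26 a = m 26 a"
    "\<And>a. a \<notin> {14, 15, 16, 17, 18, 25, 26, 31, 32, 33, 34} \<Longrightarrow> sem ext_code m a = m a"
proof -
  define e where "e = excess r b (P g)"
  define f where "f = 1 - e"
  have e2: "e < 2" "f < 2" "e \<noteq> f" "1 - e = f" by (simp_all add: e_def f_def excess_def)
  have both: "x = e \<or> x = f" if "x < 2" for x using that e2 by (auto simp: f_def lt2)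
  obtain ke kf pe pf where ext: "ext r b (K c e) (K c f) (P g e) (P g f) = (ke, kf, pe, pf)"
    by (metis prod_cases4)
  have K': "K' c e = ke" "K' c f = kf" "P' g e = pe" "P' g f = pf"
    using KP' ext e2 by (auto simp: ext_step_def Let_def simp flip: e_def)
  define m1 where "m1 = sem ext_load m"
  note load = ext_load[where K = K and P = P, OF m e_def K P, folded m1_def, unfolded e2(4)]
  have 1: "m1 5 0 = real i" "m1 20 i = real g" "m1 21 i = real c" "m1 25 = m 25" "m1 26 = m 26"
    using load(8) m by simp_all
  define m2 where "m2 = sem ext_code m"
  have all: "m2 25 (2 * c + e) = real ke \<and> m2 25 (2 * c + f) = real kf \<and> m2 26 (2 * g + e) = real pe \<and>
    m2 26 (2 * g + f) = real pf \<and> (\<forall>a. a \<noteq> 2 * c + e \<and> a \<noteq> 2 * c + f \<longrightarrow> m2 25 a = m 25 a) \<and>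
    (\<forall>a. a \<noteq> 2 * g + e \<and> a \<noteq> 2 * g + f \<longrightarrow> m2 26 a = m 26 a)"
  proof (cases "r * P g f < b * P g e")
    case False
    then have "\<not> real r * real (P g f) < real b * real (P g e)" by (metis of_nat_less_iff of_nat_mult)
    then have "m2 = m1" using load(7) by (simp add: m2_def ext_code_def m1_def[symmetric])
    then show ?thesis using False ext 1 K P e2 by (simp add: ext_def)
  next
    case True
    then have lt: "real r * real (P g f) < real b * real (P g e)" by (metis of_nat_less_iff of_nat_mult)
    have balc: "bal2 r b (K c e) (K c f)" using bal2_colour[OF e2(1), of r b "K c"] bal e2(4) by simp
    note props = ext_props[OF rb balc True ext]
    define t where "t = ext_move r b (K c e) (K c f) (P g e) (P g f)"
    define h where "h = K c e div r"
    define \<delta> where "\<delta> = b * P g e - r * P g f"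
    have \<delta>: "real b * real (P g e) - real r * real (P g f) = real \<delta>"
      using True by (simp add: \<delta>_def of_nat_diff)
    have \<sigma>: "real r * real (K c f) - real b * real (K c e) = real (r * K c f - b * K c e)"
      using balc by (simp add: bal2_def of_nat_diff)
    have fl: "real_of_int \<lfloor>(real \<delta> + real (r - 1)) / real r\<rfloor> = real ((\<delta> + (r - 1)) div r)"
      by (simp only: floor_nat_div flip: of_nat_add)
    define m3 where "m3 = sem ext_prep m1"
    have 16: "m3 16 0 = real t"
      using load \<sigma> fl unfolding m3_def ext_prep_def t_def ext_move_def \<delta>[unfolded load(7)[symmetric]]
      by (simp add: \<delta> floor_nat_div min_def flip: \<delta>_def)
    have 17: "m3 17 0 = real h" unfolding m3_def ext_prep_def h_def using load by (simp add: floor_nat_div)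
    have 3: "m3 a = m1 a" if "a \<notin> {16, 17}" for a unfolding m3_def ext_prep_def using that by simp
    have m2: "m2 = sem ext_move_cells m3"
      using lt load(7) by (simp add: m2_def ext_code_def m3_def m1_def[symmetric])
    have a: "addr (2 * real c + real e) = 2 * c + e" "addr (2 * real c + real f) = 2 * c + f"
      "addr (2 * real g + real e) = 2 * g + e" "addr (2 * real g + real f) = 2 * g + f" by simp_all
    have ne: "2 * c + e \<noteq> 2 * c + f" "2 * g + e \<noteq> 2 * g + f" using e2 by simp_all
    have cond: "real r * real t < real \<delta> \<longleftrightarrow> r * t < \<delta>" by (metis of_nat_less_iff of_nat_mult)
    have ext': "ext r b (K c e) (K c f) (P g e) (P g f) =
       (if r * t < \<delta> then (r * h, b * h, P g e + (K c e - r * h), P g f + (K c f - b * h))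
        else (K c e, K c f - t, P g e, P g f + t))"
      using True by (simp add: ext_def Let_def t_def h_def \<delta>_def)
    show ?thesis
    proof (cases "r * t < \<delta>")
      case T: True
      then have v: "ke = r * h" "kf = b * h" "pe = P g e + (K c e - r * h)" "pf = P g f + (K c f - b * h)"
        using ext[unfolded ext' if_P[OF T] prod.inject] by blast+
      have "r * h \<le> K c e" "b * h \<le> K c f" using props(1,2) v by simp_all
      then have rv: "real pe = real (P g e) + (real (K c e) - real r * real h)"
        "real pf = real (P g f) + (real (K c f) - real b * real h)" unfolding v by (simp_all add: of_nat_diff)
      have s: "m2 25 = (m 25)(2 * c + e := real r * real h, 2 * c + f := real b * real h)"
        "m2 26 = (m 26)(2 * g + e := real pe, 2 * g + f := real pf)"
        using T cond load 1 16 17 3 a unfolding m2 ext_move_cells_def rv by (simp_all add: \<delta> fun_upd_def)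
      show ?thesis unfolding s v(1,2) using ne by simp
    next
      case F: False
      then have v: "ke = K c e" "kf = K c f - t" "pe = P g e" "pf = P g f + t"
        using ext[unfolded ext' if_not_P[OF F] prod.inject] by blast+
      have "t \<le> K c f"
      proof -
        have "pf + kf = P g f + K c f" by (rule props(4))
        then show ?thesis unfolding v by linarith
      qed
      then have rv: "real kf = real (K c f) - real t" unfolding v by (simp add: of_nat_diff)
      have s: "m2 25 = (m 25)(2 * c + f := real kf)" "m2 26 = (m 26)(2 * g + f := real (P g f) + real t)"
        using F cond load 1 16 17 3 a unfolding m2 ext_move_cells_def rv by (simp_all add: \<delta> fun_upd_def)
      show ?thesis unfolding s v(1,3,4) using ne K[OF e2(1)] P[OF e2(1)] by simp
    qed
  qed
  show "sem ext_code m 25 (2 * c + x) = real (K' c x)" if "x < 2" for x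
    using all both[OF that] K' by (auto simp flip: m2_def)
  show "sem ext_code m 26 (2 * g + x) = real (P' g x)" if "x < 2" for x
    using all both[OF that] K' by (auto simp flip: m2_def)
  show "sem ext_code m 25 a = m 25 a" if "\<And>x. x < 2 \<Longrightarrow> a \<noteq> 2 * c + x" for a
    using all that[OF e2(1)] that[OF e2(2)] by (simp flip: m2_def)
  show "sem ext_code m 26 a = m 26 a" if "\<And>x. x < 2 \<Longrightarrow> a \<noteq> 2 * g + x" for a
    using all that[OF e2(1)] that[OF e2(2)] by (simp flip: m2_def)
  show "sem ext_code m a = m a" if "a \<notin> {14, 15, 16, 17, 18, 25, 26, 31, 32, 33, 34}" for a
    using that by (simp add: ext_code_def ext_load_def ext_prep_def ext_move_cells_def)
qed

end

context prog
begin

text \<open>There is no hypothesis on the groups: the program also passes over the finished points,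
  with group 0, and the translation in \<open>ext_code\<close> asks for balanced cells there as
  well.\<close>

lemma ext_step_bal2:
  assumes "\<And>c. bal2 r b (K c 0) (K c 1)" "ext_step r b c g (K, P) = (K', P')"
  shows "bal2 r b (K' c' 0) (K' c' 1)"
proof -
  define e where "e = excess r b (P g)"
  have e2: "e < 2" "1 - e \<noteq> e" by (simp_all add: e_def excess_def)
  obtain ke kf pe pf where ext: "ext r b (K c e) (K c (1 - e)) (P g e) (P g (1 - e)) = (ke, kf, pe, pf)"
    by (metis prod_cases4)
  have K': "K' = K(c := (K c)(e := ke, 1 - e := kf))"
    using assms(2) ext by (simp add: ext_step_def Let_def flip: e_def)
  have balc: "bal2 r b (K c e) (K c (1 - e))" using bal2_colour[OF e2(1), of r b "K c"] assms(1) by simp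
  have "bal2 r b ke kf"
  proof (cases "r * P g (1 - e) < b * P g e")
    case True
    then show ?thesis by (rule ext_props(5)[OF rb balc _ ext])
  next
    case False
    then show ?thesis using ext balc by (simp add: ext_def)
  qed
  then have "bal2 r b (K' c e) (K' c (1 - e))" using e2 by (simp add: K')
  then have "bal2 r b (K' c 0) (K' c 1)" using bal2_colour[OF e2(1), of r b "K' c"] by simp
  then show ?thesis using assms(1) K' by (cases "c' = c") auto
qed

lemma ext_run_bal2: "bal2 r b (fst (ext_run r b C G (keep0 C, P0) i) c 0) (fst (ext_run r b C G (keep0 C, P0) i) c 1)"
proof (induction i arbitrary: c)
  case 0
  show ?case using bal2_keep0 by simp
next
  case (Suc i)
  obtain K P where 1: "ext_run r b C G (keep0 C, P0) i = (K, P)" by fastforce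
  obtain K' P' where 2: "ext_step r b (C i) (G i) (K, P) = (K', P')" by fastforce
  from ext_step_bal2[OF _ 2] Suc 1 show ?case by (simp add: 2)
qed

lemma ext_step_other:
  assumes "ext_step r b c g (K, P) = (K', P')"
  shows "c' \<noteq> c \<Longrightarrow> K' c' = K c'" "g' \<noteq> g \<Longrightarrow> P' g' = P g'"
  using assms by (auto simp: ext_step_def Let_def split: prod.splits)

lemma pass_ext:
  assumes m: "inp m" "grp m G" "cel m C"
    and K: "\<And>j x. j < n \<Longrightarrow> x < 2 \<Longrightarrow> m 25 (2 * C j + x) = real (keep0 C (C j) x)"
    and P: "\<And>j x. j < n \<Longrightarrow> x < 2 \<Longrightarrow> m 26 (2 * G j + x) = real (pool0 G C (G j) x)"
  shows "runs pass_ext m (9 + n * 600) (\<lambda>m'. eqx {5, 14, 15, 16, 17, 18, 25, 26, 31, 32, 33, 34} m m' \<and>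
    (\<forall>j<n. \<forall>x<2. m' 25 (2 * C j + x) = real (fst (final G C) (C j) x)) \<and>
    (\<forall>j<n. \<forall>x<2. m' 26 (2 * G j + x) = real (snd (final G C) (G j) x)))"
proof -
  let ?A = "{5, 14, 15, 16, 17, 18, 25, 26, 31, 32, 33, 34} :: nat set"
  let ?st = "ext_run r b C G (keep0 C, pool0 G C)"
  let ?I = "\<lambda>i m'. eqx ?A m m' \<and> (\<forall>j<n. \<forall>x<2. m' 25 (2 * C j + x) = real (fst (?st i) (C j) x)) \<and>
    (\<forall>j<n. \<forall>x<2. m' 26 (2 * G j + x) = real (snd (?st i) (G j) x))"
  show ?thesis unfolding pass_ext_def
  proof (rule runs_For[where N = n and T = 588 and I = ?I], goal_cases)
    case 1
    then show ?case using K P by (simp add: eqx_store)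
  next
    case (2 i m')
    then show ?case using m eqxD[of ?A m m' 0] by (simp add: inp_def)
  next
    case (3 i m')
    have e: "m' 20 = m 20" "m' 21 = m 21" using 3(2) eqxD[of ?A m m'] by simp_all
    have C: "m' 20 i = real (G i)" "m' 21 i = real (C i)" using m 3(1) e by (simp_all add: grp_def cel_def)
    obtain K1 P1 where 1: "?st i = (K1, P1)" by fastforce
    obtain K2 P2 where 2: "ext_step r b (C i) (G i) (K1, P1) = (K2, P2)" by fastforce
    have st: "?st (Suc i) = (K2, P2)" using 1 2 by simp
    have K1: "m' 25 (2 * C j + x) = real (K1 (C j) x)" "m' 26 (2 * G j + x) = real (P1 (G j) x)" if "j < n" "x < 2" for j x
      using 3(2) that 1 by simp_all
    have bal: "bal2 r b (K1 (C i) 0) (K1 (C i) 1)"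
      using ext_run_bal2[of C G "pool0 G C" i "C i"] 1 by simp
    note code = ext_code[where K = K1 and P = P1, OF 3(3) C K1(1)[OF 3(1)] K1(2)[OF 3(1)] bal 2]
    let ?m = "sem ext_code m'"
    have A: "?m 25 (2 * C j + x) = real (K2 (C j) x)" if "j < n" "x < 2" for j x
    proof (cases "C j = C i")
      case True
      then show ?thesis using code(1)[OF _ _ that(2)] by simp
    next
      case False
      have "?m 25 (2 * C j + x) = m' 25 (2 * C j + x)"
        by (rule code(3)) (use False that(2) cell_eq_iff in auto)
      then show ?thesis using K1(1)[OF that] ext_step_other(1)[OF 2 False] by simp
    qed
    have B: "?m 26 (2 * G j + x) = real (P2 (G j) x)" if "j < n" "x < 2" for j x
    proof (cases "G j = G i")
      case True
      then show ?thesis using code(2)[OF _ _ that(2)] by simp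
    next
      case False
      have "?m 26 (2 * G j + x) = m' 26 (2 * G j + x)"
        by (rule code(4)) (use False that(2) cell_eq_iff in auto)
      then show ?thesis using K1(2)[OF that] ext_step_other(2)[OF 2 False] by simp
    qed
    have q: "eqx ?A m ?m" using 3(2) by (auto simp: eqx_def code(5))
    have s5: "?m 5 0 = real i" using code(5)[of 5] 3(3) by simp
    have s: "store 5 0 v m'' 25 = m'' 25" "store 5 0 v m'' 26 = m'' 26" for v m'' by simp_all
    show ?case
      by (rule runs_straight, simp add: ext_code_def ext_load_def ext_prep_def ext_move_cells_def, unfold s st fst_conv snd_conv)
        (use s5 eqx_store[OF q, of 5] A B in blast, simp add: ext_code_def ext_load_def ext_prep_def ext_move_cells_def)
  next
    case (4 m')
    then show ?case by (simp add: final_def)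
  qed simp
qed

definition block_prep :: com where
  "block_prep = Seq (Cond (Less (sc 14) (sc 13)) (setv 17 (Minus (sc 13) (sc 14))) (setv 17 (Minus (sc 14) (sc 13))))
     (Seq (setv 18 (Floor (Divide (sc 17) (Lit (int (r - b))))))
     (Seq (setv 19 (Minus (sc 17) (Times (sc 18) (Lit (int (r - b))))))
       (setv 28 (Floor (Divide (Plus (Times (Lit (int b)) (sc 19)) (Lit (int (r - b - 1)))) (Lit (int (r - b))))))))"

definition block_side :: com where
  "block_side = Cond (Less (sc 14) (sc 13))
     (Seq (setv 16 (Lit (int r))) (setv 29 (Plus (sc 28) (sc 19))))
     (Seq (setv 16 (Lit (int b))) (setv 29 (sc 28)))"

definition block_index :: com where
  "block_index = Cond (Less (sc 15) (Times (sc 16) (sc 18))) (setv 30 (Floor (Divide (sc 15) (sc 16))))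
     (Cond (Less (sc 15) (Plus (Times (sc 16) (sc 18)) (sc 29))) (setv 30 (sc 18))
       (setv 30 (Minus (Plus (Plus (sc 15) (Lit 1)) (sc 18)) (Plus (Times (sc 16) (sc 18)) (sc 29)))))"

definition block_code :: com where
  "block_code = Seq block_prep (Seq block_side block_index)"

text \<open>For \<open>r = b\<close> the machine divides by 0; real division then yields 0, just
  like \<open>div\<close> on the naturals, so no case distinction arises.\<close>

lemma block_code:
  assumes "m 13 0 = real M" "m 14 0 = real M'" "m 15 0 = real p"
  shows "sem block_code m 30 0 = real (block r b p M M')"
proof -
  define z where "z = max M M' - min M M'"
  define k e y where "k = block_count r b z" and "e = block_rest r b z" and "y = block_mid r b z"
  define u where "u = (if M' < M then r else b)"
  define v where "v = (if M' < M then y + e else y)"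
  define m1 where "m1 = sem block_prep m"
  have 17: "m1 17 0 = real z"
    using assms by (simp add: m1_def block_prep_def z_def of_nat_diff max_def min_def)
  have kz: "k * (r - b) \<le> z" by (simp add: k_def block_count_def)
  have 18: "m1 18 0 = real k"
    using assms 17[unfolded m1_def] by (simp add: m1_def block_prep_def k_def block_count_def floor_nat_div del: of_nat_diff)
  have 19: "m1 19 0 = real e"
  proof -
    have "m1 19 0 = m1 17 0 - m1 18 0 * real (r - b)" by (simp add: m1_def block_prep_def del: of_nat_diff)
    then show ?thesis using kz unfolding 17 18 by (simp add: e_def block_rest_def k_def of_nat_diff del: of_nat_diff_real)
  qed
  have 28: "m1 28 0 = real y"
  proof -
    have "m1 28 0 = real_of_int \<lfloor>(real b * m1 19 0 + real (r - b - 1)) / real (r - b)\<rfloor>"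
      by (simp add: m1_def block_prep_def del: of_nat_diff)
    then show ?thesis unfolding 19 y_def block_mid_def e_def
      by (simp only: floor_nat_div flip: of_nat_add of_nat_mult)
  qed
  have 1: "m1 a = m a" if "a \<notin> {17, 18, 19, 28}" for a using that by (simp add: m1_def block_prep_def)
  define m2 where "m2 = sem block_side m1"
  have 16: "m2 16 0 = real u" "m2 29 0 = real v"
    using assms 1 19 28 by (simp_all add: m2_def block_side_def u_def v_def)
  have 2: "m2 a = m1 a" if "a \<notin> {16, 29}" for a using that by (simp add: m2_def block_side_def)
  have b30: "block r b p M M' = cut_index u k v p"
    by (simp add: block_def Let_def u_def v_def flip: z_def k_def e_def y_def)
  have c: "real p < real u * real k \<longleftrightarrow> p < u * k" "real p < real u * real k + real v \<longleftrightarrow> p < u * k + v"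
    by (metis of_nat_less_iff of_nat_mult) (metis of_nat_add of_nat_less_iff of_nat_mult)
  have v15: "m2 15 0 = real p" "m2 18 0 = real k" using assms 1 2 18 by simp_all
  have "sem block_index m2 30 0 = real (cut_index u k v p)"
    using 16 v15 c by (simp add: block_index_def cut_index_def floor_nat_div of_nat_diff)
  then show "sem block_code m 30 0 = real (block r b p M M')"
    unfolding b30 by (simp add: block_code_def m2_def m1_def)
qed

definition keep_point :: com where
  "keep_point = Seq (Assign 20 (sc 5) (here 21)) (setv 12 (Lit 1))"

definition pool_load :: com where
  "pool_load = Seq (setv 13 (Get 26 (cell (here 20) (here 2)))) (Seq (setv 14 (Get 26 (cell (here 20) other)))
     (Seq (setv 15 (Get 27 (cell (here 20) (here 2)))) (Assign 27 (cell (here 20) (here 2)) (Plus (sc 15) (Lit 1)))))"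

definition pool_label :: com where
  "pool_label = Seq (setv 13 (Plus (Times (Plus (here 20) (sc 30)) (Plus (here 20) (sc 30))) (sc 30)))
     (Seq (Assign 3 (sc 5) (Plus (Times (Plus (sc 13) (sc 4)) (Plus (sc 13) (sc 4))) (sc 4)))
       (Assign 20 (sc 5) (Lit 0)))"

definition assign_code :: com where
  "assign_code = Cond (Less (Lit 0) (here 20))
     (Cond (Less (here 22) (Get 25 (cell (here 21) (here 2)))) keep_point
       (Seq pool_load (Seq block_code pool_label))) Skip"

definition pass_assign :: com where
  "pass_assign = For 5 points assign_code"

text \<open>The inner pair separates the fairlets made in one level, the outer one the levels; hence
  a new label never repeats an old one.\<close>

definition new_label :: "nat \<Rightarrow> (nat \<Rightarrow> nat) \<Rightarrow> (nat \<Rightarrow> nat) \<Rightarrow> (nat \<Rightarrow> nat) \<Rightarrow> nat \<Rightarrow> nat" where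
  "new_label lev G C L i = (if pooled G C i then npair (npair (G i) (pool_block G C i)) lev else L i)"

lemma pass_assign:
  assumes m: "inp m" "grp m G" "cel m C" "m 4 0 = real lev" "m 12 0 = 0" and L: "\<And>j. j < n \<Longrightarrow> m 3 j = real (L j)"
    and rk: "\<And>j. j < n \<Longrightarrow> m 22 j = real (rank C j)"
    and K: "\<And>j x. j < n \<Longrightarrow> x < 2 \<Longrightarrow> m 25 (2 * C j + x) = real (fst (final G C) (C j) x)"
    and P: "\<And>j x. j < n \<Longrightarrow> x < 2 \<Longrightarrow> m 26 (2 * G j + x) = real (snd (final G C) (G j) x)"
    and z: "\<And>j x. j < n \<Longrightarrow> x < 2 \<Longrightarrow> m 27 (2 * G j + x) = 0"
    and pos: "\<And>i. i < n \<Longrightarrow> 0 < G i \<Longrightarrow> 0 < C i"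
  shows "runs pass_assign m (9 + n * 600) (\<lambda>m'. eqx {3, 5, 12, 13, 14, 15, 16, 17, 18, 19, 20, 27, 28, 29, 30} m m' \<and>
    grp m' (newG G C) \<and> (\<forall>j<n. m' 3 j = real (new_label lev G C L j)) \<and>
    (0 < m' 12 0 \<longleftrightarrow> (\<exists>j<n. 0 < newG G C j)))"
proof -
  let ?A = "{3, 5, 12, 13, 14, 15, 16, 17, 18, 19, 20, 27, 28, 29, 30} :: nat set"
  let ?Q = "\<lambda>i g x. card {k. k < i \<and> G k = g \<and> cl k = x \<and> pooled G C k}"
  let ?I = "\<lambda>i m'. eqx ?A m m' \<and> (\<forall>j<n. m' 20 j = real (if j < i then newG G C j else G j)) \<and>
    (\<forall>j<n. m' 3 j = real (if j < i then new_label lev G C L j else L j)) \<and>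
    (\<forall>j<n. \<forall>x<2. m' 27 (2 * G j + x) = real (?Q i (G j) x)) \<and>
    (0 < m' 12 0 \<longleftrightarrow> (\<exists>j<i. 0 < newG G C j))"
  show ?thesis unfolding pass_assign_def
  proof (rule runs_For[where N = n and T = 588 and I = ?I], goal_cases)
    case 1
    then show ?case using m L z by (simp add: eqx_store grp_def)
  next
    case (2 i m')
    then show ?case using m eqxD[of ?A m m' 0] by (simp add: inp_def)
  next
    case (3 i m')
    let ?m = "sem assign_code m'"
    have e: "m' 2 = m 2" "m' 4 = m 4" "m' 21 = m 21" "m' 22 = m 22" "m' 25 = m 25" "m' 26 = m 26"
      using 3(2) eqxD[of ?A m m'] by simp_all
    have v: "m' 20 i = real (G i)" "m' 21 i = real (C i)" "m' 2 i = real (cl i)" "m' 22 i = real (rank C i)" "m' 4 0 = real lev"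
      using m rk 3(1,2) e by (simp_all add: cel_def inp_def)
    have vK: "m' 25 (2 * C i + cl i) = real (fst (final G C) (C i) (cl i))"
      "m' 26 (2 * G i + cl i) = real (snd (final G C) (G i) (cl i))"
      "m' 26 (2 * G i + (1 - cl i)) = real (snd (final G C) (G i) (1 - cl i))"
      unfolding e by ((rule K P)[1]; use 3(1) cl[of i] in simp)+
    have vQ: "m' 27 (2 * G i + cl i) = real (pool_rank G C i)"
      using 3(1,2) cl[of i] by (simp add: pool_rank_def)
    note ao = addr_other[OF cl[of i], of "G i"]
    have Qs: "?Q (Suc i) g x = ?Q i g x + (if G i = g \<and> cl i = x \<and> pooled G C i then 1 else 0)" for g x
    proof -
      have "{k. k < Suc i \<and> G k = g \<and> cl k = x \<and> pooled G C k} =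
        (if G i = g \<and> cl i = x \<and> pooled G C i then insert i {k. k < i \<and> G k = g \<and> cl k = x \<and> pooled G C k}
         else {k. k < i \<and> G k = g \<and> cl k = x \<and> pooled G C k})"
        by (auto simp: less_Suc_eq)
      then show ?thesis by simp
    qed
    have st: "straight assign_code" "wcost assign_code \<le> 588"
      by (simp_all add: assign_code_def keep_point_def pool_load_def pool_label_def block_code_def block_prep_def
        block_side_def block_index_def)
    have cond: "m' 20 i > 0 \<longleftrightarrow> 0 < G i" "m' 22 i < m' 25 (2 * C i + cl i) \<longleftrightarrow> rank C i < fst (final G C) (C i) (cl i)"
      using v vK by simp_all
    have up: "m'' 20 j = real (if j < Suc i then newG G C j else G j)"
      if "m'' 20 = (m' 20)(i := real (newG G C i))" "j < n" for j and m'' :: memory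
      using that 3(2) by (auto simp: less_Suc_eq)
    have up3: "m'' 3 j = real (if j < Suc i then new_label lev G C L j else L j)"
      if "m'' 3 = (m' 3)(i := real (new_label lev G C L i))" "j < n" for j and m'' :: memory
      using that 3(2) by (auto simp: less_Suc_eq)
    have ex: "(\<exists>j<Suc i. 0 < newG G C j) \<longleftrightarrow> (\<exists>j<i. 0 < newG G C j) \<or> 0 < newG G C i"
      by (auto simp: less_Suc_eq)
    have main: "eqx ?A m ?m \<and> ?m 20 = (m' 20)(i := real (newG G C i)) \<and> ?m 3 = (m' 3)(i := real (new_label lev G C L i)) \<and>
      (\<forall>j<n. \<forall>x<2. ?m 27 (2 * G j + x) = real (?Q (Suc i) (G j) x)) \<and>
      (0 < ?m 12 0 \<longleftrightarrow> 0 < m' 12 0 \<or> 0 < newG G C i) \<and> ?m 5 0 = real i"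
    proof (cases "0 < G i")
      case False
      then have "?m = m'" using v 3(3) by (simp add: assign_code_def)
      moreover have "newG G C i = G i" "\<not> pooled G C i" using False by (simp_all add: newG_def pooled_def)
      moreover have "m' 20 = (m' 20)(i := real (G i))" "m' 3 = (m' 3)(i := real (L i))"
        using v 3(1,2) by auto
      ultimately show ?thesis using False 3(2,3) Qs by (simp add: new_label_def)
    next
      case G: True
      show ?thesis
      proof (cases "rank C i < fst (final G C) (C i) (cl i)")
        case True
        then have np: "\<not> pooled G C i" "newG G C i = C i" using G by (simp_all add: newG_def pooled_def)
        have m2: "?m = sem keep_point m'" using G True v vK 3(3) by (simp add: assign_code_def)
        have "m' 3 = (m' 3)(i := real (L i))" using 3(1,2) by auto
        then show ?thesis unfolding m2 Qs using np pos[OF 3(1) G] 3(2,3) v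
          by (simp add: keep_point_def new_label_def eqx_store fun_upd_def)
      next
        case False
        then have po: "pooled G C i" "newG G C i = 0" using G by (simp_all add: newG_def pooled_def)
        define m1 where "m1 = sem pool_load m'"
        define m2 where "m2 = sem block_code m1"
        have m3: "?m = sem pool_label m2" using G False v vK 3(3) by (simp add: assign_code_def m1_def m2_def)
        have 1: "m1 13 0 = real (snd (final G C) (G i) (cl i))" "m1 14 0 = real (snd (final G C) (G i) (1 - cl i))"
          "m1 15 0 = real (pool_rank G C i)" "m1 27 = (m' 27)(2 * G i + cl i := real (pool_rank G C i) + 1)"
          unfolding m1_def pool_load_def using v vK vQ ao 3(3) by (simp_all add: fun_upd_def)
        have o1: "m1 a = m' a" if "a \<notin> {13, 14, 15, 27}" for a using that by (simp add: m1_def pool_load_def)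
        have 2: "m2 30 0 = real (pool_block G C i)"
          unfolding m2_def pool_block_def by (rule block_code; rule 1)
        have o2: "m2 a = m1 a" if "a \<notin> {16, 17, 18, 19, 28, 29, 30}" for a
          unfolding m2_def using that by (simp add: block_code_def block_prep_def block_side_def block_index_def)
        have w: "m2 5 0 = real i" "m2 20 = m' 20" "m2 20 i = real (G i)" "m2 4 0 = real lev" "m2 3 = m' 3"
          "m2 27 = m1 27" "m2 12 = m' 12"
          using o2 o1 3(3) v by simp_all
        have "eqx ?A m m1" using 3(2) o1 by (auto simp: eqx_def)
        then have "eqx ?A m m2" using o2 by (auto simp: eqx_def)
        then have q: "eqx ?A m (sem pool_label m2)" by (simp add: pool_label_def eqx_store)
        have s3: "sem pool_label m2 3 = (m' 3)(i := real (new_label lev G C L i))"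
          using w 2 po by (simp add: pool_label_def new_label_def npair_def fun_upd_def power2_eq_square)
        have s20: "sem pool_label m2 20 = (m' 20)(i := real (newG G C i))"
          using w po by (simp add: pool_label_def fun_upd_def)
        have s27: "sem pool_label m2 27 = (m' 27)(2 * G i + cl i := real (pool_rank G C i) + 1)"
          using w 1(4) by (simp add: pool_label_def fun_upd_def)
        have s12: "sem pool_label m2 12 = m' 12" "sem pool_label m2 5 0 = real i"
          using w by (simp_all add: pool_label_def)
        have "sem pool_label m2 27 (2 * G j + x) = real (?Q (Suc i) (G j) x)" if "j < n" "x < 2" for j x
        proof (cases "G i = G j \<and> cl i = x")
          case True
          then show ?thesis unfolding Qs s27 using po by (auto simp: pool_rank_def)
        next
          case False
          then have "2 * G j + x \<noteq> 2 * G i + cl i" using cell_eq_iff[OF that(2) cl] by metis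
          then show ?thesis unfolding Qs s27 using False 3(2) that by auto
        qed
        then show ?thesis unfolding m3 using q s3 s20 s12 po by simp
      qed
    qed
    have s: "store 5 0 v m'' 20 = m'' 20" "store 5 0 v m'' 3 = m'' 3" "store 5 0 v m'' 27 = m'' 27"
      "store 5 0 v m'' 12 = m'' 12" for v m'' by simp_all
    have q: "eqx ?A m (store 5 0 (real (Suc i)) ?m)" using main by (simp add: eqx_store)
    have m5: "?m 5 0 = real i" and m20: "?m 20 = (m' 20)(i := real (newG G C i))"
      and m3: "?m 3 = (m' 3)(i := real (new_label lev G C L i))"
      and m27: "\<forall>j<n. \<forall>x<2. ?m 27 (2 * G j + x) = real (?Q (Suc i) (G j) x)"
      and m12: "0 < ?m 12 0 \<longleftrightarrow> 0 < m' 12 0 \<or> 0 < newG G C i"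
      using main by - (elim conjE, assumption)+
    have a20: "\<forall>j<n. ?m 20 j = real (if j < Suc i then newG G C j else G j)" using up[of ?m, OF m20] by (intro allI impI)
    have a3: "\<forall>j<n. ?m 3 j = real (if j < Suc i then new_label lev G C L j else L j)" using up3[of ?m, OF m3] by (intro allI impI)
    have old12: "0 < m' 12 0 \<longleftrightarrow> (\<exists>j<i. 0 < newG G C j)" using 3(2) by (elim conjE)
    have a12: "0 < ?m 12 0 \<longleftrightarrow> (\<exists>j<Suc i. 0 < newG G C j)" unfolding ex m12 old12 ..
    show ?case
    proof (rule runs_straight[OF st(1) _ st(2)], unfold s, intro conjI)
    qed (fact m5 q a20 a3 m27 a12)+
  next
    case (4 m')
    then show ?case by (simp add: grp_def)
  qed simp
qed

end

section \<open>Assembling a level from its passes\<close>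

lemma runs_chain: "runs c m S P \<Longrightarrow> (\<And>m'. P m' \<Longrightarrow> runs d m' T Q) \<Longrightarrow> S + T \<le> R \<Longrightarrow> runs (Seq c d) m R Q"
  by (rule runs_Seq[where S = S and T = T]) (auto intro: runs_mono)

text \<open>A single uniform draw between two deterministic programs: there is one final memory
  \<open>M k\<close> per value drawn, and expectations are plain averages over \<open>k\<close>.
  This is the only place where a random instruction is executed.\<close>

lemma exec_Random_average:
  assumes h: "runs h m S R" and N: "\<And>m1. R m1 \<Longrightarrow> aval e m1 = real N" "0 < N"
    and body: "\<And>m1 k. R m1 \<Longrightarrow> k < N \<Longrightarrow> runs body (store a (addr (aval i m1)) (real k) m1) T (Q k)"
  shows "\<exists>\<mu> M. exec (Seq h (Seq (Random a i e) body)) m \<mu> \<and> (\<forall>k<N. Q k (M k)) \<and>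
    (\<forall>(m', t)\<in>set_pmf \<mu>. t \<le> S + (1 + acost i + acost e) + T \<and> (\<exists>k<N. m' = M k)) \<and>
    (\<forall>\<Phi>. expect \<mu> \<Phi> = (\<Sum>k<N. \<Phi> (M k)) / real N)"
proof -
  obtain m1 s where 1: "exec h m (return_pmf (m1, s))" "s \<le> S" "R m1"
    using h unfolding runs_def by blast
  let ?st = "\<lambda>k. store a (addr (aval i m1)) (real k) m1"
  have "\<exists>p. exec body (?st k) (return_pmf p) \<and> snd p \<le> T \<and> Q k (fst p)" if "k < N" for k
    using body[OF 1(3) that] unfolding runs_def by (metis fst_conv snd_conv)
  then obtain p where p: "\<And>k. k < N \<Longrightarrow> exec body (?st k) (return_pmf (p k)) \<and> snd (p k) \<le> T \<and> Q k (fst (p k))"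
    by metis
  \<comment> \<open>The continuation must be a function of the memory, which may coincide for
    different \<open>k\<close>; by \<open>exec_deterministic\<close> any choice gives the right
    point mass.\<close>
  define \<nu> where "\<nu> m' = (SOME \<kappa>. exec body m' \<kappa>)" for m'
  have \<nu>: "\<nu> (?st k) = return_pmf (p k)" if "k < N" for k
    unfolding \<nu>_def using p[OF that] exec_deterministic by (metis (mono_tags, lifting) someI_ex)
  let ?c = "1 + acost i + acost e"
  define \<rho> where "\<rho> = map_pmf (\<lambda>k. (?st k, ?c)) (pmf_of_set {..<N})"
  have ne: "{..<N} \<noteq> {}" "finite {..<N}" using N(2) by auto
  have addrN: "addr (aval e m1) = N" using N(1)[OF 1(3)] by simp
  have "exec (Random a i e) m1 \<rho>"
    using exec.Random[of e m1 a i] N(2) unfolding addrN \<rho>_def by simp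
  then have "exec (Seq (Random a i e) body) m1 (bind_pmf \<rho> (\<lambda>(m', t). tick t (\<nu> m')))"
  proof (rule exec.Seq)
    fix m' t assume "(m', t) \<in> set_pmf \<rho>"
    then obtain k where "k < N" "m' = ?st k" using ne by (auto simp: \<rho>_def)
    then show "exec body m' (\<nu> m')" using p \<nu> by simp
  qed
  also have "bind_pmf \<rho> (\<lambda>(m', t). tick t (\<nu> m')) = bind_pmf (pmf_of_set {..<N}) (\<lambda>k. tick ?c (\<nu> (?st k)))"
    unfolding \<rho>_def bind_map_pmf by simp
  also have "\<dots> = bind_pmf (pmf_of_set {..<N}) (\<lambda>k. return_pmf (fst (p k), ?c + snd (p k)))"
    using ne \<nu> by (intro bind_pmf_cong) (auto simp: tick_def case_prod_unfold)
  also have "\<dots> = map_pmf (\<lambda>k. (fst (p k), ?c + snd (p k))) (pmf_of_set {..<N})"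
    by (simp add: map_pmf_def)
  finally have 2: "exec (Seq (Random a i e) body) m1 (map_pmf (\<lambda>k. (fst (p k), ?c + snd (p k))) (pmf_of_set {..<N}))" .
  have "exec (Seq h (Seq (Random a i e) body)) m
      (bind_pmf (return_pmf (m1, s)) (\<lambda>(m', t). tick t (map_pmf (\<lambda>k. (fst (p k), ?c + snd (p k))) (pmf_of_set {..<N}))))"
    by (rule exec.Seq[OF 1(1)]) (use 2 in auto)
  then have 3: "exec (Seq h (Seq (Random a i e) body)) m
      (map_pmf (\<lambda>k. (fst (p k), s + (?c + snd (p k)))) (pmf_of_set {..<N}))" (is "exec _ _ ?\<mu>")
    by (simp add: bind_return_pmf tick_def pmf.map_comp o_def case_prod_unfold)
  have "expect ?\<mu> \<Phi> = (\<Sum>k<N. \<Phi> (fst (p k))) / real N" for \<Phi>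
    unfolding expect_def using ne by (simp add: integral_pmf_of_set)
  moreover have "\<forall>(m', t)\<in>set_pmf ?\<mu>. t \<le> S + ?c + T \<and> (\<exists>k<N. m' = fst (p k))"
  proof (clarsimp simp: set_pmf_of_set[OF ne])
    fix k assume "k < N"
    then have "snd (p k) \<le> T" using p by blast
    then show "s + snd (p k) \<le> S + T \<and> (\<exists>k'<N. fst (p k) = fst (p k'))" using 1(2) \<open>k < N\<close> by auto
  qed
  ultimately show ?thesis using 3 p
    by (intro exI[of _ ?\<mu>] exI[of _ "\<lambda>k. fst (p k)"]) auto
qed

locale euclid_prog = prog + solution +
  fixes Kr :: nat
  assumes \<delta>_eq: "\<And>i j. \<delta> i j = L2_set (\<lambda>t. X i t - X j t) {..<d}"
    and d_pos: "1 \<le> d" and D_pos: "1 \<le> D"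
begin

definition state :: "memory \<Rightarrow> (nat \<Rightarrow> nat) \<Rightarrow> (nat \<Rightarrow> nat) \<Rightarrow> nat \<Rightarrow> bool" where
  "state m G L lev \<longleftrightarrow> inp m \<and> grp m G \<and> (\<forall>j<n. m 3 j = real (L j)) \<and> m 4 0 = real lev \<and> m 7 0 = real Kr \<and>
    (0 < m 12 0 \<longleftrightarrow> (\<exists>j<n. 0 < G j))"

lemma state_eqx:
  assumes "eqx A m m'" "{0, 1, 2, 3, 4, 7, 12, 20} \<inter> A = {}" "state m G L lev"
  shows "state m' G L lev"
proof -
  have "inp m'" by (rule inp_eqx[OF assms(1)]) (use assms in \<open>auto simp: state_def\<close>)
  moreover have "m' 3 = m 3" "m' 4 = m 4" "m' 7 = m 7" "m' 12 = m 12" "m' 20 = m 20"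
    using assms(2) by (auto intro!: eqxD[OF assms(1)])
  ultimately show ?thesis using assms(3) by (simp add: state_def grp_def)
qed

lemma \<delta>_sym: "\<delta> i j = \<delta> j i"
  unfolding \<delta>_eq L2_set_def by (simp add: power2_commute)

lemma \<delta>_triangle: "\<delta> i j \<le> \<delta> i k + \<delta> k j"
  using L2_set_triangle_ineq[of "\<lambda>t. X i t - X k t" "\<lambda>t. X k t - X j t" "{..<d}"] unfolding \<delta>_eq by simp

definition level_head :: com where
  "level_head = Seq pass_pivot (Seq pass_dist halve)"

text \<open>The lower bound on the diameter makes cells of side \<open>s / D\<close> shrink it by
  the factor \<open>D\<close>; the upper bound keeps the product of diameter and probability of a
  cut independent of \<open>s\<close>.\<close>

definition good_scale :: "(nat \<Rightarrow> nat) \<Rightarrow> real \<Rightarrow> bool" where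
  "good_scale G s \<longleftrightarrow> 0 \<le> s \<and> sqrt (real d) * s \<le> diam G \<and> diam G \<le> 4 * (sqrt (real d) * s)"

text \<open>The factor 4 is a product of two factors 2: the diameter is at most twice the radius, by
  the triangle inequality through the pivot, and halving locates the radius up to a factor
  2.\<close>

lemma scale_ok:
  assumes pv: "\<And>i. i < n \<Longrightarrow> pv i < n \<and> G (pv i) = G i"
    and pv_eq: "\<And>i j. i < n \<Longrightarrow> j < n \<Longrightarrow> G i = G j \<Longrightarrow> pv i = pv j"
    and R: "maxset R (dsq pv ` {i. i < n \<and> 0 < G i})"
    and s: "0 \<le> s" "real d * s\<^sup>2 \<le> R" "R \<le> 4 * (real d * s\<^sup>2)"
  shows "good_scale G s"
proof -
  have dsq: "dsq pv i = (\<delta> i (pv i))\<^sup>2" for i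
    unfolding \<delta>_eq L2_set_def dsq_def by (simp add: sum_nonneg)
  have R0: "0 \<le> R" using R by (simp add: maxset_def)
  have "sqrt R \<le> diam G"
  proof (cases "R = 0")
    case True
    then show ?thesis by (simp add: diam_nonneg)
  next
    case False
    then obtain i where i: "i < n" "0 < G i" "R = dsq pv i" using R by (auto simp: maxset_def)
    then have "sqrt R = \<delta> i (pv i)" using \<delta>_nonneg by (simp add: dsq)
    also have "\<dots> \<le> diam G" using i pv[OF i(1)] by (intro diam_ge) auto
    finally show ?thesis .
  qed
  moreover have "sqrt (real d) * s \<le> sqrt R"
    using s by (intro real_le_rsqrt) (simp add: power_mult_distrib)
  moreover have "diam G \<le> 2 * sqrt R"
  proof (rule diam_le)
    fix i j assume ij: "i < n" "j < n" "G i = G j" "0 < G i"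
    have *: "\<delta> k (pv k) \<le> sqrt R" if "k < n" "0 < G k" for k
    proof -
      have "dsq pv k \<le> R" using R that by (auto simp: maxset_def)
      then show ?thesis unfolding dsq by (rule real_le_rsqrt)
    qed
    have "\<delta> i j \<le> \<delta> i (pv i) + \<delta> (pv i) j" by (rule \<delta>_triangle)
    also have "\<delta> (pv i) j = \<delta> j (pv j)" using pv_eq[OF ij(1-3)] \<delta>_sym by simp
    finally show "\<delta> i j \<le> 2 * sqrt R" using *[of i] *[of j] ij by simp
  qed (simp add: R0)
  moreover have "sqrt R \<le> 2 * (sqrt (real d) * s)"
    using s by (intro real_le_lsqrt) (simp_all add: power_mult_distrib)
  ultimately show ?thesis using s(1) by (simp add: good_scale_def)
qed

text \<open>Maximum norm against Euclidean norm.\<close>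

lemma spread_bounds:
  assumes R: "maxset R (dsq pv ` {i. i < n \<and> 0 < G i})" and w: "maxset w (spread G pv n)"
  shows "w\<^sup>2 \<le> R" "R \<le> real d * w\<^sup>2"
proof -
  show "w\<^sup>2 \<le> R"
  proof (cases "w = 0")
    case True
    then show ?thesis using R by (simp add: maxset_def)
  next
    case False
    then obtain j t where j: "j < n" "0 < G j" "t < d" "w = \<bar>X j t - X (pv j) t\<bar>"
      using w by (auto simp: maxset_def spread_def)
    then have "w\<^sup>2 = (X j t - X (pv j) t)\<^sup>2" by simp
    also have "\<dots> \<le> dsq pv j" unfolding dsq_def using j(3) by (intro member_le_sum) auto
    also have "\<dots> \<le> R" using R j by (auto simp: maxset_def)
    finally show ?thesis .
  qed
  show "R \<le> real d * w\<^sup>2"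
  proof (cases "R = 0")
    case False
    then obtain j where j: "j < n" "0 < G j" "R = dsq pv j" using R by (auto simp: maxset_def)
    have "dsq pv j \<le> (\<Sum>t<d. w\<^sup>2)" unfolding dsq_def
    proof (rule sum_mono)
      fix t assume "t \<in> {..<d}"
      then have "\<bar>X j t - X (pv j) t\<bar> \<in> spread G pv n" using j by (auto simp: spread_def)
      then have "\<bar>X j t - X (pv j) t\<bar> \<le> w" using w by (auto simp: maxset_def)
      then show "(X j t - X (pv j) t)\<^sup>2 \<le> w\<^sup>2" by (metis abs_ge_zero power2_abs power_mono)
    qed
    then show ?thesis using j by simp
  qed simp
qed

lemma level_head:
  assumes "state m G L lev"
  shows "runs level_head m (41 + n * (80 + d * 112) + d * 20) (\<lambda>m'. state m' G L lev \<and> good_scale G (m' 10 0))"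
  unfolding level_head_def
proof (rule runs_chain[OF pass_pivot])
  show "inp m" "grp m G" using assms by (simp_all add: state_def)
  fix m1 assume 1: "eqx {5, 23} m m1 \<and> (\<forall>i<n. \<exists>j<n. m1 23 (G i) = real j \<and> G j = G i)"
  have s1: "state m1 G L lev" by (rule state_eqx[OF conjunct1[OF 1] _ assms]) simp
  define pv where "pv i = addr (m1 23 (G i))" for i
  have pv: "m1 23 (G i) = real (pv i)" "pv i < n" "G (pv i) = G i" if "i < n" for i
    using 1 that unfolding pv_def by (metis addr_of_nat(1))+
  show "runs (Seq pass_dist halve) m1 (32 + n * (60 + d * 112) + d * 20) (\<lambda>m'. state m' G L lev \<and> good_scale G (m' 10 0))"
  proof (rule runs_chain[OF pass_dist[where pv = pv and G = G]])
    show "inp m1" "grp m1 G" using s1 by (simp_all add: state_def)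
    show "m1 23 (G i) = real (pv i) \<and> pv i < n" if "i < n" for i using pv[OF that] by simp
    fix m2 assume 2: "eqx {5, 6, 9, 10, 11, 13} m1 m2 \<and>
      maxset (m2 9 0) (dsq pv ` {i. i < n \<and> 0 < G i}) \<and> maxset (m2 10 0) (spread G pv n)"
    have s2: "state m2 G L lev" by (rule state_eqx[OF conjunct1[OF 2] _ s1]) simp
    note R = conjunct1[OF conjunct2[OF 2]] and w = conjunct2[OF conjunct2[OF 2]]
    note sp = spread_bounds[OF R w]
    have R0: "0 \<le> m2 9 0" "0 \<le> m2 10 0" using R w by (simp_all add: maxset_def)
    have "runs halve m2 (d * 20 + 12) (\<lambda>m'. eqx {10} m2 m' \<and> 0 \<le> m' 10 0 \<and>
      real d * (m' 10 0)\<^sup>2 \<le> m2 9 0 \<and> m2 9 0 \<le> 4 * (real d * (m' 10 0)\<^sup>2))"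
    proof (rule halve)
      show "m2 0 1 = real d" using s2 by (simp add: state_def inp_def)
      have "0 \<le> real d * (m2 10 0)\<^sup>2" by simp
      then show "m2 9 0 \<le> 4 * (real d * (m2 10 0)\<^sup>2)" using sp(2) by linarith
      have "real d * (m2 10 0)\<^sup>2 \<le> real d * m2 9 0" using sp(1) by (intro mult_left_mono) simp_all
      \<comment> \<open>At the start \<open>d * s^2\<close> exceeds the squared radius by a factor
        of at most \<open>d\<close>, which is below \<open>4 ^ d\<close>; so \<open>d\<close>
        halvings suffice, within a time of order \<open>d\<close>.\<close>
      also have "\<dots> \<le> 4 ^ d * m2 9 0"
      proof (rule mult_right_mono[OF _ R0(1)])
        have "real d \<le> 2 ^ d" using of_nat_less_two_power[of d, where ?'a = real] by simp
        also have "\<dots> \<le> 4 ^ d" by (intro power_mono) simp_all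
        finally show "real d \<le> 4 ^ d" .
      qed
      finally show "real d * (m2 10 0)\<^sup>2 \<le> 4 ^ d * m2 9 0" .
    qed (rule R0(2))
    then show "runs halve m2 (d * 20 + 12) (\<lambda>m'. state m' G L lev \<and> good_scale G (m' 10 0))"
    proof (rule runs_mono)
      fix m3 assume 3: "eqx {10} m2 m3 \<and> 0 \<le> m3 10 0 \<and>
        real d * (m3 10 0)\<^sup>2 \<le> m2 9 0 \<and> m2 9 0 \<le> 4 * (real d * (m3 10 0)\<^sup>2)"
      have s3: "state m3 G L lev" by (rule state_eqx[OF conjunct1[OF 3] _ s2]) simp
      have "good_scale G (m3 10 0)"
      proof (rule scale_ok[OF _ _ R])
        show "pv i < n \<and> G (pv i) = G i" if "i < n" for i using pv(2,3)[OF that] by simp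
        show "pv i = pv j" if "G i = G j" for i j using that by (simp add: pv_def)
      qed (use 3 in simp_all)
      with s3 show "state m3 G L lev \<and> good_scale G (m3 10 0)" ..
    qed simp
  qed simp
qed (simp add: distrib_left)

definition level_tail :: com where
  "level_tail = Seq (pass_key D) (Seq pass_clear (Seq pass_count (Seq pass_keep (Seq pass_ext
     (Seq (setv 12 (Lit 0)) (Seq pass_assign (setv 4 (Plus (sc 4) (Lit 1)))))))))"

lemma level_tail:
  assumes st: "state m G L lev" and C: "C = (\<lambda>i. ckey (G i) (zs (m 10 0 / real D) (m 8 0 / real Kr) i))"
  shows "runs level_tail m (77 + n * (1650 + d * 112)) (\<lambda>m'. state m' (newG G C) (new_label lev G C L) (Suc lev))"
  unfolding level_tail_def
proof -
  let ?Q = "\<lambda>m'. state m' (newG G C) (new_label lev G C L) (Suc lev)"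
  let ?t6 = "Seq pass_assign (setv 4 (Plus (sc 4) (Lit 1)))"
  let ?t5 = "Seq (setv 12 (Lit 0)) ?t6"
  let ?t4 = "Seq pass_ext ?t5"
  let ?t3 = "Seq pass_keep ?t4"
  let ?t2 = "Seq pass_count ?t3"
  let ?t1 = "Seq pass_clear ?t2"
  show "runs (Seq (pass_key D) ?t1) m (77 + n * (1650 + d * 112)) ?Q"
  proof (rule runs_chain[OF pass_key])
    show "inp m" "grp m G" using st by (simp_all add: state_def)
    fix m1 assume 1: "eqx {5, 6, 11, 13, 21} m m1 \<and> cel m1 (\<lambda>i. ckey (G i) (zs (m 10 0 / real D) (m 8 0 / m 7 0) i))"
    have s1: "state m1 G L lev" by (rule state_eqx[OF conjunct1[OF 1] _ st]) simp
    have c1: "cel m1 C" using 1 st by (simp add: C state_def)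
    have i1: "inp m1" "grp m1 G" using s1 by (simp_all add: state_def)
    have e21: "cel m' C" if "eqx A m0 m'" "21 \<notin> A" "cel m0 C" for A m0 m'
      using eqxD[OF that(1,2)] that(3) by (simp add: cel_def)
    show "runs ?t1 m1 (57 + n * 1610) ?Q"
    proof (rule runs_chain[OF pass_clear[OF i1 c1]])
      fix m2 assume 2: "eqx {5, 24, 25, 26, 27} m1 m2 \<and> (\<forall>j<n. \<forall>x<2. m2 24 (2 * C j + x) = 0 \<and>
        m2 25 (2 * C j + x) = 0 \<and> m2 26 (2 * G j + x) = 0 \<and> m2 27 (2 * G j + x) = 0)"
      have s2: "state m2 G L lev" by (rule state_eqx[OF conjunct1[OF 2] _ s1]) simp
      have c2: "cel m2 C" by (rule e21[OF conjunct1[OF 2] _ c1]) simp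
      have i2: "inp m2" "grp m2 G" using s2 by (simp_all add: state_def)
      show "runs ?t2 m2 (48 + n * 1460) ?Q"
      proof (rule runs_chain[OF pass_count[OF i2(1) c2]])
        show "m2 24 (2 * C j + x) = 0" if "j < n" "x < 2" for j x using 2 that by blast
        fix m3 assume 3: "eqx {5, 22, 24} m2 m3 \<and> (\<forall>j<n. m3 22 j = real (rank C j)) \<and>
          (\<forall>j<n. \<forall>x<2. m3 24 (2 * C j + x) = real (cell_count C (C j) x))"
        have s3: "state m3 G L lev" by (rule state_eqx[OF conjunct1[OF 3] _ s2]) simp
        have c3: "cel m3 C" by (rule e21[OF conjunct1[OF 3] _ c2]) simp
        have i3: "inp m3" "grp m3 G" using s3 by (simp_all add: state_def)
        have f3: "m3 25 = m2 25" "m3 26 = m2 26" "m3 27 = m2 27" using eqxD[OF conjunct1[OF 3]] by simp_all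
        show "runs ?t3 m3 (39 + n * 1400) ?Q"
        proof (rule runs_chain[OF pass_keep[OF i3 c3]])
          show "m3 22 j = real (rank C j)" if "j < n" for j using 3 that by blast
          show "m3 24 (2 * C j + x) = real (cell_count C (C j) x)" if "j < n" "x < 2" for j x using 3 that by blast
          show "m3 25 (2 * C j + x) = 0" "m3 26 (2 * G j + x) = 0" if "j < n" "x < 2" for j x
            using 2 that unfolding f3 by blast+
          fix m4 assume 4: "eqx {5, 25, 26} m3 m4 \<and> (\<forall>j<n. \<forall>x<2. m4 25 (2 * C j + x) = real (keep0 C (C j) x) \<and>
            m4 26 (2 * G j + x) = real (pool0 G C (G j) x))"
          have s4: "state m4 G L lev" by (rule state_eqx[OF conjunct1[OF 4] _ s3]) simp
          have c4: "cel m4 C" by (rule e21[OF conjunct1[OF 4] _ c3]) simp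
          have i4: "inp m4" "grp m4 G" using s4 by (simp_all add: state_def)
          have f4: "m4 22 = m3 22" "m4 27 = m3 27" using eqxD[OF conjunct1[OF 4]] by simp_all
          show "runs ?t4 m4 (30 + n * 1200) ?Q"
          proof (rule runs_chain[OF pass_ext[OF i4 c4]])
            show "m4 25 (2 * C j + x) = real (keep0 C (C j) x)" "m4 26 (2 * G j + x) = real (pool0 G C (G j) x)"
              if "j < n" "x < 2" for j x using 4 that by blast+
            fix m5 assume 5: "eqx {5, 14, 15, 16, 17, 18, 25, 26, 31, 32, 33, 34} m4 m5 \<and>
              (\<forall>j<n. \<forall>x<2. m5 25 (2 * C j + x) = real (fst (final G C) (C j) x)) \<and>
              (\<forall>j<n. \<forall>x<2. m5 26 (2 * G j + x) = real (snd (final G C) (G j) x))"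
            have s5: "state m5 G L lev" by (rule state_eqx[OF conjunct1[OF 5] _ s4]) simp
            have c5: "cel m5 C" by (rule e21[OF conjunct1[OF 5] _ c4]) simp
            have f5: "m5 22 = m4 22" "m5 27 = m4 27" using eqxD[OF conjunct1[OF 5]] by simp_all
            define m6 where "m6 = store 12 0 0 m5"
            have i6: "inp m6" by (rule inp_eqx[of "{12}" m5]) (use s5 in \<open>simp_all add: m6_def eqx_store state_def\<close>)
            have g6: "grp m6 G" "cel m6 C" using s5 c5 by (simp_all add: m6_def grp_def cel_def state_def)
            have "runs pass_assign m6 (9 + n * 600) (\<lambda>m'. eqx {3, 5, 12, 13, 14, 15, 16, 17, 18, 19, 20, 27, 28, 29, 30} m6 m' \<and>
              grp m' (newG G C) \<and> (\<forall>j<n. m' 3 j = real (new_label lev G C L j)) \<and> (0 < m' 12 0 \<longleftrightarrow> (\<exists>j<n. 0 < newG G C j)))"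
            proof (rule pass_assign[OF i6 g6])
              show "m6 4 0 = real lev" "m6 12 0 = 0" using s5 by (simp_all add: m6_def state_def)
              show "m6 3 j = real (L j)" if "j < n" for j using s5 that by (simp add: m6_def state_def)
              show "m6 22 j = real (rank C j)" if "j < n" for j using 3 that f4 f5 by (simp add: m6_def)
              show "m6 25 (2 * C j + x) = real (fst (final G C) (C j) x)" "m6 26 (2 * G j + x) = real (snd (final G C) (G j) x)"
                if "j < n" "x < 2" for j x using 5 that by (simp_all add: m6_def)
              show "m6 27 (2 * G j + x) = 0" if "j < n" "x < 2" for j x using 2 that f3 f4 f5 by (simp add: m6_def)
              show "0 < C i" if "0 < G i" for i using ckey_ge[of "G i"] that unfolding C by (rule less_le_trans[rotated])
            qed
            then have "runs ?t6 m6 (15 + n * 600) ?Q"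
            proof (rule runs_chain)
              fix m7 assume 7: "eqx {3, 5, 12, 13, 14, 15, 16, 17, 18, 19, 20, 27, 28, 29, 30} m6 m7 \<and>
                grp m7 (newG G C) \<and> (\<forall>j<n. m7 3 j = real (new_label lev G C L j)) \<and> (0 < m7 12 0 \<longleftrightarrow> (\<exists>j<n. 0 < newG G C j))"
              have i7: "inp m7" by (rule inp_eqx[OF conjunct1[OF 7] _ i6]) simp
              have i8: "inp (store 4 0 (real (Suc lev)) m7)"
                by (rule inp_eqx[of "{4}" m7]) (use i7 in \<open>simp_all add: eqx_store\<close>)
              have f7: "m7 4 0 = real lev" "m7 7 0 = real Kr"
                using eqxD[OF conjunct1[OF 7]] s5 by (simp_all add: m6_def state_def)
              have a4: "store 4 (addr (aval (Lit 0) m7)) (aval (Plus (sc 4) (Lit 1)) m7) m7 = store 4 0 (real (Suc lev)) m7"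
                using f7 by (simp add: add.commute)
              show "runs (setv 4 (Plus (sc 4) (Lit 1))) m7 6 ?Q"
                by (rule runs_Assign, unfold a4) (use 7 i8 f7 in \<open>simp_all add: state_def grp_def\<close>)
            qed simp
            then have "runs (setv 12 (Lit 0)) m5 3 (\<lambda>m6. runs ?t6 m6 (15 + n * 600)
        ?Q)"
              by (intro runs_Assign) (simp_all add: m6_def)
            then show "runs ?t5 m5 (21 + n * 600) ?Q"
              by (rule runs_Seq) simp
          qed simp
        qed simp
      qed simp
    qed simp
  qed (use st in \<open>simp_all add: algebra_simps\<close>)
qed

end

section \<open>The loop over the levels\<close>

lemma runs_obtain: "runs c m T Q \<Longrightarrow> \<exists>m1. runs c m T (\<lambda>m'. m' = m1) \<and> Q m1"
  unfolding runs_def by blast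

context solution
begin

definition pot :: "(nat \<Rightarrow> nat) \<Rightarrow> (nat \<Rightarrow> nat) \<Rightarrow> real" where
  "pot G L = paid G L + 4 * real (1 + (r + b)\<^sup>2) * diam G * real (card (loose (active G) G))"

text \<open>Groups and labels will be decoded from the memory, where only the entries below
  \<open>n\<close> are under control.\<close>

lemma pot_cong:
  assumes "\<And>i. i < n \<Longrightarrow> G i = G' i" "\<And>i. i < n \<Longrightarrow> L i = L' i"
  shows "pot G L = pot G' L'"
proof -
  have le: "diam G \<le> diam G'" if "\<And>i. i < n \<Longrightarrow> G i = G' i" for G G'
    by (rule diam_le) (use that diam_nonneg in \<open>auto intro!: diam_ge\<close>)
  have "diam G = diam G'" using le[of G G'] le[of G' G] assms(1) by (simp add: antisym)
  moreover have act: "active G = active G'" using assms(1) by (auto simp: active_def)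
  moreover have "loose (active G) G = loose (active G') G'"
    unfolding loose_def act using assms(1) by (auto simp: active_def)
  moreover have Z: "{i. i < n \<and> G i = 0} = {i. i < n \<and> G' i = 0}" using assms(1) by auto
  then have "L ` {i. i < n \<and> G i = 0} = L' ` {i. i < n \<and> G' i = 0}"
    using assms(2) by (intro image_cong) auto
  moreover have "(\<lambda>l. {j. j < n \<and> G j = 0 \<and> L j = l}) = (\<lambda>l. {j. j < n \<and> G' j = 0 \<and> L' j = l})"
    using assms by (intro ext Collect_cong) auto
  ultimately have "parts G L = parts G' L'" unfolding parts_def by (simp only:)
  then show ?thesis using \<open>diam G = diam G'\<close> act \<open>loose (active G) G = loose (active G') G'\<close>
    unfolding pot_def paid_def by (simp only:)
qed

end

text \<open>\<open>\<kappa>\<close> measures how fine the shifts are: the rounding error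
  \<open>d / Kr\<close> of a cut, multiplied by the diameter, is at most \<open>\<kappa> * d\<close>
  times the distance of any two points. After \<open>J\<close> levels the diameter would be below
  the least distance.\<close>

locale fair_prog = euclid_prog +
  fixes dmin dmax \<kappa> :: real and J :: nat
  assumes D_eq: "D = 2 * (1 + (r + b) * (1 + (r + b)\<^sup>2))" and Kr_pos: "0 < Kr"
    and dmin: "0 < dmin" "\<And>i j. i < n \<Longrightarrow> j < n \<Longrightarrow> i \<noteq> j \<Longrightarrow> dmin \<le> \<delta> i j"
    and dmax: "\<And>i j. i < n \<Longrightarrow> j < n \<Longrightarrow> \<delta> i j \<le> dmax" "0 \<le> dmax"
    and \<kappa>: "dmax \<le> dmin * (\<kappa> * real Kr)" "0 \<le> \<kappa>"
    and J: "dmax < dmin * real D ^ J"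
begin

definition cells :: "(nat \<Rightarrow> nat) \<Rightarrow> real \<Rightarrow> real \<Rightarrow> nat \<Rightarrow> nat" where
  "cells G s u i = ckey (G i) (zs (s / real D) u i)"

definition optc :: real where
  "optc = (\<Sum>j<n. \<delta> j (ctr j))"

text \<open>The first factor is the weight of the potential, \<open>r + b\<close> is the number of
  points loosened by a separated one, and the rest is the bound of
  \<open>average_cut\<close>.\<close>

definition gain :: real where
  "gain = 4 * real (1 + (r + b)\<^sup>2) * (real (r + b) * (real d * (4 * real D + \<kappa>) * optc))"

definition pt :: "nat \<Rightarrow> point" where
  "pt i = map (X i) [0..<d]"

lemma zs_grid: "zs a u i = grid d a u (pt i)"
  by (simp add: zs_def grid_def pt_def)

lemma \<delta>_pt: "\<delta> i j = euclid_dist (pt i) (pt j)"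
  unfolding \<delta>_eq euclid_dist_def by (intro L2_set_cong) (simp_all add: pt_def)

lemma length_pt: "length (pt i) = d" by (simp add: pt_def)

lemma cells_inj: "cells G s u i = cells G s u j \<Longrightarrow> G i = G j \<and> zs (s / real D) u i = zs (s / real D) u j"
  unfolding cells_def by (rule ckey_inj) (simp_all add: zs_def)

lemma level_cells:
  assumes "\<And>g. 0 < g \<Longrightarrow> balanced {i. i < n \<and> G i = g}"
  shows "level n r b cl \<delta> opt ctr G (cells G s u)"
proof
  show "0 < cells G s u i" if "0 < G i" for i
    using that ckey_ge unfolding cells_def by (rule less_le_trans)
  show "G i = G j" if "cells G s u i = cells G s u j" for i j using cells_inj[OF that] by simp
qed (rule assms)

lemma diam_shrink:
  assumes "0 < s" "good_scale G s"
  shows "diam (newG G (cells G s u)) \<le> sqrt (real d) * (s / real D)"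
proof (rule diam_le)
  have D: "0 < s / real D" using assms(1) D_pos by simp
  then show "0 \<le> sqrt (real d) * (s / real D)" by (intro mult_nonneg_nonneg) simp_all
  fix i j assume ij: "i < n" "j < n" "newG G (cells G s u) i = newG G (cells G s u) j" "0 < newG G (cells G s u) i"
  then have "cells G s u i = cells G s u j" by (auto simp: newG_def split: if_splits)
  then have "zs (s / real D) u i = zs (s / real D) u j" using cells_inj by blast
  then show "\<delta> i j \<le> sqrt (real d) * (s / real D)"
    unfolding zs_grid \<delta>_pt by (rule grid_eq_dist[OF _ D length_pt])
qed

lemma diam_le_dmax: "diam G \<le> dmax"
  by (rule diam_le) (use dmax in auto)

text \<open>Exchanging the sums leaves, for each point, the probability of being separated from its
  centre. A point that is its own centre is never separated, and every other one is at distance at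
  least \<open>dmin\<close> from its centre, which pays for the rounding of the shifts.\<close>

lemma average_cut:
  assumes s: "0 < s" "good_scale G s"
  shows "diam G * ((\<Sum>k<Kr. real (card {j. j < n \<and> zs (s / real D) (real k / real Kr) j \<noteq> zs (s / real D) (real k / real Kr) (ctr j)})) / real Kr)
    \<le> real d * (4 * real D + \<kappa>) * optc"
proof -
  let ?a = "s / real D"
  let ?f = "\<lambda>k. zs ?a (real k / real Kr)"
  have D: "0 < real D" using D_pos by simp
  have "(\<Sum>k<Kr. real (card {j. j < n \<and> ?f k j \<noteq> ?f k (ctr j)}))
    = (\<Sum>k<Kr. \<Sum>j<n. if ?f k j \<noteq> ?f k (ctr j) then 1 else 0)"
    by (intro sum.cong refl) (simp add: sum.If_cases Int_def)
  also have "\<dots> = (\<Sum>j<n. \<Sum>k<Kr. if ?f k j \<noteq> ?f k (ctr j) then 1 else 0)" by (rule sum.swap)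
  also have "\<dots> = (\<Sum>j<n. real (card {k. k < Kr \<and> ?f k j \<noteq> ?f k (ctr j)}))"
    by (intro sum.cong refl) (simp add: sum.If_cases Int_def)
  finally have swap: "(\<Sum>k<Kr. real (card {j. j < n \<and> ?f k j \<noteq> ?f k (ctr j)}))
    = (\<Sum>j<n. real (card {k. k < Kr \<and> ?f k j \<noteq> ?f k (ctr j)}))" .
  have each: "diam G * (real (card {k. k < Kr \<and> ?f k j \<noteq> ?f k (ctr j)}) / real Kr) \<le> real d * (4 * real D + \<kappa>) * \<delta> j (ctr j)"
    if j: "j < n" for j
  proof (cases "j = ctr j")
    case True
    then have "{k. k < Kr \<and> ?f k j \<noteq> ?f k (ctr j)} = {}" by auto
    then show ?thesis using \<delta>_nonneg[of j "ctr j"] \<kappa>(2) by (simp only: card.empty) simp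
  next
    case False
    let ?x = "\<delta> j (ctr j)"
    have "real (card {k. k < Kr \<and> ?f k j \<noteq> ?f k (ctr j)}) \<le> real Kr * (sqrt (real d) * ?x / ?a) + real d"
      unfolding zs_grid \<delta>_pt using s(1) D by (intro card_grid_neq Kr_pos length_pt) simp
    then have "real (card {k. k < Kr \<and> ?f k j \<noteq> ?f k (ctr j)}) / real Kr
      \<le> (real Kr * (sqrt (real d) * ?x / ?a) + real d) / real Kr"
      by (rule divide_right_mono) simp
    also have "\<dots> = sqrt (real d) * ?x * real D / s + real d / real Kr"
      using Kr_pos s(1) D by (simp add: field_simps)
    finally have "diam G * (real (card {k. k < Kr \<and> ?f k j \<noteq> ?f k (ctr j)}) / real Kr)
      \<le> diam G * (sqrt (real d) * ?x * real D / s + real d / real Kr)"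
      by (intro mult_left_mono diam_nonneg)
    also have "\<dots> = diam G * (sqrt (real d) * ?x * real D / s) + diam G * (real d / real Kr)"
      by (simp add: distrib_left)
    \<comment> \<open>In the first summand the upper bound of \<open>good_scale\<close> makes
      \<open>s\<close> cancel; in the second, the diameter is at most \<open>dmax\<close>, hence at
      most \<open>dmin * \<kappa> * Kr\<close>.\<close>
    also have "\<dots> \<le> 4 * (sqrt (real d) * s) * (sqrt (real d) * ?x * real D / s) + (?x * (\<kappa> * real Kr)) * (real d / real Kr)"
    proof (intro add_mono mult_right_mono)
      show "diam G \<le> 4 * (sqrt (real d) * s)" using s(2) by (simp add: good_scale_def)
      have "dmin \<le> ?x" using dmin(2)[OF j ctr(1)[OF j] False] .
      then have "dmin * (\<kappa> * real Kr) \<le> ?x * (\<kappa> * real Kr)" using \<kappa>(2) by (intro mult_right_mono) simp_all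
      then show "diam G \<le> ?x * (\<kappa> * real Kr)" using diam_le_dmax[of G] \<kappa>(1) by linarith
    qed (use s(1) \<delta>_nonneg in simp_all)
    also have "\<dots> = real d * (4 * real D + \<kappa>) * ?x"
    proof -
      have "4 * (sqrt (real d) * s) * (sqrt (real d) * ?x * real D / s) = 4 * (sqrt (real d) * sqrt (real d)) * ?x * real D"
        using s(1) by (simp add: field_simps)
      moreover have "(?x * (\<kappa> * real Kr)) * (real d / real Kr) = ?x * \<kappa> * real d" using Kr_pos by simp
      ultimately show ?thesis by (simp add: algebra_simps)
    qed
    finally show ?thesis .
  qed
  have "diam G * ((\<Sum>k<Kr. real (card {j. j < n \<and> ?f k j \<noteq> ?f k (ctr j)})) / real Kr)
    = (\<Sum>j<n. diam G * (real (card {k. k < Kr \<and> ?f k j \<noteq> ?f k (ctr j)}) / real Kr))"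
    unfolding swap by (simp add: sum_divide_distrib sum_distrib_left)
  also have "\<dots> \<le> (\<Sum>j<n. real d * (4 * real D + \<kappa>) * \<delta> j (ctr j))" using each by (intro sum_mono) simp
  also have "\<dots> = real d * (4 * real D + \<kappa>) * optc" by (simp add: optc_def sum_distrib_left)
  finally show ?thesis .
qed

text \<open>The condition on labels says that finished points carry labels of earlier levels, which
  makes the labels of level \<open>j\<close> fresh. The last condition counts levels by the
  diameter.\<close>

definition inv :: "nat \<Rightarrow> memory \<Rightarrow> (nat \<Rightarrow> nat) \<Rightarrow> (nat \<Rightarrow> nat) \<Rightarrow> bool" where
  "inv j m G L \<longleftrightarrow> state m G L j \<and> (\<forall>g>0. balanced {i. i < n \<and> G i = g}) \<and> valid_parts G L \<and>
     (\<forall>i<n. G i = 0 \<longrightarrow> (\<exists>y l. L i = npair y l \<and> l < j)) \<and> diam G * real D ^ j \<le> dmax"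

text \<open>A single point misses one colour, so a balanced group has at least two points.\<close>

lemma diam_active:
  assumes "balanced {i. i < n \<and> G i = G i0}" "i0 < n" "0 < G i0"
  shows "dmin \<le> diam G"
proof -
  have "\<exists>j<n. j \<noteq> i0 \<and> G j = G i0"
  proof (rule ccontr)
    assume "\<not> ?thesis"
    then have s: "{i. i < n \<and> G i = G i0} = {i0}" using assms(2) by auto
    have "cnt {i0} x = (if cl i0 = x then 1 else 0)" for x by (simp add: cnt_def Collect_conv_if)
    then show False using assms(1) rb(1,2) cl[of i0] unfolding s balanced_def bal2_def by (auto simp: lt2)
  qed
  then obtain j where j: "j < n" "j \<noteq> i0" "G j = G i0" by blast
  have "dmin \<le> \<delta> i0 j" using dmin(2) assms(2) j by auto
  also have "\<dots> \<le> diam G" using assms j by (intro diam_ge) simp_all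
  finally show ?thesis .
qed

lemma level_step:
  assumes I: "inv j m G L" and s: "0 < s" "good_scale G s" and "state m' (newG G (cells G s u)) (new_label j G (cells G s u) L) (Suc j)"
  shows "inv (Suc j) m' (newG G (cells G s u)) (new_label j G (cells G s u) L)"
    "pot (newG G (cells G s u)) (new_label j G (cells G s u) L) \<le> pot G L +
      4 * real (1 + (r + b)\<^sup>2) * (real (r + b) * (diam G * real (card {j. j < n \<and> zs (s / real D) u j \<noteq> zs (s / real D) u (ctr j)})))"
proof -
  let ?C = "cells G s u"
  let ?L = "new_label j G ?C L"
  have bal: "balanced {i. i < n \<and> G i = g}" if "0 < g" for g using I that by (simp add: inv_def)
  interpret level n r b cl \<delta> opt ctr G ?C by (rule level_cells[OF bal])
  have sh: "diam (newG G ?C) \<le> sqrt (real d) * (s / real D)" by (rule diam_shrink[OF s])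
  have D: "0 < real D" using D_pos by simp
  have "real D * diam (newG G ?C) \<le> real D * (sqrt (real d) * (s / real D))" using sh by (intro mult_left_mono) simp_all
  also have "\<dots> = sqrt (real d) * s" using D by simp
  also have "\<dots> \<le> diam G" using s(2) by (simp add: good_scale_def)
  finally have shr: "real D * diam (newG G ?C) \<le> diam G" .
  have old: "?L i = L i" if "i < n" "G i = 0" for i using that by (simp add: new_label_def pooled_def)
  have lold: "\<exists>y l. L i = npair y l \<and> l < j" if "i < n" "G i = 0" for i using I that by (simp add: inv_def)
  have new: "?L i = npair (npair (G i) (pool_block G ?C i)) j" if "i \<in> pool" for i
    using that by (simp add: new_label_def pool_def)
  have a1: "?L i \<noteq> ?L i'" if "i < n" "G i = 0" "i' \<in> pool" for i i'
  proof -
    from lold[OF that(1,2)] obtain y l where "L i = npair y l" "l < j" by blast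
    then show ?thesis using npair_inj[of y l] unfolding old[OF that(1,2)] new[OF that(3)] by auto
  qed
  have a3: "?L i = ?L i' \<longleftrightarrow> G i = G i' \<and> pool_block G ?C i = pool_block G ?C i'" if "i \<in> pool" "i' \<in> pool" for i i'
    unfolding new[OF that(1)] new[OF that(2)] by (auto dest!: npair_inj)
  have vp: "valid_parts G L" using I by (simp add: inv_def)
  have "valid_parts (newG G ?C) ?L"
    by (rule paid_new(1)) (fact a1 old a3 vp)+
  moreover have "\<exists>y l. ?L i = npair y l \<and> l < Suc j" if i: "i < n" "newG G ?C i = 0" for i
  proof (cases "G i = 0")
    case True
    then show ?thesis using lold[OF i(1)] old[OF i(1)] less_SucI by metis
  next
    case False
    then have "i \<in> pool" using newG_0[OF i(1)] i by (simp add: pool_def)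
    then show ?thesis using new by blast
  qed
  moreover have "diam (newG G ?C) * real D ^ Suc j \<le> dmax"
  proof -
    have "diam (newG G ?C) * real D ^ Suc j = (real D * diam (newG G ?C)) * real D ^ j" by simp
    also have "\<dots> \<le> diam G * real D ^ j" using shr by (intro mult_right_mono) simp_all
    also have "\<dots> \<le> dmax" using I by (simp add: inv_def)
    finally show ?thesis .
  qed
  ultimately show "inv (Suc j) m' (newG G ?C) ?L"
    using assms(4) newG_balanced unfolding inv_def by blast
  have "paid (newG G ?C) ?L + 4 * real (1 + (r + b)\<^sup>2) * diam (newG G ?C) * real (card (loose (active (newG G ?C)) (newG G ?C)))
    \<le> paid G L + 4 * real (1 + (r + b)\<^sup>2) * diam G * real (card (loose (active G) G))
      + 4 * real (1 + (r + b)\<^sup>2) * diam G * (real (r + b) * real (card {j. j < n \<and> zs (s / real D) u j \<noteq> zs (s / real D) u (ctr j)}))"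
  proof (rule potential_step[OF _ _ _ vp _ refl refl])
    show "2 * real (1 + (r + b) * (1 + (r + b)\<^sup>2)) * diam (newG G ?C) \<le> diam G"
      using shr unfolding D_eq by (simp only: of_nat_mult of_nat_numeral)
    show "?C i = ?C i'" if "G i = G i'" "zs (s / real D) u i = zs (s / real D) u i'" for i i'
      using that by (simp add: cells_def)
  qed (fact a1 old a3)+
  then show "pot (newG G ?C) ?L \<le> pot G L +
      4 * real (1 + (r + b)\<^sup>2) * (real (r + b) * (diam G * real (card {j. j < n \<and> zs (s / real D) u j \<noteq> zs (s / real D) u (ctr j)})))"
    unfolding pot_def by (simp only: mult_ac)
qed

definition round :: com where
  "round = Seq level_head (Seq (Random 8 (Lit 0) (sc 7)) level_tail)"

definition round_cost :: nat where
  "round_cost = (41 + n * (80 + d * 112) + d * 20) + 5 + (77 + n * (1650 + d * 112))"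

text \<open>The potential as a function of the memory, since expectations are taken over final
  memories.\<close>

definition \<Phi> :: "memory \<Rightarrow> real" where
  "\<Phi> m = pot (\<lambda>i. addr (m 20 i)) (\<lambda>i. addr (m 3 i))"

lemma \<Phi>_state: "state m G L lev \<Longrightarrow> \<Phi> m = pot G L"
  unfolding \<Phi>_def by (rule pot_cong) (simp_all add: state_def grp_def)

lemma round_step:
  assumes I: "inv j m G L" and "0 < m 12 0"
  shows "j < J \<and> (\<exists>\<mu>. exec round m \<mu> \<and> (\<forall>(m', t)\<in>set_pmf \<mu>. t \<le> round_cost \<and> (\<exists>G L. inv (Suc j) m' G L)) \<and>
    expect \<mu> \<Phi> \<le> \<Phi> m + gain)"
proof
  have st: "state m G L j" using I by (simp add: inv_def)
  then obtain i0 where i0: "i0 < n" "0 < G i0" using assms(2) by (auto simp: state_def)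
  have dm: "dmin \<le> diam G" using I i0 by (intro diam_active[of _ i0]) (simp_all add: inv_def)
  have "1 < D" unfolding D_eq by simp
  then have D1: "1 < real D" by simp
  \<comment> \<open>The loop guard says that a group is left, so the diameter is at least
    \<open>dmin\<close>; after \<open>j\<close> levels it is at most
    \<open>dmax / D ^ j\<close>.\<close>
  have "dmin * real D ^ j \<le> diam G * real D ^ j" using dm by (intro mult_right_mono) simp_all
  also have "\<dots> \<le> dmax" using I by (simp add: inv_def)
  also have "\<dots> < dmin * real D ^ J" by (rule J)
  finally have "real D ^ j < real D ^ J" using dmin(1) by simp
  then show "j < J" using power_less_imp_less_exp[OF D1] by blast
  obtain m1 where h: "runs level_head m (41 + n * (80 + d * 112) + d * 20) (\<lambda>m'. m' = m1)"
    and m1: "state m1 G L j" "good_scale G (m1 10 0)"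
    using runs_obtain[OF level_head[OF st]] by blast
  define s where "s = m1 10 0"
  have gs: "good_scale G s" using m1 by (simp add: s_def)
  have "0 < diam G" using dm dmin(1) by simp
  \<comment> \<open>A scale 0 would force the diameter to be 0.\<close>
  then have s: "0 < s" using gs unfolding good_scale_def by (cases "s = 0") auto
  let ?C = "\<lambda>k. cells G s (real k / real Kr)"
  let ?Q = "\<lambda>k m'. state m' (newG G (?C k)) (new_label j G (?C k) L) (Suc j)"
  have tail: "runs level_tail (store 8 (addr (aval (Lit 0) m1)) (real k) m1) (77 + n * (1650 + d * 112)) (?Q k)" for k
  proof (rule level_tail)
    show "state (store 8 (addr (aval (Lit 0) m1)) (real k) m1) G L j"
      by (rule state_eqx[of "{8}" m1]) (use m1 in \<open>simp_all add: eqx_store\<close>)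
  qed (simp add: cells_def s_def fun_eq_iff)
  have "\<exists>\<mu> M. exec (Seq level_head (Seq (Random 8 (Lit 0) (sc 7)) level_tail)) m \<mu> \<and> (\<forall>k<Kr. ?Q k (M k)) \<and>
    (\<forall>(m', t)\<in>set_pmf \<mu>. t \<le> (41 + n * (80 + d * 112) + d * 20) + (1 + acost (Lit 0) + acost (sc 7)) + (77 + n * (1650 + d * 112)) \<and> (\<exists>k<Kr. m' = M k)) \<and>
    (\<forall>\<Phi>. expect \<mu> \<Phi> = (\<Sum>k<Kr. \<Phi> (M k)) / real Kr)"
    by (rule exec_Random_average[OF h]) (use m1 Kr_pos tail in \<open>auto simp: state_def\<close>)
  then obtain \<mu> M where \<mu>M: "exec (Seq level_head (Seq (Random 8 (Lit 0) (sc 7)) level_tail)) m \<mu>" "\<forall>k<Kr. ?Q k (M k)"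
    "\<forall>(m', t)\<in>set_pmf \<mu>. t \<le> (41 + n * (80 + d * 112) + d * 20) + (1 + acost (Lit 0) + acost (sc 7)) + (77 + n * (1650 + d * 112)) \<and> (\<exists>k<Kr. m' = M k)"
    "\<forall>\<Phi>. expect \<mu> \<Phi> = (\<Sum>k<Kr. \<Phi> (M k)) / real Kr"
    by (elim exE conjE)
  have ex: "exec round m \<mu>" using \<mu>M(1) by (simp only: round_def)
  have M: "?Q k (M k)" if "k < Kr" for k using \<mu>M(2) that by (elim allE impE)
  have \<mu>: "t \<le> round_cost \<and> (\<exists>k<Kr. m' = M k)" if "(m', t) \<in> set_pmf \<mu>" for m' t
    using bspec[OF \<mu>M(3) that] by (simp add: round_cost_def)
  have E: "expect \<mu> \<Phi> = (\<Sum>k<Kr. \<Phi> (M k)) / real Kr" using \<mu>M(4) by (rule spec)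
  have inv: "inv (Suc j) (M k) (newG G (?C k)) (new_label j G (?C k) L)" if "k < Kr" for k
    by (rule level_step(1)[OF I s gs M[OF that]])
  let ?A = "4 * real (1 + (r + b)\<^sup>2)"
  let ?N = "\<lambda>k. real (card {j. j < n \<and> zs (s / real D) (real k / real Kr) j \<noteq> zs (s / real D) (real k / real Kr) (ctr j)})"
  have "expect \<mu> \<Phi> \<le> (\<Sum>k<Kr. pot G L + ?A * (real (r + b) * (diam G * ?N k))) / real Kr"
    unfolding E
  proof (intro divide_right_mono sum_mono)
    fix k assume "k \<in> {..<Kr}"
    then have k: "k < Kr" by simp
    show "\<Phi> (M k) \<le> pot G L + ?A * (real (r + b) * (diam G * ?N k))"
      unfolding \<Phi>_state[OF M[OF k]] by (rule level_step(2)[OF I s gs M[OF k]])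
  qed simp
  also have "\<dots> = pot G L + ?A * (real (r + b) * (diam G * ((\<Sum>k<Kr. ?N k) / real Kr)))"
    using Kr_pos by (simp add: sum.distrib add_divide_distrib sum_distrib_left sum_divide_distrib)
  also have "\<dots> \<le> pot G L + gain"
    unfolding gain_def by (intro add_left_mono mult_left_mono average_cut s gs) simp_all
  finally have "expect \<mu> \<Phi> \<le> \<Phi> m + gain" unfolding \<Phi>_state[OF st] .
  moreover have "\<exists>G L. inv (Suc j) m' G L" if "(m', t) \<in> set_pmf \<mu>" for m' t
    using \<mu>[OF that] inv by blast
  ultimately show "\<exists>\<mu>. exec round m \<mu> \<and> (\<forall>(m', t)\<in>set_pmf \<mu>. t \<le> round_cost \<and> (\<exists>G L. inv (Suc j) m' G L)) \<and>
    expect \<mu> \<Phi> \<le> \<Phi> m + gain"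
    using ex \<mu> by blast
qed

lemma optc_nonneg: "0 \<le> optc" by (simp add: optc_def sum_nonneg \<delta>_nonneg)

lemma gain_nonneg: "0 \<le> gain"
  unfolding gain_def using optc_nonneg \<kappa>(2) by (intro mult_nonneg_nonneg) simp_all

lemma rounds:
  assumes "inv 0 m G L"
  shows "\<exists>\<mu>. exec (While (Less (Lit 0) (sc 12)) round) m \<mu> \<and>
    (\<forall>(m', t)\<in>set_pmf \<mu>. t \<le> J * (round_cost + 4) + 4 \<and> (\<exists>j G L. inv j m' G L \<and> (\<forall>i<n. G i = 0))) \<and>
    expect \<mu> \<Phi> \<le> \<Phi> m + real J * gain"
proof -
  let ?e = "Less (Lit 0) (sc 12)"
  have "\<exists>\<mu>. exec (While ?e round) m \<mu> \<and>
    (\<forall>(m', t)\<in>set_pmf \<mu>. t \<le> (J - 0) * (round_cost + bcost ?e) + bcost ?e \<and> (\<exists>j. \<exists>G L. inv j m' G L) \<and> \<not> bval ?e m') \<and>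
    expect \<mu> \<Phi> \<le> \<Phi> m + real (J - 0) * gain"
  proof (rule exec_While_expect[where I = "\<lambda>j m. \<exists>G L. inv j m G L"])
    show "j < J \<and> (\<exists>\<mu>. exec round m \<mu> \<and> (\<forall>(m', t)\<in>set_pmf \<mu>. t \<le> round_cost \<and> (\<exists>G L. inv (Suc j) m' G L)) \<and>
      expect \<mu> \<Phi> \<le> \<Phi> m + gain)" if "\<exists>G L. inv j m G L" "bval ?e m" for j m
      using that round_step by auto
  qed (use assms gain_nonneg in auto)
  then obtain \<mu> where ex: "exec (While ?e round) m \<mu>"
    and set: "\<forall>(m', t)\<in>set_pmf \<mu>. t \<le> (J - 0) * (round_cost + bcost ?e) + bcost ?e \<and> (\<exists>j. \<exists>G L. inv j m' G L) \<and> \<not> bval ?e m'"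
    and E: "expect \<mu> \<Phi> \<le> \<Phi> m + real (J - 0) * gain"
    by (elim exE conjE)
  have \<mu>: "t \<le> J * (round_cost + 4) + 4" "\<exists>j G L. inv j m' G L" "\<not> 0 < m' 12 0" if "(m', t) \<in> set_pmf \<mu>" for m' t
    using bspec[OF set that] by (simp_all add: algebra_simps)
  have "\<exists>j G L. inv j m' G L \<and> (\<forall>i<n. G i = 0)" if "(m', t) \<in> set_pmf \<mu>" for m' t
  proof -
    from \<mu>(2)[OF that] obtain j G L where "inv j m' G L" by blast
    moreover from this have "\<forall>i<n. G i = 0" 
      using \<mu>(3)[OF that] by (auto simp: inv_def state_def)
    ultimately show ?thesis by blast
  qed
  then have "\<forall>(m', t)\<in>set_pmf \<mu>. t \<le> J * (round_cost + 4) + 4 \<and> (\<exists>j G L. inv j m' G L \<and> (\<forall>i<n. G i = 0))"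
    using \<mu>(1) by blast
  with ex E show ?thesis by (intro exI[of _ \<mu>] conjI) simp_all
qed

end

section \<open>Optimal decompositions\<close>

context fairness
begin

text \<open>All points are treated as one pool and cut by \<open>block\<close>. This shows that a
  fairlet decomposition exists, so that the minimum in \<open>optimal_cost\<close> is over a
  nonempty set.\<close>

lemma fair_classes:
  assumes "balanced {..<n}"
  shows "\<exists>h :: nat \<Rightarrow> nat. \<forall>l. balanced {i. i < n \<and> h i = l} \<and> card {i. i < n \<and> h i = l} \<le> r + b"
proof -
  define h where "h i = block r b (rank (\<lambda>_. 0) i) (cnt {..<n} (cl i)) (cnt {..<n} (1 - cl i))" for i
  let ?c = "cnt {..<n}"
  have c: "cnt {i. i < n \<and> h i = l} x = card {p. p < ?c x \<and> block r b p (?c x) (?c (1 - x)) = l}" for x l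
  proof -
    let ?T = "{i. i < n \<and> cl i = x}"
    have rk: "rank (\<lambda>_. 0) i = card {j\<in>?T. j < i}" if "i \<in> ?T" for i
      using that by (auto simp: rank_def intro!: arg_cong[where f = card])
    have "{i\<in>{i. i < n \<and> h i = l}. cl i = x} = {i\<in>?T. block r b (card {j\<in>?T. j < i}) (?c x) (?c (1 - x)) = l}"
    proof (intro Collect_cong)
      fix i
      show "(i \<in> {i. i < n \<and> h i = l} \<and> cl i = x) = (i \<in> ?T \<and> block r b (card {j\<in>?T. j < i}) (?c x) (?c (1 - x)) = l)"
        using rk[of i] by (auto simp: h_def)
    qed
    then have "cnt {i. i < n \<and> h i = l} x = card {p. p < card ?T \<and> block r b p (?c x) (?c (1 - x)) = l}"
      unfolding cnt_def[of "{i. i < n \<and> h i = l}"]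
      by (simp only: card_rank_filter[of ?T "\<lambda>p. block r b p (?c x) (?c (1 - x)) = l"]
        finite_Collect_conjI finite_Collect_less_nat simp_thms)
    moreover have "card ?T = ?c x" unfolding cnt_def by (rule arg_cong[where f = card]) auto
    ultimately show ?thesis by simp
  qed
  have "balanced {i. i < n \<and> h i = l} \<and> card {i. i < n \<and> h i = l} \<le> r + b" for l
  proof -
    let ?D = "{i. i < n \<and> h i = l}"
    have "b * cnt ?D 0 \<le> r * cnt ?D 1 \<and> b * cnt ?D 1 \<le> r * cnt ?D 0 \<and> cnt ?D 0 + cnt ?D 1 \<le> r + b"
      using assms by (intro block_fair[OF rb(1,2), of "?c 0" "?c 1" _ l])
        (simp_all only: balanced_def bal2_def c diff_self_eq_0 diff_zero)
    then show ?thesis using cnt_add[of ?D] by (simp add: balanced_def bal2_def)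
  qed
  then show ?thesis by blast
qed

end

lemma euclid_dist_pos:
  assumes "length p = length q" "p \<noteq> q"
  shows "0 < euclid_dist p q"
proof -
  obtain t where t: "t < length p" "p ! t \<noteq> q ! t" using assms nth_equalityI by blast
  then have "(p ! t - q ! t)\<^sup>2 \<le> (\<Sum>i<length p. (p ! i - q ! i)\<^sup>2)"
    by (intro member_le_sum) auto
  then have "sqrt ((p ! t - q ! t)\<^sup>2) \<le> euclid_dist p q"
    unfolding euclid_dist_def L2_set_def by (rule real_sqrt_le_mono)
  then show ?thesis using t(2) by simp
qed

section \<open>Instances: the points of a list identified with their indices\<close>

locale instance_points =
  fixes r b d :: nat and ps :: "point list" and col :: "point \<Rightarrow> color"
  assumes rb: "1 \<le> b" "b \<le> r" "coprime r b" and d: "1 \<le> d" and dist: "distinct ps"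
    and len: "\<And>p. p \<in> set ps \<Longrightarrow> length p = d"
    and bal: "real b / real r \<le> balance col (set ps)"
begin

definition N where "N = length ps"
definition cl where "cl i = (if i < N \<and> col (ps ! i) = Red then 1 else 0 :: nat)"
definition X where "X i t = ps ! i ! t"
definition \<delta> where "\<delta> i j = L2_set (\<lambda>t. X i t - X j t) {..<d}"

sublocale fairness N r b cl
  by unfold_locales (use rb in \<open>auto simp: cl_def\<close>)

lemma nth_mem': "i < N \<Longrightarrow> ps ! i \<in> set ps" by (simp add: N_def)

lemma \<delta>_dist: "i < N \<Longrightarrow> \<delta> i j = euclid_dist (ps ! i) (ps ! j)"
  unfolding \<delta>_def euclid_dist_def X_def using len[OF nth_mem'] by simp

lemma inj_nth: "inj_on ((!) ps) {..<N}"
  using dist by (auto simp: inj_on_def N_def nth_eq_iff_index_eq)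

lemma image_nth: "(!) ps ` {..<N} = set ps"
  by (auto simp: N_def set_conv_nth)

lemma inj_nth_subset: "S \<subseteq> {..<N} \<Longrightarrow> inj_on ((!) ps) S"
  using inj_nth by (rule inj_on_subset)

lemma card_colours:
  assumes "S \<subseteq> {..<N}"
  shows "card (red_part col ((!) ps ` S)) = cnt S 1" "card (blue_part col ((!) ps ` S)) = cnt S 0"
proof -
  have "red_part col ((!) ps ` S) = (!) ps ` {i\<in>S. cl i = 1}"
    using assms by (auto simp: red_part_def cl_def)
  moreover have "blue_part col ((!) ps ` S) = (!) ps ` {i\<in>S. cl i = 0}"
    using assms color.exhaust by (auto simp: blue_part_def cl_def)
  ultimately show "card (red_part col ((!) ps ` S)) = cnt S 1" "card (blue_part col ((!) ps ` S)) = cnt S 0"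
    using assms by (simp_all add: cnt_def card_image inj_nth_subset subset_iff)
qed

lemma balance_iff:
  assumes "S \<subseteq> {..<N}" "S \<noteq> {}"
  shows "real b / real r \<le> balance col ((!) ps ` S) \<longleftrightarrow> balanced S"
proof -
  have "finite ((!) ps ` S)" using assms(1) finite_subset by auto
  then show ?thesis using assms rb balance_ge_iff[of "(!) ps ` S" b r col]
    by (auto simp: balanced_def bal2_def card_colours)
qed

lemma cost_median_nth:
  assumes "S \<subseteq> {..<N}"
  shows "cost_median euclid_dist ((!) ps ` S) = cost_median \<delta> S"
proof -
  have "(\<Sum>q\<in>(!) ps ` S. euclid_dist (ps ! i) q) = (\<Sum>j\<in>S. \<delta> i j)" if "i \<in> S" for i
  proof -
    have "i < N" using that assms by auto
    then show ?thesis by (simp add: sum.reindex[OF inj_nth_subset[OF assms]] \<delta>_dist)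
  qed
  then have "(\<lambda>p. \<Sum>q\<in>(!) ps ` S. euclid_dist p q) ` (!) ps ` S = (\<lambda>i. \<Sum>j\<in>S. \<delta> i j) ` S"
    unfolding image_image by (rule image_cong[OF refl])
  then show ?thesis by (simp only: cost_median_def)
qed

lemma nonempty: "set ps \<noteq> {}"
proof
  assume "set ps = {}"
  then have "balance col (set ps) = 0" by (simp add: balance_def red_part_def blue_part_def)
  then show False using bal rb by (simp add: divide_le_0_iff)
qed

lemma balanced_all: "balanced {..<N}"
proof -
  have "{..<N} \<noteq> {}" using nonempty by (simp add: N_def lessThan_empty_iff)
  then show ?thesis using bal balance_iff[of "{..<N}"] by (simp add: image_nth)
qed

lemma N_ge_2: "2 \<le> N"
proof (rule ccontr)
  assume "\<not> 2 \<le> N"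
  then have "N = 1" using nonempty by (cases N) (auto simp: N_def)
  then have "cnt {..<N} x = (if cl 0 = x then 1 else 0)" for x
    by (simp add: cnt_def Collect_conv_if lessThan_Suc)
  then show False using balanced_all rb(1,2) cl[of 0] unfolding balanced_def bal2_def by (auto simp: less_2_cases_iff)
qed

definition decs :: "point set set set" where
  "decs = {Y. fairlet_decomposition r b col (set ps) Y}"

lemma finite_decs: "finite decs"
proof -
  have "decs \<subseteq> Pow (Pow (set ps))"
    by (auto simp: decs_def fairlet_decomposition_def partition_on_def)
  then show ?thesis by (rule finite_subset) simp
qed

lemma fibres_decomposition:
  fixes h :: "nat \<Rightarrow> 'b"
  assumes "\<And>l. balanced {i. i < N \<and> h i = l}" "\<And>l. card {i. i < N \<and> h i = l} \<le> r + b"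
  shows "fairlet_decomposition r b col (set ps) ((\<lambda>l. (!) ps ` {i. i < N \<and> h i = l}) ` h ` {..<N})"
proof -
  let ?F = "\<lambda>l. {i. i < N \<and> h i = l}"
  have sub: "?F l \<subseteq> {..<N}" for l by auto
  have ne: "?F l \<noteq> {}" if "l \<in> h ` {..<N}" for l using that by auto
  have "partition_on (set ps) ((\<lambda>l. (!) ps ` ?F l) ` h ` {..<N})"
  proof (rule partition_onI)
    show "\<Union> ((\<lambda>l. (!) ps ` ?F l) ` h ` {..<N}) = set ps" unfolding image_nth[symmetric] by auto
    show "{} \<notin> (\<lambda>l. (!) ps ` ?F l) ` h ` {..<N}" by auto
    show "disjnt p q" if "p \<in> (\<lambda>l. (!) ps ` ?F l) ` h ` {..<N}" "q \<in> (\<lambda>l. (!) ps ` ?F l) ` h ` {..<N}" "p \<noteq> q" for p q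
    proof -
      note pq = that
      from that obtain l l' where l: "p = (!) ps ` ?F l" "q = (!) ps ` ?F l'" by blast
      then have "?F l \<inter> ?F l' = {}" using pq(3) by auto
      then have "p \<inter> q = {}" unfolding l using inj_on_image_Int[OF inj_nth sub sub, of l l'] by simp
      then show ?thesis by (simp add: disjnt_def)
    qed
  qed
  moreover have "card D \<le> r + b \<and> real b / real r \<le> balance col D" if "D \<in> (\<lambda>l. (!) ps ` ?F l) ` h ` {..<N}" for D
  proof -
    from that obtain l where l: "l \<in> h ` {..<N}" "D = (!) ps ` ?F l" by blast
    have "card D = card (?F l)" unfolding l(2) by (rule card_image[OF inj_nth_subset[OF sub]])
    then show ?thesis using assms(2)[of l] assms(1)[of l] balance_iff[OF sub ne[OF l(1)]] unfolding l(2) by simp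
  qed
  ultimately show ?thesis unfolding fairlet_decomposition_def by blast
qed

lemma decs_nonempty: "decs \<noteq> {}"
proof -
  obtain h :: "nat \<Rightarrow> nat" where h: "\<forall>l. balanced {i. i < N \<and> h i = l} \<and> card {i. i < N \<and> h i = l} \<le> r + b"
    using fair_classes[OF balanced_all] by (elim exE)
  have "fairlet_decomposition r b col (set ps) ((\<lambda>l. (!) ps ` {i. i < N \<and> h i = l}) ` h ` {..<N})"
    using h by (intro fibres_decomposition) simp_all
  then show ?thesis unfolding decs_def by (intro notI) (simp only: Collect_empty_eq)
qed

text \<open>The minimum is attained because there are finitely many decompositions and at least one.
  The fairlets of an optimal one are numbered by an injection into the naturals, and
  \<open>ctr\<close> picks a median in each.\<close>

lemma optimum:
  obtains opt ctr :: "nat \<Rightarrow> nat" where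
    "\<And>v. balanced {i. i < N \<and> opt i = v}" "\<And>v. card {i. i < N \<and> opt i = v} \<le> r + b"
    "\<And>i. i < N \<Longrightarrow> ctr i < N" "\<And>i. i < N \<Longrightarrow> opt (ctr i) = opt i"
    "\<And>i j. i < N \<Longrightarrow> j < N \<Longrightarrow> opt i = opt j \<Longrightarrow> ctr i = ctr j"
    "(\<Sum>j<N. \<delta> j (ctr j)) = optimal_cost r b euclid_dist col (set ps)"
proof -
  have "optimal_cost r b euclid_dist col (set ps) \<in> decomposition_cost euclid_dist ` decs"
    unfolding optimal_cost_def decs_def[symmetric] using finite_decs decs_nonempty by (intro Min_in) auto
  then obtain Y where Y: "Y \<in> decs" "optimal_cost r b euclid_dist col (set ps) = decomposition_cost euclid_dist Y"
    by blast
  have part: "partition_on (set ps) Y" and ok: "\<And>D. D \<in> Y \<Longrightarrow> card D \<le> r + b \<and> real b / real r \<le> balance col D"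
    using Y(1) by (auto simp: decs_def fairlet_decomposition_def)
  have un: "\<Union> Y = set ps" and dj: "disjoint Y" and ne: "{} \<notin> Y"
    using part by (simp_all add: partition_on_def)
  have finY: "finite Y" using un by (metis List.finite_set finite_UnionD)
  define idx where "idx D = {i. i < N \<and> ps ! i \<in> D}" for D
  have idx: "(!) ps ` idx D = D" "idx D \<subseteq> {..<N}" "idx D \<noteq> {}" if "D \<in> Y" for D
  proof -
    have "D \<subseteq> (!) ps ` {..<N}" using that un unfolding image_nth by blast
    then show im: "(!) ps ` idx D = D" by (auto simp: idx_def)
    show "idx D \<noteq> {}" using im that ne by auto
  qed (auto simp: idx_def)
  obtain e :: "point set \<Rightarrow> nat" where e: "inj_on e Y" using finY finite_imp_inj_to_nat_seg by metis
  have uniq: "D = D'" if "D \<in> Y" "D' \<in> Y" "x \<in> D" "x \<in> D'" for D D' x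
    using disjointD[OF dj that(1,2)] that(3,4) by blast
  have "\<exists>D\<in>Y. ps ! i \<in> D" if "i < N" for i using nth_mem'[OF that] un by blast
  then obtain part_of where po: "\<And>i. i < N \<Longrightarrow> part_of i \<in> Y \<and> ps ! i \<in> part_of i" by metis
  have po_eq: "part_of i = D" if "i < N" "D \<in> Y" "ps ! i \<in> D" for i D
    using uniq[OF _ that(2) _ that(3)] po[OF that(1)] by blast
  have "\<exists>i\<in>idx D. (\<Sum>j\<in>idx D. \<delta> i j) = cost_median \<delta> (idx D)" if "D \<in> Y" for D
  proof -
    have "cost_median \<delta> (idx D) \<in> (\<lambda>i. \<Sum>j\<in>idx D. \<delta> i j) ` idx D"
      unfolding cost_median_def using idx[OF that] finite_subset[OF idx(2)[OF that]] by (intro Min_in) auto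
    then show ?thesis by auto
  qed
  then obtain med where med: "\<And>D. D \<in> Y \<Longrightarrow> med D \<in> idx D \<and> (\<Sum>j\<in>idx D. \<delta> (med D) j) = cost_median \<delta> (idx D)"
    by metis
  define opt where "opt i = e (part_of i)" for i
  define ctr where "ctr i = med (part_of i)" for i
  have cls: "{i. i < N \<and> opt i = e D} = idx D" if "D \<in> Y" for D
  proof -
    have "e (part_of i) = e D \<longleftrightarrow> ps ! i \<in> D" if "i < N" for i
      using po[OF that] po_eq[OF that \<open>D \<in> Y\<close>] inj_onD[OF e] \<open>D \<in> Y\<close> by metis
    then show ?thesis unfolding opt_def idx_def by blast
  qed
  have fibre: "\<exists>D\<in>Y. {i. i < N \<and> opt i = v} = idx D" if "{i. i < N \<and> opt i = v} \<noteq> {}" for v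
  proof -
    from that obtain i where "i < N" "opt i = v" by blast
    then show ?thesis using cls po unfolding opt_def by blast
  qed
  have med': "med D < N" "part_of (med D) = D" if "D \<in> Y" for D
    using med[OF that] po_eq that by (auto simp: idx_def)
  show ?thesis
  proof (rule that)
    fix v
    show "balanced {i. i < N \<and> opt i = v}"
    proof (cases "{i. i < N \<and> opt i = v} = {}")
      case True
      show ?thesis unfolding True by (simp add: balanced_def cnt_def bal2_def)
    next
      case False
      then obtain D where D: "D \<in> Y" "{i. i < N \<and> opt i = v} = idx D" using fibre by blast
      show ?thesis unfolding D(2) using balance_iff[OF idx(2,3)[OF D(1)]] ok[OF D(1)] idx(1)[OF D(1)] by simp
    qed
    show "card {i. i < N \<and> opt i = v} \<le> r + b"
    proof (cases "{i. i < N \<and> opt i = v} = {}")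
      case True
      show ?thesis unfolding True by simp
    next
      case False
      then obtain D where D: "D \<in> Y" "{i. i < N \<and> opt i = v} = idx D" using fibre by blast
      have "card (idx D) = card D"
        using card_image[OF inj_nth_subset[OF idx(2)[OF D(1)]]] idx(1)[OF D(1)] by simp
      then show ?thesis unfolding D(2) using ok[OF D(1)] by simp
    qed
  next
    fix i assume i: "i < N"
    show "ctr i < N" "opt (ctr i) = opt i" unfolding ctr_def opt_def using med' po[OF i] by simp_all
    fix j assume "j < N" "opt i = opt j"
    then show "ctr i = ctr j" unfolding ctr_def opt_def using inj_onD[OF e] po i by metis
  next
    have \<delta>_sym: "\<delta> i j = \<delta> j i" for i j unfolding \<delta>_def L2_set_def by (simp add: power2_commute)
    have "(\<Sum>j<N. \<delta> j (ctr j)) = (\<Sum>D\<in>Y. \<Sum>j\<in>{j\<in>{..<N}. part_of j = D}. \<delta> j (ctr j))"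
      using po by (intro sum.group[symmetric] finY) auto
    also have "\<dots> = (\<Sum>D\<in>Y. cost_median euclid_dist D)"
    proof (rule sum.cong[OF refl])
      fix D assume D: "D \<in> Y"
      have "{j\<in>{..<N}. part_of j = D} = idx D" using po po_eq D by (auto simp: idx_def)
      then have "(\<Sum>j\<in>{j\<in>{..<N}. part_of j = D}. \<delta> j (ctr j)) = (\<Sum>j\<in>idx D. \<delta> (med D) j)"
        using po_eq[OF _ D] by (intro sum.cong) (auto simp: ctr_def idx_def \<delta>_sym)
      also have "\<dots> = cost_median euclid_dist D"
        using med[OF D] cost_median_nth[OF idx(2)[OF D]] idx(1)[OF D] by simp
      finally show "(\<Sum>j\<in>{j\<in>{..<N}. part_of j = D}. \<delta> j (ctr j)) = cost_median euclid_dist D" .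
    qed
    finally show "(\<Sum>j<N. \<delta> j (ctr j)) = optimal_cost r b euclid_dist col (set ps)"
      using Y(2) by (simp add: decomposition_cost_def)
  qed
qed

end

section \<open>The algorithm\<close>

text \<open>The range of the shifts has to outgrow \<open>n ^ c\<close> for every exponent
  \<open>c\<close>; \<open>n ^ n\<close> does so and takes only \<open>n\<close>
  multiplications.\<close>

definition setup_code :: com where
  "setup_code = Seq (setv 7 (Lit 1)) (Seq (For 5 points (Seq (setv 7 (Times (sc 7) points)) (Assign 20 (sc 5) (Lit 1))))
     (setv 12 (Lit 1)))"

definition ratio :: "nat \<Rightarrow> nat \<Rightarrow> nat" where
  "ratio r b = 2 * (1 + (r + b) * (1 + (r + b)\<^sup>2))"

definition algorithm :: "nat \<Rightarrow> nat \<Rightarrow> com" where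
  "algorithm r b = Seq setup_code (While (Less (Lit 0) (sc 12)) (fair_prog.round r b (ratio r b)))"

lemma (in euclid_prog) setup_code:
  assumes "inp m" "\<And>j. m 3 j = 0" "m 4 0 = 0" "1 \<le> n" "Kr = n ^ n"
  shows "runs setup_code m (15 + n * 40) (\<lambda>m'. state m' (\<lambda>_. 1) (\<lambda>_. 0) 0)"
  unfolding setup_code_def
proof (rule runs_chain[where P = "\<lambda>m'. m' = store 7 0 1 m" and S = 3])
  show "runs (setv 7 (Lit 1)) m 3 (\<lambda>m'. m' = store 7 0 1 m)" by (rule runs_Assign) simp_all
  fix m1 assume m1: "m1 = store 7 0 1 m"
  have inp1: "inp m1" by (rule inp_eqx[of "{7}" m]) (use assms in \<open>simp_all add: m1 eqx_store\<close>)
  have "runs (For 5 points (Seq (setv 7 (Times (sc 7) points)) (Assign 20 (sc 5) (Lit 1)))) m1 (9 + n * 40)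
    (\<lambda>m'. eqx {5, 7, 20} m1 m' \<and> m' 7 0 = real (n ^ n) \<and> (\<forall>j<n. m' 20 j = 1))"
  proof (rule runs_For[where N = n and T = 28 and
      I = "\<lambda>i m'. eqx {5, 7, 20} m1 m' \<and> m' 7 0 = real (n ^ i) \<and> (\<forall>j<i. m' 20 j = 1)"], goal_cases)
    case 1
    then show ?case by (simp add: m1 eqx_store)
  next
    case (2 i m')
    then show ?case using inp1 eqxD[of "{5, 7, 20}" m1 m' 0] by (simp add: inp_def)
  next
    case (3 i m')
    have "m' 0 0 = real n" using inp1 eqxD[of "{5, 7, 20}" m1 m' 0] 3(2) by (simp add: inp_def)
    then show ?case using 3
      by (intro runs_straight) (simp_all add: eqx_store less_Suc_eq mult.commute)
  qed simp_all
  then show "runs (Seq (For 5 points (Seq (setv 7 (Times (sc 7) points)) (Assign 20 (sc 5) (Lit 1)))) (setv 12 (Lit 1))) m1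
    (12 + n * 40) (\<lambda>m'. state m' (\<lambda>_. 1) (\<lambda>_. 0) 0)"
  proof (rule runs_chain[where T = 3])
    fix m2 assume 2: "eqx {5, 7, 20} m1 m2 \<and> m2 7 0 = real (n ^ n) \<and> (\<forall>j<n. m2 20 j = 1)"
    have "inp m2" by (rule inp_eqx[OF conjunct1[OF 2] _ inp1]) simp
    then have "inp (store 12 0 1 m2)" by (rule inp_eqx[of "{12}" m2, rotated 2]) (simp_all add: eqx_store)
    moreover have "m2 3 = m 3" "m2 4 = m 4" using eqxD[OF conjunct1[OF 2]] by (simp_all add: m1)
    moreover have "\<exists>j. j < n" using assms(4) by (intro exI[of _ 0]) simp
    ultimately have "state (store 12 0 1 m2) (\<lambda>_. 1) (\<lambda>_. 0) 0"
      unfolding state_def grp_def using 2 assms by auto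
    then show "runs (setv 12 (Lit 1)) m2 3 (\<lambda>m'. state m' (\<lambda>_. 1) (\<lambda>_. 0) 0)" by (intro runs_Assign) simp_all
  qed simp
qed simp

context instance_points
begin

lemma aspect_bounds:
  assumes "aspect_ratio (set ps) \<le> real N ^ c"
  obtains dmin dmax where "0 < dmin" "\<And>i j. i < N \<Longrightarrow> j < N \<Longrightarrow> i \<noteq> j \<Longrightarrow> dmin \<le> \<delta> i j"
    "\<And>i j. i < N \<Longrightarrow> j < N \<Longrightarrow> \<delta> i j \<le> dmax" "0 \<le> dmax" "dmax \<le> dmin * real N ^ c"
proof -
  let ?E = "{euclid_dist p q | p q. p \<in> set ps \<and> q \<in> set ps \<and> p \<noteq> q}"
  have "?E \<subseteq> (\<lambda>(p, q). euclid_dist p q) ` (set ps \<times> set ps)" by auto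
  then have fin: "finite ?E" by (rule finite_subset) simp
  have mem: "\<delta> i j \<in> ?E" if "i < N" "j < N" "i \<noteq> j" for i j
  proof -
    have "ps ! i \<noteq> ps ! j" using that dist by (simp add: nth_eq_iff_index_eq N_def)
    then show ?thesis unfolding \<delta>_dist[OF that(1)] using nth_mem'[OF that(1)] nth_mem'[OF that(2)] by blast
  qed
  have ne: "?E \<noteq> {}" using mem[of 0 1] N_ge_2 by auto
  have pos: "0 < x" if "x \<in> ?E" for x using that euclid_dist_pos len by auto
  have Mn: "0 < Min ?E" using Min_in[OF fin ne] pos by blast
  have Mx: "0 < Max ?E" using Max_in[OF fin ne] pos by blast
  have "Max ?E / Min ?E \<le> real N ^ c" using assms by (simp add: aspect_ratio_def)
  then have le: "Max ?E \<le> Min ?E * real N ^ c" using Mn by (simp add: pos_divide_le_eq mult.commute)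
  show ?thesis
  proof (rule that[OF Mn _ _ _ le])
    show "Min ?E \<le> \<delta> i j" if "i < N" "j < N" "i \<noteq> j" for i j using mem[OF that] fin by (rule Min_le[rotated])
    show "\<delta> i j \<le> Max ?E" if "i < N" "j < N" for i j
    proof (cases "i = j")
      case True
      then show ?thesis using Mx by (simp add: \<delta>_def L2_set_def)
    next
      case False
      show ?thesis using mem[OF that False] fin by (rule Max_ge[rotated])
    qed
    show "0 \<le> Max ?E" using Mx by simp
  qed
qed

text \<open>For \<open>c \<le> N\<close> the second factor suffices, for \<open>N < c\<close> the
  first: this is the origin of \<open>c ^ c\<close> in the approximation factor.\<close>

lemma power_bound: "real N ^ c \<le> real (c ^ c) * real (N ^ N)"
proof (cases "c \<le> N")
  case True
  have "N ^ c \<le> N ^ N" using True N_ge_2 by (intro power_increasing) simp_all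
  moreover have "1 \<le> c ^ c" by (cases "c = 0") (simp_all add: Suc_le_eq)
  ultimately have "N ^ c \<le> c ^ c * N ^ N" using mult_le_mono[of 1 "c ^ c" "N ^ c" "N ^ N"] by simp
  then show ?thesis by (metis of_nat_le_iff of_nat_mult of_nat_power)
next
  case False
  then have "N ^ c \<le> c ^ c" by (intro power_mono) simp_all
  moreover have "1 \<le> N ^ N" using N_ge_2 by simp
  ultimately have "N ^ c \<le> c ^ c * N ^ N" using mult_le_mono[of "N ^ c" "c ^ c" 1 "N ^ N"] by simp
  then show ?thesis by (metis of_nat_le_iff of_nat_mult of_nat_power)
qed

lemma ratio_ge: "22 \<le> ratio r b"
proof -
  have q: "2 \<le> r + b" using rb by simp
  have "2\<^sup>2 \<le> (r + b)\<^sup>2" using q by (rule power_mono) simp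
  then have "2 * 5 \<le> (r + b) * (1 + (r + b)\<^sup>2)" using q by (intro mult_le_mono) simp_all
  then show ?thesis by (simp add: ratio_def)
qed

lemma run:
  assumes asp: "aspect_ratio (set ps) \<le> real N ^ c"
  shows "\<exists>J \<mu>. real J \<le> 1 + real c * log (real (ratio r b)) (real N) \<and> exec (algorithm r b) (input_memory d ps col) \<mu> \<and>
    (\<forall>(m, t)\<in>set_pmf \<mu>. t \<le> N * d * (60 + J * 2101) \<and> fairlet_decomposition r b col (set ps) (output_decomposition ps m)) \<and>
    expect \<mu> (\<lambda>m. decomposition_cost euclid_dist (output_decomposition ps m)) \<le>
      real J * (4 * real (1 + (r + b)\<^sup>2) * (real (r + b) * (real d * (4 * real (ratio r b) + real (c ^ c)) *
        optimal_cost r b euclid_dist col (set ps))))"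
proof -
  let ?D = "ratio r b"
  obtain dmin dmax where dm: "0 < dmin" "\<And>i j. i < N \<Longrightarrow> j < N \<Longrightarrow> i \<noteq> j \<Longrightarrow> dmin \<le> \<delta> i j"
    "\<And>i j. i < N \<Longrightarrow> j < N \<Longrightarrow> \<delta> i j \<le> dmax" "0 \<le> dmax" "dmax \<le> dmin * real N ^ c"
  proof (rule aspect_bounds[OF asp], goal_cases)
    case (1 dmin dmax)
    show ?case by (rule 1(1)) (fact 1)+
  qed
  obtain opt ctr :: "nat \<Rightarrow> nat" where o: "\<And>v. balanced {i. i < N \<and> opt i = v}" "\<And>v. card {i. i < N \<and> opt i = v} \<le> r + b"
    "\<And>i. i < N \<Longrightarrow> ctr i < N" "\<And>i. i < N \<Longrightarrow> opt (ctr i) = opt i"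
    "\<And>i j. i < N \<Longrightarrow> j < N \<Longrightarrow> opt i = opt j \<Longrightarrow> ctr i = ctr j"
    "(\<Sum>j<N. \<delta> j (ctr j)) = optimal_cost r b euclid_dist col (set ps)"
  proof (rule optimum, goal_cases)
    case (1 opt ctr)
    show ?case by (rule 1(1)) (fact 1)+
  qed
  have D1: "1 < real ?D" using ratio_ge by linarith
  have N1: "1 \<le> real N" using N_ge_2 by simp
  \<comment> \<open>The least number of levels with \<open>N ^ c < D ^ J\<close>; the successor
    makes the inequality strict.\<close>
  define J where "J = Suc (nat \<lfloor>real c * log (real ?D) (real N)\<rfloor>)"
  have lg: "0 \<le> real c * log (real ?D) (real N)" using D1 N1 by simp
  then have Jle: "real J \<le> 1 + real c * log (real ?D) (real N)" unfolding J_def by simp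
  have "real c * log (real ?D) (real N) < real J" unfolding J_def using lg by linarith
  then have "log (real ?D) (real N ^ c) < real J" using N1 by (simp add: log_nat_power)
  then have "real N ^ c < real ?D powr real J" using D1 N1 by (simp add: log_less_iff)
  then have ND: "real N ^ c < real ?D ^ J" using D1 by (simp add: powr_realpow)
  have "dmax < dmin * real ?D ^ J"
    using dm(5) mult_strict_left_mono[OF ND dm(1)] by linarith
  note J = this
  have \<kappa>: "dmax \<le> dmin * (real (c ^ c) * real (N ^ N))"
    using dm(5) mult_left_mono[OF power_bound[of c], of dmin] dm(1) by linarith
  interpret fair_prog N r b cl d ?D X \<delta> opt ctr "N ^ N" dmin dmax "real (c ^ c)" J
  proof unfold_locales
    show "0 \<le> \<delta> i j" for i j by (simp add: \<delta>_def)
    show "1 \<le> ?D" using D1 by linarith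
    show "0 < N ^ N" using N_ge_2 by simp
    show "0 \<le> real (c ^ c)" by simp
  qed (fact o dm J \<kappa> \<delta>_def d ratio_def)+
  let ?m = "input_memory d ps col"
  have inp: "inp ?m"
    unfolding inp_def
  proof (intro conjI allI impI)
    show "?m 0 0 = real N" "?m 0 1 = real d" by (simp_all add: input_memory_def N_def)
    fix i assume i: "i < N"
    show "?m 2 i = real (cl i)" using i by (simp add: input_memory_def cl_def N_def)
    fix t assume t: "t < d"
    have "Suc i * d \<le> N * d" using i by (intro mult_le_mono1) simp
    then have "i * d + t < N * d" using t by simp
    moreover have "(i * d + t) div d = i" "(i * d + t) mod d = t" using t by simp_all
    ultimately show "?m 1 (i * d + t) = X i t" by (simp add: input_memory_def X_def N_def)
  qed
  have "runs setup_code ?m (15 + N * 40) (\<lambda>m'. state m' (\<lambda>_. 1) (\<lambda>_. 0) 0)"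
    by (rule setup_code) (use inp N_ge_2 in \<open>simp_all add: input_memory_def\<close>)
  then obtain m1 t1 where m1: "exec setup_code ?m (return_pmf (m1, t1))" "t1 \<le> 15 + N * 40" "state m1 (\<lambda>_. 1) (\<lambda>_. 0) 0"
    unfolding runs_def by blast
  have "balanced {i. i < N \<and> (1 :: nat) = g}" for g
  proof (cases "g = 1")
    case True
    have "{i. i < N \<and> (1 :: nat) = g} = {..<N}" using True by auto
    then show ?thesis using balanced_all by simp
  qed (simp add: balanced_def bal2_def cnt_def)
  moreover have p0: "parts (\<lambda>_. 1) (\<lambda>_. 0) = {}" by (simp add: parts_def)
  moreover have "diam (\<lambda>_. 1) \<le> dmax" by (rule diam_le_dmax)
  ultimately have inv0: "inv 0 m1 (\<lambda>_. 1) (\<lambda>_. 0)" using m1(3) by (simp add: inv_def valid_parts_def)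
  \<comment> \<open>Initially all points form one group, so no fairlet is cut and nothing has been
    paid.\<close>
  have "loose (active (\<lambda>_. 1)) (\<lambda>_. 1 :: nat) = {}" by (simp add: loose_def)
  then have \<Phi>0: "\<Phi> m1 = 0" unfolding \<Phi>_state[OF m1(3)] pot_def paid_def p0 by simp
  obtain \<mu> where ex: "exec (While (Less (Lit 0) (sc 12)) (fair_prog.round r b ?D)) m1 \<mu>"
    and set: "\<forall>(m', t)\<in>set_pmf \<mu>. t \<le> J * (round_cost + 4) + 4 \<and> (\<exists>j G L. inv j m' G L \<and> (\<forall>i<N. G i = 0))"
    and E: "expect \<mu> \<Phi> \<le> \<Phi> m1 + real J * gain"
    using rounds[OF inv0] by (elim exE conjE)
  \<comment> \<open>Once all points are finished, the fibres of the labels are the output, and with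
    no active point the potential is exactly its cost.\<close>
  have out: "fairlet_decomposition r b col (set ps) (output_decomposition ps m') \<and>
      decomposition_cost euclid_dist (output_decomposition ps m') = \<Phi> m'"
    if "inv j m' G L" "\<forall>i<N. G i = 0" for j m' G L
  proof -
    let ?F = "\<lambda>l. {i. i < N \<and> L i = l}"
    have st: "state m' G L j" and vp: "valid_parts G L" using that(1) by (simp_all add: inv_def)
    have 3: "m' 3 i = real (L i)" if "i < N" for i using st that by (simp add: state_def)
    have o: "output_decomposition ps m' = (\<lambda>l. (!) ps ` ?F l) ` L ` {..<N}"
      unfolding output_decomposition_def image_image N_def[symmetric]
    proof (rule image_cong[OF refl])
      fix i assume "i \<in> {..<N}"
      then show "{ps ! j |j. j < N \<and> m' 3 j = m' 3 i} = (!) ps ` ?F (L i)" using 3 by auto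
    qed
    have pts: "parts G L = ?F ` L ` {..<N}"
    proof -
      have "{i. i < N \<and> G i = 0} = {..<N}" using that(2) by auto
      moreover have "{j. j < N \<and> G j = 0 \<and> L j = l} = ?F l" for l using that(2) by auto
      ultimately show ?thesis unfolding parts_def by simp
    qed
    have F: "balanced (?F l) \<and> card (?F l) \<le> r + b" for l
    proof (cases "l \<in> L ` {..<N}")
      case True
      then have "?F l \<in> parts G L" unfolding pts by blast
      then show ?thesis using vp by (simp add: valid_parts_def)
    next
      case False
      then have e: "?F l = {}" by auto
      show ?thesis unfolding e by (simp add: balanced_def cnt_def bal2_def)
    qed
    have fd: "fairlet_decomposition r b col (set ps) (output_decomposition ps m')"
      unfolding o using F by (intro fibres_decomposition) simp_all
    have injF: "inj_on ?F (L ` {..<N})"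
    proof (rule inj_onI)
      fix l l' assume l: "l \<in> L ` {..<N}" and e: "?F l = ?F l'"
      from l obtain i where "i \<in> ?F l" by blast
      then show "l = l'" using e by blast
    qed
    have injP: "inj_on (\<lambda>l. (!) ps ` ?F l) (L ` {..<N})"
    proof (rule inj_onI)
      fix l l' assume l: "l \<in> L ` {..<N}" "l' \<in> L ` {..<N}" and e: "(!) ps ` ?F l = (!) ps ` ?F l'"
      have "?F l = ?F l'" using e inj_on_image_eq_iff[OF inj_nth, of "?F l" "?F l'"] by auto
      then show "l = l'" using l by (rule inj_onD[OF injF])
    qed
    have "decomposition_cost euclid_dist (output_decomposition ps m') = (\<Sum>l\<in>L ` {..<N}. cost_median \<delta> (?F l))"
      unfolding decomposition_cost_def o sum.reindex[OF injP] o_def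
      by (intro sum.cong refl cost_median_nth) auto
    also have "\<dots> = paid G L" unfolding paid_def pts sum.reindex[OF injF] o_def ..
    also have "\<dots> = \<Phi> m'"
    proof -
      have "active G = {}" using that(2) by (auto simp: active_def)
      then show ?thesis unfolding \<Phi>_state[OF st] pot_def by (simp add: loose_def)
    qed
    finally show ?thesis using fd by simp
  qed
  have ex2: "exec (algorithm r b) ?m (tick t1 \<mu>)"
  proof -
    have "exec (Seq setup_code (While (Less (Lit 0) (sc 12)) (fair_prog.round r b ?D))) ?m
        (bind_pmf (return_pmf (m1, t1)) (\<lambda>(m', t). tick t \<mu>))"
      by (rule exec.Seq[OF m1(1)]) (use ex in auto)
    then show ?thesis by (simp add: algorithm_def bind_return_pmf)
  qed
  have fin: "finite (set_pmf (tick t1 \<mu>))" using exec_finite[OF ex] by (simp add: tick_def)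
  have cost: "15 + N * 40 + (J * (round_cost + 4) + 4) \<le> N * d * (60 + J * 2101)"
  proof -
    have a: "1 \<le> N * d" "N \<le> N * d" "d \<le> N * d" using d N_ge_2 by simp_all
    have "round_cost + 4 = 127 + 1730 * N + 20 * d + 224 * (N * d)"
      unfolding round_cost_def by (simp add: algebra_simps)
    \<comment> \<open>Here 2101 is \<open>127 + 1730 + 20 + 224\<close>, as 1, \<open>N\<close> and
      \<open>d\<close> are all at most \<open>N * d\<close>.\<close>
    then have "round_cost + 4 \<le> 2101 * (N * d)" using a by linarith
    then have "J * (round_cost + 4) \<le> J * (2101 * (N * d))" by (rule mult_le_mono2)
    also have "\<dots> = N * d * (J * 2101)" by simp
    finally have "J * (round_cost + 4) \<le> N * d * (J * 2101)" .
    moreover have "15 + N * 40 + 4 \<le> N * d * 60" using a by linarith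
    ultimately show ?thesis unfolding distrib_left by linarith
  qed
  have end_: "t \<le> N * d * (60 + J * 2101) \<and> fairlet_decomposition r b col (set ps) (output_decomposition ps m') \<and>
      decomposition_cost euclid_dist (output_decomposition ps m') = \<Phi> m'" if mt: "(m', t) \<in> set_pmf (tick t1 \<mu>)" for m' t
  proof -
    from mt obtain t2 where t2: "(m', t2) \<in> set_pmf \<mu>" "t = t1 + t2" by (auto simp: tick_def)
    from bspec[OF set t2(1)] have *: "t2 \<le> J * (round_cost + 4) + 4" "\<exists>j G L. inv j m' G L \<and> (\<forall>i<N. G i = 0)" by simp_all
    then show ?thesis using out cost m1(2) t2(2) by (meson add_mono le_trans)
  qed
  have "expect (tick t1 \<mu>) (\<lambda>m. decomposition_cost euclid_dist (output_decomposition ps m)) \<le> expect (tick t1 \<mu>) \<Phi>"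
    using end_ by (intro expect_mono[OF fin]) (metis order_refl)
  also have "\<dots> \<le> real J * gain" using E \<Phi>0 by (simp add: expect_tick)
  also have "gain = 4 * real (1 + (r + b)\<^sup>2) * (real (r + b) * (real d * (4 * real ?D + real (c ^ c)) *
        optimal_cost r b euclid_dist col (set ps)))"
    unfolding gain_def optc_def o(6) ..
  finally show ?thesis using Jle ex2 end_ by blast
qed

lemma optimal_cost_nonneg: "0 \<le> optimal_cost r b euclid_dist col (set ps)"
proof -
  obtain opt ctr :: "nat \<Rightarrow> nat" where "(\<Sum>j<N. \<delta> j (ctr j)) = optimal_cost r b euclid_dist col (set ps)"
  proof (rule optimum, goal_cases)
    case (1 opt ctr)
    show ?case by (rule 1(1)) (fact 1)+
  qed
  moreover have "0 \<le> (\<Sum>j<N. \<delta> j (ctr j))" by (intro sum_nonneg) (simp add: \<delta>_def)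
  ultimately show ?thesis by simp
qed

end

text \<open>For the first bound, \<open>r ^ 5 + b ^ 5 \<le> (r + b) ^ 5 \<le> D ^ 5\<close>, so
  passing to the new base costs a factor 5. For the second, \<open>D\<close> exceeds Euler's number,
  and the additive 1 is at most \<open>2 * ln n\<close> because \<open>n \<ge> 2\<close>.\<close>

lemma level_bound:
  assumes "1 \<le> b" "b \<le> r" "2 \<le> n" and J: "J \<le> 1 + real c * log (real (ratio r b)) n"
  shows "J \<le> 1 + 5 * real c * max 1 (log (real (r ^ 5 + b ^ 5)) n)" "J \<le> (2 + real c) * ln n"
proof -
  let ?D = "real (ratio r b)" and ?\<gamma> = "real (r ^ 5 + b ^ 5)"
  have q: "2 \<le> r + b" using assms by simp
  have "r + b \<le> ratio r b" unfolding ratio_def by (simp add: algebra_simps)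
  have "2\<^sup>2 \<le> (r + b)\<^sup>2" using q by (rule power_mono) simp
  then have "2 * 5 \<le> (r + b) * (1 + (r + b)\<^sup>2)" using q by (intro mult_le_mono) simp_all
  then have "22 \<le> ratio r b" by (simp add: ratio_def)
  then have D22: "22 \<le> ?D" by linarith
  have "exp 1 \<le> ?D" using exp_le D22 by linarith
  then have lnD: "1 \<le> ln ?D" using D22 by (simp add: ln_ge_iff)
  have lnn: "0 \<le> ln n" using assms(3) by simp
  have "1 ^ 5 \<le> r ^ 5" "1 ^ 5 \<le> b ^ 5" using assms by (intro power_mono; simp)+
  then have "2 \<le> r ^ 5 + b ^ 5" by simp
  then have \<gamma>2: "2 \<le> ?\<gamma>" by (metis of_nat_le_iff of_nat_numeral)
  have "r ^ 4 \<le> (r + b) ^ 4" "b ^ 4 \<le> (r + b) ^ 4" by (intro power_mono; simp)+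
  then have "r * r ^ 4 + b * b ^ 4 \<le> r * (r + b) ^ 4 + b * (r + b) ^ 4" by (intro add_mono mult_le_mono2)
  also have "\<dots> = (r + b) ^ 5" by (simp add: power_Suc2 numeral_eq_Suc algebra_simps)
  finally have "r ^ 5 + b ^ 5 \<le> (r + b) ^ 5" by (simp add: numeral_eq_Suc)
  also have "\<dots> \<le> ratio r b ^ 5" using \<open>r + b \<le> ratio r b\<close> by (intro power_mono) simp_all
  finally have "?\<gamma> \<le> ?D ^ 5" by (metis of_nat_le_iff of_nat_power)
  then have "ln ?\<gamma> \<le> ln (?D ^ 5)" using \<gamma>2 D22 by (subst ln_le_cancel_iff) auto
  also have "\<dots> = 5 * ln ?D" using D22 by (simp add: ln_realpow)
  finally have \<gamma>D: "ln ?\<gamma> \<le> 5 * ln ?D" .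
  have ln\<gamma>: "0 < ln ?\<gamma>" using \<gamma>2 by simp
  have "ln n * ln ?\<gamma> \<le> ln n * (5 * ln ?D)" using lnn \<gamma>D by (rule mult_left_mono[rotated])
  then have "log ?D n \<le> 5 * log ?\<gamma> n"
    unfolding log_def using lnD ln\<gamma> by (simp add: divide_simps mult_ac)
  also have "\<dots> \<le> 5 * max 1 (log ?\<gamma> n)" by simp
  finally have "real c * log ?D n \<le> real c * (5 * max 1 (log ?\<gamma> n))" by (rule mult_left_mono) simp
  then show "J \<le> 1 + 5 * real c * max 1 (log ?\<gamma> n)" using J by (simp add: mult_ac)
  have "ln n * 1 \<le> ln n * ln ?D" using lnn lnD by (rule mult_left_mono[rotated])
  then have "log ?D n \<le> ln n" unfolding log_def using lnD by (simp add: divide_simps)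
  then have "real c * log ?D n \<le> real c * ln n" by (rule mult_left_mono) simp
  moreover have "1 \<le> 2 * ln n"
  proof -
    \<comment> \<open>This gives \<open>ln 2 \<ge> 1 / 2\<close>.\<close>
    have "ln (1 / 2 :: real) \<le> 1 / 2 - 1" by (rule ln_le_minus_one) simp
    then have "1 \<le> 2 * ln (2 :: real)" by (simp add: ln_div)
    also have "\<dots> \<le> 2 * ln n" using assms(3) by simp
    finally show ?thesis .
  qed
  ultimately show "J \<le> (2 + real c) * ln n" using J by (simp add: distrib_right)
qed

text \<open>With \<open>q = r + b\<close> the three factors are at most \<open>5 * q ^ 2\<close>,
  \<open>q\<close> and \<open>(12 + \<kappa>) * q ^ 3\<close>. Then
  \<open>q ^ 6 \<le> 64 * r ^ 6 \<le> 64 * r ^ 8\<close>, and 320 is \<open>5 * 64\<close>.\<close>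

lemma gain_bound:
  assumes "1 \<le> b" "b \<le> r" "0 \<le> \<kappa>" "0 \<le> y"
  shows "4 * real (1 + (r + b)\<^sup>2) * (real (r + b) * ((4 * real (ratio r b) + \<kappa>) * y))
    \<le> 320 * (12 + \<kappa>) * real (r ^ 8 + b ^ 8) * y"
proof -
  let ?q = "r + b"
  have q: "2 \<le> ?q" using assms by simp
  have q2: "4 \<le> ?q\<^sup>2" using power_mono[OF q, of 2] by simp
  have "4 * (1 + ?q\<^sup>2) \<le> 5 * ?q\<^sup>2" using q2 by simp
  then have 1: "4 * real (1 + ?q\<^sup>2) \<le> 5 * real ?q ^ 2"
    by (metis (mono_tags, lifting) of_nat_le_iff of_nat_mult of_nat_numeral of_nat_power)
  have "4 * ?q \<le> ?q ^ 3" "2 * 4 \<le> ?q ^ 3"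
    using mult_le_mono[OF q2 le_refl[of ?q]] mult_le_mono[OF q q2] by (simp_all add: numeral_eq_Suc algebra_simps)
  moreover have "?q * ?q\<^sup>2 = ?q ^ 3" by (simp add: numeral_eq_Suc)
  ultimately have "4 * ratio r b \<le> 12 * ?q ^ 3" unfolding ratio_def distrib_left by simp
  then have "4 * real (ratio r b) \<le> 12 * real ?q ^ 3"
    by (metis (mono_tags, lifting) of_nat_le_iff of_nat_mult of_nat_numeral of_nat_power)
  moreover have "\<kappa> * 1 \<le> \<kappa> * real ?q ^ 3" using q assms(3) by (intro mult_left_mono one_le_power) simp_all
  ultimately have 2: "4 * real (ratio r b) + \<kappa> \<le> (12 + \<kappa>) * real ?q ^ 3" by (simp add: distrib_right)
  have "real ?q ^ 6 \<le> (2 * real r) ^ 6" using assms by (intro power_mono) simp_all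
  also have "\<dots> = 64 * real r ^ 6" by (simp add: power_mult_distrib)
  also have "\<dots> \<le> 64 * real r ^ 8" using assms by (intro mult_left_mono power_increasing) simp_all
  also have "\<dots> \<le> 64 * real (r ^ 8 + b ^ 8)" by simp
  finally have 3: "real ?q ^ 6 \<le> 64 * real (r ^ 8 + b ^ 8)" .
  have "4 * real (1 + ?q\<^sup>2) * (real ?q * ((4 * real (ratio r b) + \<kappa>) * y))
    \<le> 5 * real ?q ^ 2 * (real ?q * (((12 + \<kappa>) * real ?q ^ 3) * y))"
  proof (rule mult_mono[OF 1])
    show "real ?q * ((4 * real (ratio r b) + \<kappa>) * y) \<le> real ?q * (((12 + \<kappa>) * real ?q ^ 3) * y)"
      using 2 assms(4) by (intro mult_left_mono mult_right_mono) simp_all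
    show "0 \<le> real ?q * ((4 * real (ratio r b) + \<kappa>) * y)"
      using assms(3,4) by (intro mult_nonneg_nonneg add_nonneg_nonneg) simp_all
  qed simp
  also have "\<dots> = 5 * ((12 + \<kappa>) * y) * real ?q ^ 6" by (simp add: numeral_eq_Suc)
  also have "\<dots> \<le> 5 * ((12 + \<kappa>) * y) * (64 * real (r ^ 8 + b ^ 8))"
    using 3 assms(3,4) by (intro mult_left_mono mult_nonneg_nonneg) simp_all
  also have "5 * (k * y) * (64 * R) = 320 * k * R * y" for k R :: real by simp
  finally show ?thesis .
qed

context instance_points
begin

text \<open>The maximum with 1 covers small \<open>n\<close>, where the logarithm to base
  \<open>r ^ 5 + b ^ 5\<close> is below 1 although a level is always carried out.\<close>

lemma algorithm_correct:
  assumes asp: "aspect_ratio (set ps) \<le> real (length ps) ^ c"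
  shows "\<exists>\<mu>. exec (algorithm r b) (input_memory d ps col) \<mu> \<and>
    (\<forall>(m, t)\<in>set_pmf \<mu>.
      real t \<le> (2161 + 10505 * real c) * real d * real (length ps) * max 1 (log (real (r ^ 5 + b ^ 5)) (real (length ps))) \<and>
      fairlet_decomposition r b col (set ps) (output_decomposition ps m)) \<and>
    measure_pmf.expectation \<mu> (\<lambda>(m, t). decomposition_cost euclid_dist (output_decomposition ps m))
      \<le> (320 * (12 + real (c ^ c)) * (2 + real c)) * real d * real (r ^ 8 + b ^ 8) * ln (real (length ps)) *
        optimal_cost r b euclid_dist col (set ps)"
proof -
  let ?n = "real N" and ?O = "optimal_cost r b euclid_dist col (set ps)"
  let ?M = "max 1 (log (real (r ^ 5 + b ^ 5)) ?n)"
  obtain J \<mu> where J: "real J \<le> 1 + real c * log (real (ratio r b)) ?n"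
    and ex: "exec (algorithm r b) (input_memory d ps col) \<mu>"
    and t: "\<forall>(m, t)\<in>set_pmf \<mu>. t \<le> N * d * (60 + J * 2101) \<and> fairlet_decomposition r b col (set ps) (output_decomposition ps m)"
    and E: "expect \<mu> (\<lambda>m. decomposition_cost euclid_dist (output_decomposition ps m)) \<le>
      real J * (4 * real (1 + (r + b)\<^sup>2) * (real (r + b) * (real d * (4 * real (ratio r b) + real (c ^ c)) * ?O)))"
    using run[OF asp[folded N_def]] by (elim exE conjE)
  have n2: "2 \<le> ?n" using N_ge_2 by simp
  note JB = level_bound[OF rb(1,2) n2 J]
  have time: "real t' \<le> (2161 + 10505 * real c) * real d * ?n * ?M" if "t' \<le> N * d * (60 + J * 2101)" for t'
  proof -
    have "real t' \<le> real (N * d * (60 + J * 2101))" using that by (simp only: of_nat_le_iff)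
    also have "\<dots> = (?n * real d) * (60 + 2101 * real J)" by simp
    also have "\<dots> \<le> (?n * real d) * ((2161 + 10505 * real c) * ?M)"
    proof (rule mult_left_mono)
      \<comment> \<open>By the bound on \<open>J\<close>, with \<open>2161 = 60 + 2101\<close> and
        \<open>10505 = 5 * 2101\<close>.\<close>
      have "60 + 2101 * real J \<le> 2161 * 1 + 10505 * (real c * ?M)" using JB(1) by (simp add: mult_ac)
      also have "\<dots> \<le> 2161 * ?M + 10505 * (real c * ?M)" by (intro add_right_mono mult_left_mono) simp_all
      finally show "60 + 2101 * real J \<le> (2161 + 10505 * real c) * ?M" by (simp add: distrib_right)
    qed simp
    finally show ?thesis by (simp only: mult_ac)
  qed
  have O0: "0 \<le> ?O" by (rule optimal_cost_nonneg)
  have "4 * real (1 + (r + b)\<^sup>2) * (real (r + b) * ((4 * real (ratio r b) + real (c ^ c)) * (real d * ?O)))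
    \<le> 320 * (12 + real (c ^ c)) * real (r ^ 8 + b ^ 8) * (real d * ?O)" (is "?L \<le> ?R")
    using O0 by (intro gain_bound rb) simp_all
  with JB(2) have "real J * ?L \<le> ((2 + real c) * ln ?n) * ?R"
  proof (rule mult_mono)
    show "0 \<le> (2 + real c) * ln ?n" using n2 by (intro mult_nonneg_nonneg) simp_all
    show "0 \<le> ?L" using O0 by (intro mult_nonneg_nonneg add_nonneg_nonneg) simp_all
  qed
  with E have "expect \<mu> (\<lambda>m. decomposition_cost euclid_dist (output_decomposition ps m)) \<le> ((2 + real c) * ln ?n) * ?R"
    by (simp only: mult_ac)
  then have "measure_pmf.expectation \<mu> (\<lambda>(m, t). decomposition_cost euclid_dist (output_decomposition ps m))
      \<le> (320 * (12 + real (c ^ c)) * (2 + real c)) * real d * real (r ^ 8 + b ^ 8) * ln ?n * ?O"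
    unfolding expect_def case_prod_unfold by (simp only: mult_ac)
  moreover have "\<forall>(m, t)\<in>set_pmf \<mu>. real t \<le> (2161 + 10505 * real c) * real d * ?n * ?M \<and>
      fairlet_decomposition r b col (set ps) (output_decomposition ps m)"
    using t time by blast
  ultimately show ?thesis using ex unfolding N_def by blast
qed

end

theorem theorem3p3:
  "\<exists>(\<gamma> :: nat \<Rightarrow> nat \<Rightarrow> real) (C\<^sub>t :: nat \<Rightarrow> real) (C\<^sub>a :: nat \<Rightarrow> real) (c\<^sub>1 :: real) (c\<^sub>2 :: real).
     c\<^sub>1 > 0 \<and>
     (\<forall>r b :: nat. 1 \<le> b \<and> b \<le> r \<and> coprime r b \<longrightarrow>
        \<gamma> r b \<ge> 2 \<and>
        c\<^sub>1 * real (r ^ 5 + b ^ 5) \<le> \<gamma> r b \<and> \<gamma> r b \<le> c\<^sub>2 * real (r ^ 5 + b ^ 5) \<and>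
        (\<exists>alg :: com. \<forall>(c :: nat) (d :: nat) (ps :: point list) (col :: point \<Rightarrow> color).
           d \<ge> 1 \<and> distinct ps \<and> (\<forall>p\<in>set ps. length p = d) \<and>
           balance col (set ps) \<ge> real b / real r \<and>
           aspect_ratio (set ps) \<le> real (length ps) ^ c \<longrightarrow>
           (let n = real (length ps) in
            \<exists>\<mu>. exec alg (input_memory d ps col) \<mu> \<and>
              (\<forall>(m, t)\<in>set_pmf \<mu>.
                 real t \<le> C\<^sub>t c * real d * n * max 1 (log (\<gamma> r b) n) \<and>
                 fairlet_decomposition r b col (set ps) (output_decomposition ps m)) \<and>
              measure_pmf.expectation \<mu>
                  (\<lambda>(m, t). decomposition_cost euclid_dist (output_decomposition ps m))
                \<le> C\<^sub>a c * real d * real (r ^ 8 + b ^ 8) * ln n *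
                   optimal_cost r b euclid_dist col (set ps))))"
\<comment> \<open>The witnesses stay schematic here and are fixed by the facts shown below:
  \<open>\<gamma> r b\<close> is \<open>r ^ 5 + b ^ 5\<close> itself, with both constants around it
  equal to 1.\<close>
proof (intro exI conjI allI impI)
  show "(0 :: real) < 1" by simp
  fix r b :: nat assume rb: "1 \<le> b \<and> b \<le> r \<and> coprime r b"
  have "1 ^ 5 \<le> r ^ 5" "1 ^ 5 \<le> b ^ 5" using rb by (intro power_mono; simp)+
  then have "2 \<le> r ^ 5 + b ^ 5" by simp
  then show "2 \<le> real (r ^ 5 + b ^ 5)" by (metis of_nat_le_iff of_nat_numeral)
  show "1 * real (r ^ 5 + b ^ 5) \<le> real (r ^ 5 + b ^ 5)" "real (r ^ 5 + b ^ 5) \<le> 1 * real (r ^ 5 + b ^ 5)" by simp_all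
  fix c d :: nat and ps :: "point list" and col :: "point \<Rightarrow> color"
  assume a: "d \<ge> 1 \<and> distinct ps \<and> (\<forall>p\<in>set ps. length p = d) \<and>
           balance col (set ps) \<ge> real b / real r \<and> aspect_ratio (set ps) \<le> real (length ps) ^ c"
  interpret instance_points r b d ps col by unfold_locales (use rb a in simp_all)
  show "let n = real (length ps) in
            \<exists>\<mu>. exec (algorithm r b) (input_memory d ps col) \<mu> \<and>
              (\<forall>(m, t)\<in>set_pmf \<mu>.
                 real t \<le> (2161 + 10505 * real c) * real d * n * max 1 (log (real (r ^ 5 + b ^ 5)) n) \<and>
                 fairlet_decomposition r b col (set ps) (output_decomposition ps m)) \<and>
              measure_pmf.expectation \<mu>
                  (\<lambda>(m, t). decomposition_cost euclid_dist (output_decomposition ps m))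
                \<le> (320 * (12 + real (c ^ c)) * (2 + real c)) * real d * real (r ^ 8 + b ^ 8) * ln n *
                   optimal_cost r b euclid_dist col (set ps)"
    unfolding Let_def by (rule algorithm_correct) (use a in simp)
qed

end
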